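(* Let $M^n$ be a closed SYS manifold with aspherical class $\tau=[M]\frown(\beta_1\smile\cdots\smile\beta_{n-2})\in H_2(M)$, where $\beta_1,\dots,\beta_{n-2}\in H^1(M)$, and let $\Gamma\subset M$ be a closed embedded submanifold. If $\tau$ is not in the subgroup of $H_2(M)$ generated by the image of $H_2(\Gamma)\to H_2(M)$ and the image of the Hurewicz map $\pi_2(M)\to H_2(M)$, then $M\setminus\Gamma$ is weakly SYS.
   Context: All homology and cohomology groups have integer coefficients. A closed orientable manifold $M^n$ is SYS if there are $\beta_1,\dots,\beta_{n-2}\in H^1(M)$ such that $\tau:=[M]\frown(\beta_1\smile\cdots\smile\beta_{n-2})\in H_2(M)$ does not lie in the image of the Hurewicz map $\pi_2(M)\to H_2(M)$; such a $\tau$ is called aspherical. In the following definitions $M$ denotes an arbitrary $n$-manifold without boundary (possibly non-compact) with an exhaustion $K_1\subseteq K_2\subseteq\cdots$ by compact sets (with $K_i\subset \mathrm{Int}\,K_{i+1}$). An end of $M$ is a decreasing sequence $U_1\supseteq U_2\supseteq\cdots$ where $U_i$ is a connected component of $M\setminus K_i$. Let $\mathcal B(M)$ be the collection of subsets $V\subset M$ with compact boundary. For $V\in\mathcal B(M)$, $\partial_\infty V$ denotes the collection of ends $\{U_i\}$ with $U_i\subset V$ for all sufficiently large $i$. Put $C_*(M,\partial_\infty V):=\varprojlim_i C_*(M,V\setminus K_i)$ (singular chains), with homology $H_*(M,\partial_\infty V)$, and $H^*(M,\partial_\infty V):=\varinjlim_i H^*(M,V\setminus K_i)$. With $V^c=M\setminus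 V$, write $\partial_sM:=\partial_\infty V$ and $\partial_bM:=\partial_\infty V^c$; then $\partial_\infty M=\partial_sM\sqcup\partial_bM$ is called the ends-decomposition induced by $V$. The cap product with the fundamental class $[M]\in H_n(M,\partial_\infty M)$ maps $H^k(M,\partial_bM)$ to $H_{n-k}(M,\partial_sM)$. If $\Omega\subset M$ is closed and $\overline{\Omega\,\Delta\, V^c}$ is compact, then $V\setminus K_i\subset M\setminus\Omega$ for large $i$, and for $\tau\in H_2(M,\partial_sM)$ the restricted class $\tau|_\Omega\in H_2(M,M\setminus\Omega)$ is the image of $\tau$ under $H_2(M,\partial_sM)\to H_2(M,V\setminus K_i)\to H_2(M,M\setminus\Omega)$. A class $\tau\in H_2(M,\partial_sM)$ is strongly spherical if for every closed $\Omega\subset M$ with $\overline{\Omega\,\Delta\,V^c}$ compact, $\tau|_\Omega$ is in the image of the composition $\pi_2(M)\to H_2(M)\to H_2(M,M\setminus\Omega)$ of the Hurewicz map with the natural map (if $M$ is disconnected: the subgroup generated by classes of maps $S^2\to M$); otherwise $\tau$ is weakly aspherical. An orientable manifold $M^n$ (possibly open) is weakly SYS if there are $V\in\mathcal B(M)$, with induced ends-decomposition $\partial_\infty M=\partial_sM\sqcup\partial_bM$, a class $\beta_1\in H^1(M,\partial_bM)$ and classes $\beta_2,\dots,\beta_{n-2}\in H^1(M)$ such that $[M]\frown(\beta_1\smile\cdots\smile\beta_{n-2})\in H_2(M,\partial_sM)$ is weakly aspherical. *)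

theory Defs
  imports "HOL-Analysis.Analysis" "HOL-Homology.Homology"
begin

section \<open>Topological manifolds\<close>

definition manifold :: "nat \<Rightarrow> 'a topology \<Rightarrow> bool" where
  "manifold n X \<longleftrightarrow>
     Hausdorff_space X \<and> second_countable X \<and>
     (\<forall>x \<in> topspace X. \<exists>U W. openin X U \<and> x \<in> U \<and> openin (Euclidean_space n) W \<and>
        subtopology X U homeomorphic_space subtopology (Euclidean_space n) W)"

definition closed_manifold :: "nat \<Rightarrow> 'a topology \<Rightarrow> bool" where
  "closed_manifold n X \<longleftrightarrow> manifold n X \<and> compact_space X"

definition closed_embedded_submanifold :: "'a topology \<Rightarrow> 'a set \<Rightarrow> bool" where
  "closed_embedded_submanifold X \<Gamma> \<longleftrightarrow>
     \<Gamma> \<subseteq> topspace X \<and> (\<exists>k. closed_manifold k (subtopology X \<Gamma>))"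

text \<open>An orientation chooses generators of the local homology groups \<open>H\<^sub>n(X, X - {x})\<close>
  in a locally consistent way.\<close>

definition orientation :: "nat \<Rightarrow> 'a topology \<Rightarrow> ('a \<Rightarrow> 'a chain set) \<Rightarrow> bool" where
  "orientation n X \<mu> \<longleftrightarrow>
     (\<forall>x \<in> topspace X.
        \<mu> x \<in> carrier (relative_homology_group (int n) X (topspace X - {x})) \<and>
        generate (relative_homology_group (int n) X (topspace X - {x})) {\<mu> x}
          = carrier (relative_homology_group (int n) X (topspace X - {x}))) \<and>
     (\<forall>x \<in> topspace X. \<exists>U. openin X U \<and> x \<in> U \<and>
        (\<exists>\<alpha> \<in> carrier (relative_homology_group (int n) X (topspace X - U)). \<forall>y \<in> U.
           hom_induced (int n) X (topspace X - U) X (topspace X - {y}) id \<alpha> = \<mu> y))"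

text \<open>The fundamental class of a closed manifold with orientation \<open>\<mu>\<close>.\<close>

definition fundamental_class :: "nat \<Rightarrow> 'a topology \<Rightarrow> ('a \<Rightarrow> 'a chain set) \<Rightarrow> 'a chain set \<Rightarrow> bool"
  where
  "fundamental_class n X \<mu> \<zeta> \<longleftrightarrow>
     \<zeta> \<in> carrier (homology_group (int n) X) \<and>
     (\<forall>x \<in> topspace X. hom_induced (int n) X {} X (topspace X - {x}) id \<zeta> = \<mu> x)"


section \<open>Singular cohomology with integer coefficients\<close>

text \<open>A cochain is a function on singular simplices, extended by \<open>0\<close> to all functions that are
  not singular simplices of the right degree; relative cochains of \<open>(X, S)\<close> vanish on the
  simplices in \<open>S\<close>.\<close>

type_synonym 'a cochain = "((nat \<Rightarrow> real) \<Rightarrow> 'a) \<Rightarrow> int"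

definition singular_cochain :: "nat \<Rightarrow> 'a topology \<Rightarrow> 'a set \<Rightarrow> 'a cochain \<Rightarrow> bool" where
  "singular_cochain p X S \<phi> \<longleftrightarrow>
     (\<forall>\<sigma>. \<not> singular_simplex p X \<sigma> \<longrightarrow> \<phi> \<sigma> = 0) \<and>
     (\<forall>\<sigma>. singular_simplex p (subtopology X S) \<sigma> \<longrightarrow> \<phi> \<sigma> = 0)"

definition cochain_eval :: "'a cochain \<Rightarrow> 'a chain \<Rightarrow> int" where
  "cochain_eval \<phi> c = (\<Sum>\<sigma> \<in> Poly_Mapping.keys c. Poly_Mapping.lookup c \<sigma> * \<phi> \<sigma>)"

definition coboundary :: "nat \<Rightarrow> 'a topology \<Rightarrow> 'a cochain \<Rightarrow> 'a cochain" where
  "coboundary p X \<phi> = (\<lambda>\<sigma>. if singular_simplex (Suc p) X \<sigma>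
     then cochain_eval \<phi> (chain_boundary (Suc p) (frag_of \<sigma>)) else 0)"

definition cocycle_group :: "nat \<Rightarrow> 'a topology \<Rightarrow> 'a set \<Rightarrow> 'a cochain monoid" where
  "cocycle_group p X S =
     \<lparr>carrier = {\<phi>. singular_cochain p X S \<phi> \<and> coboundary p X \<phi> = (\<lambda>_. 0)},
      monoid.mult = (\<lambda>\<phi> \<psi> \<sigma>. \<phi> \<sigma> + \<psi> \<sigma>),
      one = (\<lambda>_. 0)\<rparr>"

definition coboundary_set :: "nat \<Rightarrow> 'a topology \<Rightarrow> 'a set \<Rightarrow> 'a cochain set" where
  "coboundary_set p X S =
     (if p = 0 then {\<lambda>_. 0} else coboundary (p - 1) X ` Collect (singular_cochain (p - 1) X S))"

definition relative_cohomology_group :: "nat \<Rightarrow> 'a topology \<Rightarrow> 'a set \<Rightarrow> 'a cochain set monoid" where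
  "relative_cohomology_group p X S = cocycle_group p X S Mod coboundary_set p X S"

abbreviation cohomology_group :: "nat \<Rightarrow> 'a topology \<Rightarrow> 'a cochain set monoid" where
  "cohomology_group p X \<equiv> relative_cohomology_group p X {}"

definition cohomology_class :: "nat \<Rightarrow> 'a topology \<Rightarrow> 'a set \<Rightarrow> 'a cochain \<Rightarrow> 'a cochain set" where
  "cohomology_class p X S \<phi> = coboundary_set p X S #>\<^bsub>cocycle_group p X S\<^esub> \<phi>"

text \<open>The map \<open>H\<^sup>p(X, S) \<rightarrow> H\<^sup>p(X, T)\<close> for \<open>T \<subseteq> S\<close>. Here and below, maps between quotient
  groups are written as unions over all representatives.\<close>

definition cohomology_restrict :: "nat \<Rightarrow> 'a topology \<Rightarrow> 'a set \<Rightarrow> 'a cochain set \<Rightarrow> 'a cochain set"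
  where "cohomology_restrict p X T b = (\<Union>\<phi> \<in> b. cohomology_class p X T \<phi>)"


section \<open>Cup and cap products\<close>

text \<open>The restrictions of a singular simplex with vertices \<open>v\<^sub>0, v\<^sub>1, \<dots>\<close> to \<open>[v\<^sub>0, \<dots>, v\<^sub>k]\<close>
  and to \<open>[v\<^sub>k, \<dots>, v\<^sub>k\<^sub>+\<^sub>l]\<close>.\<close>

definition front_face :: "nat \<Rightarrow> ((nat \<Rightarrow> real) \<Rightarrow> 'a) \<Rightarrow> (nat \<Rightarrow> real) \<Rightarrow> 'a" where
  "front_face k \<sigma> = restrict \<sigma> (standard_simplex k)"

definition back_face :: "nat \<Rightarrow> nat \<Rightarrow> ((nat \<Rightarrow> real) \<Rightarrow> 'a) \<Rightarrow> (nat \<Rightarrow> real) \<Rightarrow> 'a" where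
  "back_face k l \<sigma> =
     restrict (\<lambda>x. \<sigma> (\<lambda>i. if i < k then 0 else x (i - k))) (standard_simplex l)"

definition cup :: "nat \<Rightarrow> nat \<Rightarrow> 'a topology \<Rightarrow> 'a cochain \<Rightarrow> 'a cochain \<Rightarrow> 'a cochain" where
  "cup p q X \<phi> \<psi> = (\<lambda>\<sigma>. if singular_simplex (p + q) X \<sigma>
     then \<phi> (front_face p \<sigma>) * \<psi> (back_face p q \<sigma>) else 0)"

text \<open>The product \<open>H\<^sup>p(X, S) \<times> H\<^sup>q(X) \<rightarrow> H\<^sup>p\<^sup>+\<^sup>q(X, S)\<close>.\<close>

definition cup_class ::
  "nat \<Rightarrow> nat \<Rightarrow> 'a topology \<Rightarrow> 'a set \<Rightarrow> 'a cochain set \<Rightarrow> 'a cochain set \<Rightarrow> 'a cochain set" where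
  "cup_class p q X S b c = (\<Union>\<phi> \<in> b. \<Union>\<psi> \<in> c. cohomology_class (p + q) X S (cup p q X \<phi> \<psi>))"

definition cohomology_one :: "'a topology \<Rightarrow> 'a cochain set" where
  "cohomology_one X = cohomology_class 0 X {} (\<lambda>\<sigma>. if singular_simplex 0 X \<sigma> then 1 else 0)"

text \<open>The product in \<open>H\<^sup>m(X)\<close> of a list of \<open>m\<close> classes of degree one.\<close>

primrec cup_list :: "'a topology \<Rightarrow> 'a cochain set list \<Rightarrow> 'a cochain set" where
  "cup_list X [] = cohomology_one X"
| "cup_list X (b # bs) = cup_class 1 (length bs) X {} b (cup_list X bs)"

text \<open>\<open>\<sigma> \<frown> \<phi> = \<phi>(\<sigma>|[v\<^sub>0, \<dots>, v\<^sub>k]) \<cdot> \<sigma>|[v\<^sub>k, \<dots>, v\<^sub>n]\<close> for \<open>n\<close>-chains and \<open>k\<close>-cochains.\<close>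

definition cap :: "nat \<Rightarrow> nat \<Rightarrow> 'a chain \<Rightarrow> 'a cochain \<Rightarrow> 'a chain" where
  "cap n k c \<phi> =
     frag_extend (\<lambda>\<sigma>. frag_cmul (\<phi> (front_face k \<sigma>)) (frag_of (back_face k (n - k) \<sigma>))) c"

definition cap_class ::
  "nat \<Rightarrow> nat \<Rightarrow> 'a topology \<Rightarrow> 'a chain set \<Rightarrow> 'a cochain set \<Rightarrow> 'a chain set" where
  "cap_class n k X \<zeta> b = (\<Union>c \<in> \<zeta>. \<Union>\<phi> \<in> b. homologous_rel_set (n - k) X {} (cap n k c \<phi>))"


section \<open>SYS manifolds\<close>

text \<open>The subgroup of \<open>H\<^sub>2(X)\<close> generated by the classes \<open>f\<^sub>*[S\<^sup>2]\<close> of maps \<open>f : S\<^sup>2 \<rightarrow> X\<close>. If \<open>X\<close> is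
  path connected, then these classes already form a subgroup, the image of \<open>\<pi>\<^sub>2(X) \<rightarrow> H\<^sub>2(X)\<close>.\<close>

definition hurewicz_image :: "'a topology \<Rightarrow> 'a chain set set" where
  "hurewicz_image X = generate (homology_group 2 X)
     {hom_induced 2 (nsphere 2) {} X {} f s | f s.
        continuous_map (nsphere 2) X f \<and> s \<in> carrier (homology_group 2 (nsphere 2)) \<and>
        generate (homology_group 2 (nsphere 2)) {s} = carrier (homology_group 2 (nsphere 2))}"

definition aspherical_class :: "'a topology \<Rightarrow> 'a chain set \<Rightarrow> bool" where
  "aspherical_class X \<tau> \<longleftrightarrow> \<tau> \<in> carrier (homology_group 2 X) \<and> \<tau> \<notin> hurewicz_image X"

definition SYS :: "nat \<Rightarrow> 'a topology \<Rightarrow> bool" where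
  "SYS n X \<longleftrightarrow> 2 \<le> n \<and> closed_manifold n X \<and>
     (\<exists>\<mu> \<zeta> \<beta>s. orientation n X \<mu> \<and> fundamental_class n X \<mu> \<zeta> \<and>
        length \<beta>s = n - 2 \<and> set \<beta>s \<subseteq> carrier (cohomology_group 1 X) \<and>
        aspherical_class X (cap_class n (n - 2) X \<zeta> (cup_list X \<beta>s)))"


section \<open>Homology and cohomology relative to a set of ends\<close>

definition exhaustion :: "'a topology \<Rightarrow> (nat \<Rightarrow> 'a set) \<Rightarrow> bool" where
  "exhaustion X K \<longleftrightarrow>
     (\<forall>i. compactin X (K i) \<and> K i \<subseteq> X interior_of K (Suc i)) \<and> (\<Union>i. K i) = topspace X"

definition compact_boundary_sets :: "'a topology \<Rightarrow> 'a set set" where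
  "compact_boundary_sets X = {V. V \<subseteq> topspace X \<and> compactin X (X frontier_of V)}"

definition relative_chain_group :: "nat \<Rightarrow> 'a topology \<Rightarrow> 'a set \<Rightarrow> 'a chain set monoid" where
  "relative_chain_group p X S = chain_group p X Mod singular_chain_set p (subtopology X S)"

text \<open>The inverse limit of the groups \<open>C\<^sub>p(X, V - K\<^sub>i)\<close>. Elements of \<open>C\<^sub>p(X, S)\<close> are cosets,
  and for \<open>T \<subseteq> S\<close> the map \<open>C\<^sub>p(X, T) \<rightarrow> C\<^sub>p(X, S)\<close> sends a coset to the coset containing it.\<close>

definition ends_chain_group ::
  "nat \<Rightarrow> 'a topology \<Rightarrow> (nat \<Rightarrow> 'a set) \<Rightarrow> 'a set \<Rightarrow> (nat \<Rightarrow> 'a chain set) monoid" where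
  "ends_chain_group p X K V =
     \<lparr>carrier = {c. \<forall>i. c i \<in> carrier (relative_chain_group p X (V - K i)) \<and> c (Suc i) \<subseteq> c i},
      monoid.mult = (\<lambda>c d i. c i \<otimes>\<^bsub>relative_chain_group p X (V - K i)\<^esub> d i),
      one = (\<lambda>i. \<one>\<^bsub>relative_chain_group p X (V - K i)\<^esub>)\<rparr>"

definition ends_boundary ::
  "nat \<Rightarrow> 'a topology \<Rightarrow> (nat \<Rightarrow> 'a set) \<Rightarrow> 'a set \<Rightarrow> (nat \<Rightarrow> 'a chain set) \<Rightarrow> nat \<Rightarrow> 'a chain set" where
  "ends_boundary p X K V c = (\<lambda>i. \<Union>x \<in> c i.
     singular_chain_set (p - 1) (subtopology X (V - K i)) #>\<^bsub>chain_group (p - 1) X\<^esub> chain_boundary p x)"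

definition ends_cycle_group ::
  "nat \<Rightarrow> 'a topology \<Rightarrow> (nat \<Rightarrow> 'a set) \<Rightarrow> 'a set \<Rightarrow> (nat \<Rightarrow> 'a chain set) monoid" where
  "ends_cycle_group p X K V = (ends_chain_group p X K V)
     \<lparr>carrier := {c \<in> carrier (ends_chain_group p X K V).
        ends_boundary p X K V c = \<one>\<^bsub>ends_chain_group (p - 1) X K V\<^esub>}\<rparr>"

definition ends_boundary_set ::
  "nat \<Rightarrow> 'a topology \<Rightarrow> (nat \<Rightarrow> 'a set) \<Rightarrow> 'a set \<Rightarrow> (nat \<Rightarrow> 'a chain set) set" where
  "ends_boundary_set p X K V =
     ends_boundary (Suc p) X K V ` carrier (ends_chain_group (Suc p) X K V)"

text \<open>The homology \<open>H\<^sub>p(X, \<partial>\<^sub>\<infinity>V)\<close> of the inverse limit complex. The ends-decomposition enters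
  only through \<open>V\<close>; the whole space of ends corresponds to \<open>V = topspace X\<close>, and \<open>\<partial>\<^sub>bX\<close> to
  \<open>topspace X - V\<close>.\<close>

definition ends_homology_group ::
  "nat \<Rightarrow> 'a topology \<Rightarrow> (nat \<Rightarrow> 'a set) \<Rightarrow> 'a set \<Rightarrow> (nat \<Rightarrow> 'a chain set) set monoid" where
  "ends_homology_group p X K V = ends_cycle_group p X K V Mod ends_boundary_set p X K V"

text \<open>The map \<open>H\<^sub>p(X, \<partial>\<^sub>\<infinity>V) \<rightarrow> H\<^sub>p(X, V - K\<^sub>i)\<close>.\<close>

definition ends_projection ::
  "nat \<Rightarrow> 'a topology \<Rightarrow> (nat \<Rightarrow> 'a set) \<Rightarrow> 'a set \<Rightarrow> nat \<Rightarrow> (nat \<Rightarrow> 'a chain set) set \<Rightarrow> 'a chain set"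
  where "ends_projection p X K V i \<tau> = (\<Union>c \<in> \<tau>. \<Union>x \<in> c i. homologous_rel_set p X (V - K i) x)"

text \<open>The restricted class \<open>\<tau>|\<^sub>\<Omega>\<close> in \<open>H\<^sub>p(X, X - \<Omega>)\<close>. Any \<open>i\<close> with \<open>V - K\<^sub>i \<subseteq> X - \<Omega>\<close> gives
  the same class.\<close>

definition restricted_class ::
  "nat \<Rightarrow> 'a topology \<Rightarrow> (nat \<Rightarrow> 'a set) \<Rightarrow> 'a set \<Rightarrow> 'a set \<Rightarrow> (nat \<Rightarrow> 'a chain set) set \<Rightarrow> 'a chain set"
  where
  "restricted_class p X K V \<Omega> \<tau> =
     (let i = (LEAST i. V - K i \<subseteq> topspace X - \<Omega>) in
      hom_induced (int p) X (V - K i) X (topspace X - \<Omega>) id (ends_projection p X K V i \<tau>))"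

text \<open>The fundamental class in \<open>H\<^sub>n(X, \<partial>\<^sub>\<infinity>X)\<close> of a manifold with orientation \<open>\<mu>\<close>.\<close>

definition ends_fundamental_class ::
  "nat \<Rightarrow> 'a topology \<Rightarrow> (nat \<Rightarrow> 'a set) \<Rightarrow> ('a \<Rightarrow> 'a chain set) \<Rightarrow> (nat \<Rightarrow> 'a chain set) set \<Rightarrow> bool"
  where
  "ends_fundamental_class n X K \<mu> \<zeta> \<longleftrightarrow>
     \<zeta> \<in> carrier (ends_homology_group n X K (topspace X)) \<and>
     (\<forall>x \<in> topspace X. restricted_class n X K (topspace X) {x} \<zeta> = \<mu> x)"

text \<open>\<open>H\<^sup>p(X, \<partial>\<^sub>\<infinity>V)\<close> as the direct limit of the groups \<open>H\<^sup>p(X, V - K\<^sub>i)\<close>: pairs \<open>(i, b)\<close>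
  with \<open>b \<in> H\<^sup>p(X, V - K\<^sub>i)\<close>, identified if they have the same image at some later stage.\<close>

definition ends_cohomology_pairs ::
  "nat \<Rightarrow> 'a topology \<Rightarrow> (nat \<Rightarrow> 'a set) \<Rightarrow> 'a set \<Rightarrow> (nat \<times> 'a cochain set) set" where
  "ends_cohomology_pairs p X K V = {(i, b). b \<in> carrier (relative_cohomology_group p X (V - K i))}"

definition ends_cohomology_rel ::
  "nat \<Rightarrow> 'a topology \<Rightarrow> (nat \<Rightarrow> 'a set) \<Rightarrow> 'a set \<Rightarrow> (nat \<times> 'a cochain set) rel" where
  "ends_cohomology_rel p X K V =
     {((i, b), (j, c)).
        (i, b) \<in> ends_cohomology_pairs p X K V \<and> (j, c) \<in> ends_cohomology_pairs p X K V \<and>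
        (\<exists>l. i \<le> l \<and> j \<le> l \<and>
           cohomology_restrict p X (V - K l) b = cohomology_restrict p X (V - K l) c)}"

definition ends_cohomology ::
  "nat \<Rightarrow> 'a topology \<Rightarrow> (nat \<Rightarrow> 'a set) \<Rightarrow> 'a set \<Rightarrow> (nat \<times> 'a cochain set) set set" where
  "ends_cohomology p X K V = ends_cohomology_pairs p X K V // ends_cohomology_rel p X K V"

text \<open>The cup product \<open>H\<^sup>p(X, \<partial>\<^sub>\<infinity>V) \<times> H\<^sup>q(X) \<rightarrow> H\<^sup>p\<^sup>+\<^sup>q(X, \<partial>\<^sub>\<infinity>V)\<close>.\<close>

definition ends_cup ::
  "nat \<Rightarrow> nat \<Rightarrow> 'a topology \<Rightarrow> (nat \<Rightarrow> 'a set) \<Rightarrow> 'a set \<Rightarrow>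
   (nat \<times> 'a cochain set) set \<Rightarrow> 'a cochain set \<Rightarrow> (nat \<times> 'a cochain set) set" where
  "ends_cup p q X K V \<beta> c =
     ends_cohomology_rel (p + q) X K V `` ((\<lambda>(i, b). (i, cup_class p q X (V - K i) b c)) ` \<beta>)"

text \<open>The cap product of a chain relative to all ends with a cochain vanishing on the simplices in
  \<open>(X - V) - K\<^sub>j\<close>, as a chain relative to \<open>\<partial>\<^sub>\<infinity>V\<close>. For large \<open>m\<close> the boundary of \<open>V\<close> lies in
  the interior of \<open>K\<^sub>m\<close> and \<open>j \<le> m\<close>, so that every simplex in \<open>X - K\<^sub>m\<close> lies either in \<open>V - K\<^sub>m\<close> or
  in \<open>(X - V) - K\<^sub>j\<close>; hence capping a representative of the \<open>m\<close>-th component of the chain gives an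
  element of \<open>C\<^sub>n\<^sub>-\<^sub>k(X, V - K\<^sub>i)\<close>, for \<open>i \<le> m\<close>, that does not depend on the representative or on \<open>m\<close>.\<close>

definition ends_cap ::
  "nat \<Rightarrow> nat \<Rightarrow> 'a topology \<Rightarrow> (nat \<Rightarrow> 'a set) \<Rightarrow> 'a set \<Rightarrow>
   (nat \<Rightarrow> 'a chain set) \<Rightarrow> 'a cochain \<Rightarrow> nat \<Rightarrow> 'a chain set" where
  "ends_cap n k X K V c \<phi> = (\<lambda>i. {y. singular_chain (n - k) X y \<and>
     (\<forall>\<^sub>F m in sequentially. \<forall>x \<in> c m.
        singular_chain (n - k) (subtopology X (V - K i)) (y - cap n k x \<phi>))})"

text \<open>The cap product \<open>H\<^sub>n(X, \<partial>\<^sub>\<infinity>X) \<times> H\<^sup>k(X, \<partial>\<^sub>bX) \<rightarrow> H\<^sub>n\<^sub>-\<^sub>k(X, \<partial>\<^sub>sX)\<close>, where \<open>\<partial>\<^sub>sX = \<partial>\<^sub>\<infinity>V\<close>.\<close>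

definition ends_cap_class ::
  "nat \<Rightarrow> nat \<Rightarrow> 'a topology \<Rightarrow> (nat \<Rightarrow> 'a set) \<Rightarrow> 'a set \<Rightarrow>
   (nat \<Rightarrow> 'a chain set) set \<Rightarrow> (nat \<times> 'a cochain set) set \<Rightarrow> (nat \<Rightarrow> 'a chain set) set" where
  "ends_cap_class n k X K V \<zeta> \<beta> = (\<Union>c \<in> \<zeta>. \<Union>(j, b) \<in> \<beta>. \<Union>\<phi> \<in> b.
     ends_boundary_set (n - k) X K V #>\<^bsub>ends_cycle_group (n - k) X K V\<^esub> ends_cap n k X K V c \<phi>)"


section \<open>Weakly SYS manifolds\<close>

definition strongly_spherical ::
  "'a topology \<Rightarrow> (nat \<Rightarrow> 'a set) \<Rightarrow> 'a set \<Rightarrow> (nat \<Rightarrow> 'a chain set) set \<Rightarrow> bool" where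
  "strongly_spherical X K V \<tau> \<longleftrightarrow>
     (\<forall>\<Omega>. closedin X \<Omega> \<and> compactin X (X closure_of (sym_diff \<Omega> (topspace X - V))) \<longrightarrow>
        restricted_class 2 X K V \<Omega> \<tau> \<in> hom_induced 2 X {} X (topspace X - \<Omega>) id ` hurewicz_image X)"

definition weakly_aspherical ::
  "'a topology \<Rightarrow> (nat \<Rightarrow> 'a set) \<Rightarrow> 'a set \<Rightarrow> (nat \<Rightarrow> 'a chain set) set \<Rightarrow> bool" where
  "weakly_aspherical X K V \<tau> \<longleftrightarrow>
     \<tau> \<in> carrier (ends_homology_group 2 X K V) \<and> \<not> strongly_spherical X K V \<tau>"

text \<open>The list \<open>\<beta>s\<close> contains \<open>\<beta>\<^sub>2, \<dots>, \<beta>\<^sub>n\<^sub>-\<^sub>2\<close>. The notion does not depend on the exhaustion; all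
  exhaustions are required to work, and the lemma \<open>manifold_exhaustion\<close> shows that there is one.\<close>

definition weakly_SYS :: "nat \<Rightarrow> 'a topology \<Rightarrow> bool" where
  "weakly_SYS n X \<longleftrightarrow> 3 \<le> n \<and> manifold n X \<and>
     (\<exists>\<mu>. orientation n X \<mu> \<and>
       (\<forall>K. exhaustion X K \<longrightarrow>
         (\<exists>\<zeta>. ends_fundamental_class n X K \<mu> \<zeta> \<and>
           (\<exists>V \<in> compact_boundary_sets X. \<exists>\<beta>\<^sub>1 \<in> ends_cohomology 1 X K (topspace X - V). \<exists>\<beta>s.
              length \<beta>s = n - 3 \<and> set \<beta>s \<subseteq> carrier (cohomology_group 1 X) \<and>
              weakly_aspherical X K V
                (ends_cap_class n (n - 2) X K V \<zeta>
                  (ends_cup 1 (n - 3) X K (topspace X - V) \<beta>\<^sub>1 (cup_list X \<beta>s)))))))"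

lemma manifold_imp_locally_compact:
  assumes "manifold n X"
  shows "locally_compact_space X"
  unfolding locally_compact_space_def
proof
  fix x assume "x \<in> topspace X"
  then obtain U W where UW: "openin X U" "x \<in> U" "openin (Euclidean_space n) W"
    "subtopology X U homeomorphic_space subtopology (Euclidean_space n) W"
    using assms unfolding manifold_def by blast
  have "locally_compact_space (subtopology (Euclidean_space n) W)"
    using UW(3) Hausdorff_Euclidean_space locally_compact_Euclidean_space
      locally_compact_space_open_subset by blast
  then have "locally_compact_space (subtopology X U)"
    using UW(4) homeomorphic_locally_compact_space by blast
  moreover have "x \<in> topspace (subtopology X U)"
    using UW \<open>x \<in> topspace X\<close> by simp
  ultimately obtain N C where NC: "openin (subtopology X U) N" "compactin (subtopology X U) C"
    "x \<in> N" "N \<subseteq> C"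
    unfolding locally_compact_space_def by blast
  then have "openin X N" "compactin X C"
    using UW(1) openin_trans_full compactin_subtopology by blast+
  with NC show "\<exists>U K. openin X U \<and> compactin X K \<and> x \<in> U \<and> U \<subseteq> K"
    by blast
qed

lemma manifold_exhaustion:
  assumes "manifold n X"
  shows "\<exists>K. exhaustion X K"
proof -
  obtain u c where uc: "\<And>x. x \<in> topspace X \<Longrightarrow> openin X (u x) \<and> compactin X (c x) \<and> x \<in> u x \<and> u x \<subseteq> c x"
    using manifold_imp_locally_compact[OF assms] unfolding locally_compact_space_def by metis
  have "Lindelof_space X"
    using assms second_countable_imp_Lindelof_space unfolding manifold_def by blast
  moreover have "\<forall>U \<in> u ` topspace X. openin X U" "topspace X \<subseteq> \<Union> (u ` topspace X)"
    using uc by auto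
  ultimately have "\<exists>\<V>. countable \<V> \<and> \<V> \<subseteq> u ` topspace X \<and> topspace X \<subseteq> \<Union>\<V>"
    unfolding Lindelof_space_alt by blast
  then obtain A where A: "countable A" "A \<subseteq> topspace X" "topspace X \<subseteq> \<Union> (u ` A)"
    by (metis countable_subset_image)
  define D where "D i = (\<Union>x \<in> {x \<in> A. to_nat_on A x \<le> i}. c x)" for i
  have fin: "finite {x \<in> A. to_nat_on A x \<le> i}" for i
    using finite_vimage_IntI[OF finite_atMost inj_on_to_nat_on[OF A(1)], of i]
    by (simp add: vimage_def Int_def conj_commute)
  have D: "compactin X (D i)" for i
    unfolding D_def using fin A(2) uc by (intro compactin_Union) auto
  have step: "\<exists>L. compactin X L \<and> C \<subseteq> X interior_of L \<and> D i \<subseteq> L" if C: "compactin X C" for C i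
  proof -
    have "C \<subseteq> \<Union> (u ` topspace X)"
      using compactin_subset_topspace[OF C] uc by blast
    moreover have "\<And>U. U \<in> u ` topspace X \<Longrightarrow> openin X U"
      using uc by auto
    ultimately obtain F where F: "finite F" "F \<subseteq> u ` topspace X" "C \<subseteq> \<Union>F"
      using compactinD[OF C, of "u ` topspace X"] by blast
    then obtain B where B: "finite B" "B \<subseteq> topspace X" "F = u ` B"
      by (meson finite_subset_image)
    define L where "L = D i \<union> (\<Union>x \<in> B. c x)"
    have "compactin X (\<Union>x \<in> B. c x)"
      using B uc by (intro compactin_Union) auto
    then have "compactin X L"
      unfolding L_def using D compactin_Un by blast
    moreover have "C \<subseteq> X interior_of L"
    proof -
      have "openin X (\<Union> (u ` B))" using B uc by auto
      moreover have "\<Union> (u ` B) \<subseteq> L" unfolding L_def using B uc by blast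
      ultimately show ?thesis using F B interior_of_maximal by (metis subset_trans)
    qed
    ultimately show ?thesis unfolding L_def by blast
  qed
  have "\<exists>K. \<forall>i. compactin X (K i) \<and> (K i \<subseteq> X interior_of K (Suc i) \<and> D i \<subseteq> K (Suc i))"
    by (rule dependent_nat_choice) (use step compactin_empty in blast)+
  then obtain K where K: "\<And>i. compactin X (K i) \<and> K i \<subseteq> X interior_of K (Suc i) \<and> D i \<subseteq> K (Suc i)"
    by blast
  have "topspace X \<subseteq> (\<Union>i. K i)"
  proof
    fix x assume "x \<in> topspace X"
    then obtain a where "a \<in> A" "x \<in> u a" using A by blast
    then have "x \<in> D (to_nat_on A a)" unfolding D_def using uc A by blast
    then show "x \<in> (\<Union>i. K i)" using K by blast
  qed
  then have "(\<Union>i. K i) = topspace X"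
    using K compactin_subset_topspace by blast
  then show ?thesis
    unfolding exhaustion_def using K by blast
qed

end

theory Submission
  imports Defs
begin

text \<open>All ends of \<open>X = M - \<Gamma>\<close> are declared to be in \<open>\<partial>\<^sub>sX\<close>, so that \<open>V = X\<close>, \<open>\<partial>\<^sub>bX\<close> is empty and the classes
  \<open>\<beta>\<^sub>i\<close> restrict to \<open>X\<close>; the orientation and the fundamental class restrict to \<open>X\<close> by excision. As a
  compact manifold \<open>\<Gamma>\<close> is locally contractible, and hence it has a neighbourhood \<open>W\<close> such that the image of
  \<open>H\<^sub>2(W)\<close> in \<open>H\<^sub>2(M)\<close> is contained in that of \<open>H\<^sub>2(\<Gamma>)\<close>. If the cap product on \<open>X\<close> were strongly
  spherical, then taking \<open>\<Omega> = M - W\<close> would yield a spherical class whose difference from \<open>\<tau>\<close> vanishes in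
  \<open>H\<^sub>2(M, W)\<close>. That difference comes from \<open>H\<^sub>2(W)\<close>, hence from \<open>H\<^sub>2(\<Gamma>)\<close>, contrary to the hypothesis on
  \<open>\<tau>\<close>.\<close>

section \<open>The Leibniz rules for cup and cap products\<close>

text \<open>\<open>\<Gamma>\<close> is only a topological submanifold and may be wildly embedded, so
  no tubular neighbourhood is at hand. Nor is a map from the neighbourhood to
  \<open>\<Gamma>\<close> needed: a chain map with a chain homotopy, defined on small simplices up
  to degree 2, moves 2-cycles into \<open>\<Gamma>\<close>. With \<open>V\<close> the whole space, a
  test set is simply a closed set that is compact, so the complement of every open \<open>W\<close>
  containing \<open>\<Gamma>\<close> qualifies. Homology relative to ends is that of an inverse
  limit of chain complexes, so a compatible family of relative classes is not yet a class. The
  fundamental class of the complement is therefore made of actual chains \<open>x i\<close>,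
  corrected stage by stage. The comparison with \<tau> takes place at a single stage whose
  \<open>K i\<close> contains the test set: there \<open>x i\<close> is homologous to a fundamental
  cycle of \<open>M\<close> relative to \<open>M - K i\<close>, a subset of \<open>W\<close>.
  Products are computed on cochains. A cocycle of \<open>M\<close> and its restriction have the same
  values on simplices of the complement, so capping \<open>x i\<close> with either gives the same
  chain.\<close>

lemma shift_in_standard_simplex:
  assumes "x \<in> standard_simplex l"
  shows "(\<lambda>i. if i < k then 0 else x (i - k)) \<in> standard_simplex (k + l)"
proof -
  have "(\<Sum>i\<le>k + l. if i < k then 0 else x (i - k)) = (\<Sum>i\<in>{k..k + l}. x (i - k))"
    by (rule sum.mono_neutral_cong_right) auto
  also have "\<dots> = (\<Sum>i\<le>l. x i)"
    by (rule sum.reindex_bij_witness[where i="\<lambda>i. i + k" and j="\<lambda>i. i - k"]) auto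
  finally show ?thesis
    using assms by (auto simp: standard_simplex_def)
qed

lemma singular_simplex_front_face:
  assumes "singular_simplex p X \<sigma>" "k \<le> p"
  shows "singular_simplex k X (front_face k \<sigma>)"
  using assms standard_simplex_mono[OF assms(2)] 
  by (auto simp: singular_simplex_def front_face_def intro: continuous_map_from_subtopology_mono)

lemma singular_simplex_back_face:
  assumes "singular_simplex (k + l) X \<sigma>"
  shows "singular_simplex l X (back_face k l \<sigma>)"
proof -
  have "continuous_map (subtopology (powertop_real UNIV) (standard_simplex l))
          (subtopology (powertop_real UNIV) (standard_simplex (k + l)))
          (\<lambda>x i. if i < k then 0 else x (i - k))"
    unfolding continuous_map_in_subtopology
  proof (intro conjI)
    have "continuous_map (powertop_real UNIV) euclideanreal (\<lambda>x. if i < k then 0 else x (i - k))" for i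
      by (auto intro: continuous_map_product_projection)
    then show "continuous_map (subtopology (powertop_real UNIV) (standard_simplex l)) (powertop_real UNIV)
          (\<lambda>x i. if i < k then 0 else x (i - k))"
      by (simp add: continuous_map_componentwise_UNIV continuous_map_from_subtopology)
  qed (use shift_in_standard_simplex in auto)
  from continuous_map_compose[OF this] assms show ?thesis
    by (auto simp: singular_simplex_def back_face_def o_def)
qed

text \<open>Deleting a vertex up to \<open>k\<close> shortens the front part, deleting a later one
  shortens the back part. This lemma and the next four record what remains of either part. Deleting
  the vertex \<open>k\<close> itself is covered by both lemmas on back faces, and this overlap
  produces the cancelling terms of the Leibniz rule.\<close>

lemma front_face_singular_face_le:
  assumes "i \<le> k"
  shows "front_face k (singular_face (Suc (k + l)) i \<sigma>) = singular_face (Suc k) i (front_face (Suc k) \<sigma>)"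
proof
  fix x
  show "front_face k (singular_face (Suc (k + l)) i \<sigma>) x = singular_face (Suc k) i (front_face (Suc k) \<sigma>) x"
    using assms standard_simplex_mono[of k "k + l"] simplical_face_in_standard_simplex[of "Suc k" i x]
    by (auto simp: front_face_def singular_face_def)
qed

lemma front_face_singular_face_gt:
  assumes "k < i"
  shows "front_face k (singular_face (Suc (k + l)) i \<sigma>) = front_face k \<sigma>"
proof
  fix x
  have "simplical_face i x = x" if "x \<in> standard_simplex k"
    using that assms by (auto simp: simplical_face_def standard_simplex_def)
  then show "front_face k (singular_face (Suc (k + l)) i \<sigma>) x = front_face k \<sigma> x"
    using standard_simplex_mono[of k "k + l"] by (auto simp: front_face_def singular_face_def)
qed

lemma singular_face_front_face_last:
  "singular_face (Suc k) (Suc k) (front_face (Suc k) \<sigma>) = front_face k \<sigma>"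
proof
  fix x
  have "simplical_face (Suc k) x = x" if "x \<in> standard_simplex k"
    using that by (auto simp: simplical_face_def standard_simplex_def)
  then show "singular_face (Suc k) (Suc k) (front_face (Suc k) \<sigma>) x = front_face k \<sigma> x"
    using standard_simplex_mono[of k "Suc k"] by (auto simp: front_face_def singular_face_def)
qed

lemma back_face_singular_face_le:
  assumes "i \<le> k"
  shows "back_face k l (singular_face (Suc (k + l)) i \<sigma>) = back_face (Suc k) l \<sigma>"
proof
  fix x :: "nat \<Rightarrow> real"
  have "simplical_face i (\<lambda>j. if j < k then 0 else x (j - k)) = (\<lambda>j. if j < Suc k then 0 else x (j - Suc k))"
    using assms by (auto simp: simplical_face_def fun_eq_iff)
  then show "back_face k l (singular_face (Suc (k + l)) i \<sigma>) x = back_face (Suc k) l \<sigma> x"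
    using shift_in_standard_simplex[of x l k] by (auto simp: back_face_def singular_face_def)
qed

lemma back_face_singular_face_ge:
  assumes "j \<le> Suc l"
  shows "back_face k l (singular_face (Suc (k + l)) (k + j) \<sigma>) = singular_face (Suc l) j (back_face k (Suc l) \<sigma>)"
proof
  fix x :: "nat \<Rightarrow> real"
  have "simplical_face (k + j) (\<lambda>i. if i < k then 0 else x (i - k)) =
      (\<lambda>i. if i < k then 0 else simplical_face j x (i - k))"
    by (auto simp: simplical_face_def fun_eq_iff)
  moreover have "simplical_face j x \<in> standard_simplex (Suc l)" if "x \<in> standard_simplex l"
    using simplical_face_in_standard_simplex[of "Suc l" j x] assms that by simp
  ultimately show "back_face k l (singular_face (Suc (k + l)) (k + j) \<sigma>) x =
      singular_face (Suc l) j (back_face k (Suc l) \<sigma>) x"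
    using shift_in_standard_simplex[of x l k] by (auto simp: back_face_def singular_face_def)
qed

section \<open>Evaluation of cochains, linearity of the cap product, and the Leibniz rules\<close>

lemma cochain_eval_superset:
  assumes "finite A" "Poly_Mapping.keys c \<subseteq> A"
  shows "cochain_eval \<phi> c = (\<Sum>\<sigma>\<in>A. Poly_Mapping.lookup c \<sigma> * \<phi> \<sigma>)"
  unfolding cochain_eval_def
  by (rule sum.mono_neutral_left) (use assms in \<open>auto simp: in_keys_iff\<close>)

lemma cochain_eval_0 [simp]: "cochain_eval \<phi> 0 = 0"
  by (simp add: cochain_eval_def)

lemma cochain_eval_frag_of [simp]: "cochain_eval \<phi> (frag_of \<sigma>) = \<phi> \<sigma>"
  by (simp add: cochain_eval_def)

lemma cochain_eval_add: "cochain_eval \<phi> (a + b) = cochain_eval \<phi> a + cochain_eval \<phi> b"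
proof -
  let ?A = "Poly_Mapping.keys a \<union> Poly_Mapping.keys b"
  have "Poly_Mapping.keys (a + b) \<subseteq> ?A" by (rule keys_add)
  then show ?thesis
    by (simp add: cochain_eval_superset[of ?A] lookup_add distrib_right sum.distrib)
qed

lemma cochain_eval_diff: "cochain_eval \<phi> (a - b) = cochain_eval \<phi> a - cochain_eval \<phi> b"
  using cochain_eval_add[of \<phi> "a - b" b] by simp

lemma cochain_eval_cmul: "cochain_eval \<phi> (frag_cmul m a) = m * cochain_eval \<phi> a"
proof -
  have "Poly_Mapping.keys (frag_cmul m a) \<subseteq> Poly_Mapping.keys a" by (rule keys_cmul)
  then show ?thesis
    by (simp add: cochain_eval_superset[of "Poly_Mapping.keys a"] sum_distrib_left mult.assoc)
qed

lemma cochain_eval_sum: "cochain_eval \<phi> (sum f I) = (\<Sum>i\<in>I. cochain_eval \<phi> (f i))"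
  by (induction I rule: infinite_finite_induct) (auto simp: cochain_eval_add)

lemma frag_cmul_diff_distrib2: "frag_cmul c (a - b) = frag_cmul c a - frag_cmul c b"
  by (simp add: poly_mapping_eqI lookup_minus right_diff_distrib)

lemma frag_cmul_sum_left: "frag_cmul (sum f I) a = (\<Sum>i\<in>I. frag_cmul (f i) a)"
  by (induction I rule: infinite_finite_induct) (auto simp: frag_cmul_distrib)

lemma cap_0 [simp]: "cap n k 0 \<phi> = 0"
  by (simp add: cap_def)

lemma cap_frag_of: "cap n k (frag_of \<sigma>) \<phi> = frag_cmul (\<phi> (front_face k \<sigma>)) (frag_of (back_face k (n - k) \<sigma>))"
  by (simp add: cap_def)

lemma cap_add: "cap n k (a + b) \<phi> = cap n k a \<phi> + cap n k b \<phi>"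
  by (simp add: cap_def frag_extend_add)

lemma cap_diff: "cap n k (a - b) \<phi> = cap n k a \<phi> - cap n k b \<phi>"
  by (simp add: cap_def frag_extend_diff)

lemma cap_cmul: "cap n k (frag_cmul m a) \<phi> = frag_cmul m (cap n k a \<phi>)"
  by (simp add: cap_def frag_extend_cmul)

lemma cap_sum: "cap n k (sum f I) \<phi> = (\<Sum>i\<in>I. cap n k (f i) \<phi>)"
  by (induction I rule: infinite_finite_induct) (auto simp: cap_add)

lemma singular_chain_cap:
  assumes "singular_chain n X c" "k \<le> n"
  shows "singular_chain (n - k) X (cap n k c \<phi>)"
  unfolding cap_def
proof (rule singular_chain_extend)
  fix \<sigma> assume "\<sigma> \<in> Poly_Mapping.keys c"
  then have "singular_simplex (k + (n - k)) X \<sigma>" using assms by (auto simp: singular_chain_def)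
  then show "singular_chain (n - k) X (frag_cmul (\<phi> (front_face k \<sigma>)) (frag_of (back_face k (n - k) \<sigma>)))"
    by (simp add: singular_chain_cmul singular_chain_of singular_simplex_back_face)
qed

lemma cap_cong:
  assumes "singular_chain n X c" "k \<le> n" "\<And>\<sigma>. singular_simplex k X \<sigma> \<Longrightarrow> \<phi> \<sigma> = \<psi> \<sigma>"
  shows "cap n k c \<phi> = cap n k c \<psi>"
  unfolding cap_def
  by (rule frag_extend_eq) (use assms singular_simplex_front_face in \<open>fastforce simp: singular_chain_def\<close>)

lemma cap_cochain_add: "cap n k c (\<lambda>\<sigma>. \<phi> \<sigma> + \<psi> \<sigma>) = cap n k c \<phi> + cap n k c \<psi>"
  using subset_UNIV
proof (induction c rule: frag_induction)
  case (diff a b)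
  then show ?case by (simp add: cap_diff)
qed (auto simp: cap_frag_of frag_cmul_distrib)

lemma cap_cochain_0 [simp]: "cap n k c (\<lambda>_. 0) = 0"
  using cap_cochain_add[of n k c "\<lambda>_. 0" "\<lambda>_. 0"] by simp

lemma coboundary_frag:
  assumes "singular_simplex (Suc p) X \<sigma>"
  shows "coboundary p X \<phi> \<sigma> = (\<Sum>i\<le>Suc p. (-1) ^ i * \<phi> (singular_face (Suc p) i \<sigma>))"
  using assms by (simp add: coboundary_def chain_boundary_of cochain_eval_sum cochain_eval_cmul cochain_eval_add del: sum.atMost_Suc)

text \<open>The faces up to \<open>k\<close> give every term of the cap product with the coboundary
  except the last, and the later faces give every term of the boundary of the cap product except the
  first. The two missing terms are both \<phi> of the front \<open>k\<close>-face times the back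
  \<open>l\<close>-face, with opposite signs, so they may be added for free.\<close>

lemma cap_chain_boundary_frag:
  assumes "singular_simplex (Suc (k + l)) X \<sigma>"
  shows "cap (k + l) k (chain_boundary (Suc (k + l)) (frag_of \<sigma>)) \<phi> =
    cap (Suc (k + l)) (Suc k) (frag_of \<sigma>) (coboundary k X \<phi>)
    + frag_cmul ((-1) ^ k) (chain_boundary (Suc l) (cap (Suc (k + l)) k (frag_of \<sigma>) \<phi>))"
proof -
  define B where "B = frag_of (back_face (Suc k) l \<sigma>)"
  define f where "f = \<phi> (front_face k \<sigma>)"
  define g where "g i = \<phi> (singular_face (Suc k) i (front_face (Suc k) \<sigma>))" for i
  define h where "h j = frag_of (singular_face (Suc l) j (back_face k (Suc l) \<sigma>))" for j
  have h0: "h 0 = B"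
    unfolding h_def B_def
    using back_face_singular_face_ge[of 0 l k \<sigma>] back_face_singular_face_le[of k k l \<sigma>] by simp
  have gk: "g (Suc k) = f" by (simp add: g_def f_def singular_face_front_face_last)
  have front: "singular_simplex (Suc k) X (front_face (Suc k) \<sigma>)"
    using assms by (rule singular_simplex_front_face) simp
  have 1: "cap (Suc (k + l)) (Suc k) (frag_of \<sigma>) (coboundary k X \<phi>) =
      frag_cmul (\<Sum>i\<le>Suc k. (-1) ^ i * g i) B"
    using coboundary_frag[OF front, of \<phi>] by (simp add: cap_frag_of B_def g_def del: sum.atMost_Suc)
  have 2: "chain_boundary (Suc l) (cap (Suc (k + l)) k (frag_of \<sigma>) \<phi>) =
      frag_cmul f (\<Sum>j\<le>Suc l. frag_cmul ((-1) ^ j) (h j))"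
    by (simp add: cap_frag_of chain_boundary_cmul chain_boundary_of f_def h_def Suc_diff_le del: sum.atMost_Suc)
  define t where "t i = frag_cmul ((-1) ^ i) (frag_cmul (\<phi> (front_face k (singular_face (Suc (k + l)) i \<sigma>)))
     (frag_of (back_face k l (singular_face (Suc (k + l)) i \<sigma>))))" for i
  have "cap (k + l) k (chain_boundary (Suc (k + l)) (frag_of \<sigma>)) \<phi> = (\<Sum>i\<le>Suc (k + l). t i)"
    by (simp add: chain_boundary_of cap_sum cap_cmul cap_add cap_frag_of t_def del: sum.atMost_Suc)
  also have "{..Suc (k + l)} = {..k} \<union> {Suc k..Suc (k + l)}" by auto
  also have "(\<Sum>i\<in>{..k} \<union> {Suc k..Suc (k + l)}. t i) = (\<Sum>i\<le>k. t i) + (\<Sum>i\<in>{Suc k..Suc (k + l)}. t i)"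
    by (rule sum.union_disjoint) auto
  also have "(\<Sum>i\<le>k. t i) = (\<Sum>i\<le>k. frag_cmul ((-1) ^ i * g i) B)"
    by (rule sum.cong) (auto simp: t_def g_def B_def front_face_singular_face_le back_face_singular_face_le)
  also have "\<dots> = frag_cmul (\<Sum>i\<le>k. (-1) ^ i * g i) B"
    by (simp add: frag_cmul_sum_left)
  also have "(\<Sum>i\<in>{Suc k..Suc (k + l)}. t i) = (\<Sum>j\<in>{1..Suc l}. t (k + j))"
    by (rule sum.reindex_bij_witness[where i="\<lambda>i. k + i" and j="\<lambda>i. i - k"]) auto
  also have "\<dots> = (\<Sum>j\<in>{1..Suc l}. frag_cmul ((-1) ^ k) (frag_cmul f (frag_cmul ((-1) ^ j) (h j))))"
    by (rule sum.cong) (auto simp: t_def f_def h_def front_face_singular_face_gt back_face_singular_face_ge power_add mult.commute mult.left_commute)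
  also have "\<dots> = frag_cmul ((-1) ^ k) (frag_cmul f ((\<Sum>j\<le>Suc l. frag_cmul ((-1) ^ j) (h j)) - B))"
  proof -
    have "{..Suc l} = insert 0 {1..Suc l}" by auto
    then have "(\<Sum>j\<le>Suc l. frag_cmul ((-1) ^ j) (h j)) = B + (\<Sum>j\<in>{1..Suc l}. frag_cmul ((-1) ^ j) (h j))"
      using h0 by simp
    then show ?thesis by (simp add: frag_cmul_sum del: sum.cl_ivl_Suc sum.atMost_Suc)
  qed
  finally show ?thesis
    unfolding 1 2 using gk by (simp add: frag_cmul_distrib frag_cmul_diff_distrib frag_cmul_diff_distrib2)
qed

lemma cap_chain_boundary:
  assumes "singular_chain (Suc (k + l)) X c"
  shows "cap (k + l) k (chain_boundary (Suc (k + l)) c) \<phi> =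
    cap (Suc (k + l)) (Suc k) c (coboundary k X \<phi>)
    + frag_cmul ((-1) ^ k) (chain_boundary (Suc l) (cap (Suc (k + l)) k c \<phi>))"
  using assms unfolding singular_chain_def
proof (induction c rule: frag_induction)
  case (one \<sigma>)
  then show ?case using cap_chain_boundary_frag by blast
next
  case (diff a b)
  then show ?case by (simp add: chain_boundary_diff cap_diff frag_cmul_diff_distrib2)
qed simp

text \<open>Through this adjunction between cup and cap, the Leibniz rule for cochains is read off
  from the one for chains, without a second computation with faces.\<close>

lemma cup_eq_cap:
  assumes "singular_simplex (p + q) X \<sigma>"
  shows "cup p q X \<phi> \<psi> \<sigma> = cochain_eval \<psi> (cap (p + q) p (frag_of \<sigma>) \<phi>)"
  using assms by (simp add: cup_def cap_frag_of cochain_eval_cmul)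

lemma cochain_eval_cup:
  assumes "singular_chain (p + q) X c"
  shows "cochain_eval (cup p q X \<phi> \<psi>) c = cochain_eval \<psi> (cap (p + q) p c \<phi>)"
  using assms unfolding singular_chain_def
proof (induction c rule: frag_induction)
  case (one \<sigma>)
  then show ?case by (simp add: cup_eq_cap)
next
  case (diff a b)
  then show ?case by (simp add: cap_diff cochain_eval_diff)
qed simp

lemma cochain_eval_coboundary:
  assumes "singular_chain (Suc p) X c"
  shows "cochain_eval (coboundary p X \<phi>) c = cochain_eval \<phi> (chain_boundary (Suc p) c)"
  using assms unfolding singular_chain_def
proof (induction c rule: frag_induction)
  case (one \<sigma>)
  then show ?case by (simp add: coboundary_def)
next
  case (diff a b)
  then show ?case by (simp add: chain_boundary_diff cochain_eval_diff)
qed simp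

lemma coboundary_cup:
  "coboundary (p + q) X (cup p q X \<phi> \<psi>) =
     (\<lambda>\<sigma>. cup (Suc p) q X (coboundary p X \<phi>) \<psi> \<sigma> + (-1) ^ p * cup p (Suc q) X \<phi> (coboundary q X \<psi>) \<sigma>)"
proof
  fix \<sigma>
  show "coboundary (p + q) X (cup p q X \<phi> \<psi>) \<sigma> =
     cup (Suc p) q X (coboundary p X \<phi>) \<psi> \<sigma> + (-1) ^ p * cup p (Suc q) X \<phi> (coboundary q X \<psi>) \<sigma>"
  proof (cases "singular_simplex (Suc (p + q)) X \<sigma>")
    case True
    then have 1: "singular_chain (Suc (p + q)) X (frag_of \<sigma>)" by (simp add: singular_chain_of)
    then have 2: "singular_chain (p + q) X (chain_boundary (Suc (p + q)) (frag_of \<sigma>))"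
      by (rule singular_chain_boundary_alt)
    have 3: "singular_chain (Suc q) X (cap (Suc (p + q)) p (frag_of \<sigma>) \<phi>)"
      using singular_chain_cap[OF 1, of p \<phi>] by (simp add: Suc_diff_le)
    have "coboundary (p + q) X (cup p q X \<phi> \<psi>) \<sigma> =
        cochain_eval \<psi> (cap (p + q) p (chain_boundary (Suc (p + q)) (frag_of \<sigma>)) \<phi>)"
      using True cochain_eval_cup[OF 2] by (simp add: coboundary_def)
    also have "\<dots> = cochain_eval \<psi> (cap (Suc (p + q)) (Suc p) (frag_of \<sigma>) (coboundary p X \<phi>))
       + (-1) ^ p * cochain_eval (coboundary q X \<psi>) (cap (Suc (p + q)) p (frag_of \<sigma>) \<phi>)"
      by (simp add: cap_chain_boundary[OF 1] cochain_eval_add cochain_eval_cmul cochain_eval_coboundary[OF 3])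
    finally show ?thesis
      using True cup_eq_cap[of "Suc p" q X \<sigma>] cup_eq_cap[of p "Suc q" X \<sigma>] by simp
  next
    case False
    then show ?thesis by (simp add: coboundary_def cup_def)
  qed
qed

lemma cup_add_left: "cup p q X (\<lambda>\<sigma>. \<phi> \<sigma> + \<phi>' \<sigma>) \<psi> = (\<lambda>\<sigma>. cup p q X \<phi> \<psi> \<sigma> + cup p q X \<phi>' \<psi> \<sigma>)"
  by (auto simp: cup_def fun_eq_iff algebra_simps)

lemma cup_add_right: "cup p q X \<phi> (\<lambda>\<sigma>. \<psi> \<sigma> + \<psi>' \<sigma>) = (\<lambda>\<sigma>. cup p q X \<phi> \<psi> \<sigma> + cup p q X \<phi> \<psi>' \<sigma>)"
  by (auto simp: cup_def fun_eq_iff algebra_simps)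

lemma cup_0 [simp]: "cup p q X (\<lambda>_. 0) \<psi> = (\<lambda>_. 0)" "cup p q X \<phi> (\<lambda>_. 0) = (\<lambda>_. 0)"
  by (auto simp: cup_def)

section \<open>Cocycles, coboundaries and products of cohomology classes\<close>

lemma not_singular_simplex_empty: "\<not> singular_simplex p trivial_topology \<sigma>"
  by (simp add: singular_simplex_empty)

lemma singular_cochain_empty:
  "singular_cochain p X {} \<phi> \<longleftrightarrow> (\<forall>\<sigma>. \<not> singular_simplex p X \<sigma> \<longrightarrow> \<phi> \<sigma> = 0)"
  by (simp add: singular_cochain_def not_singular_simplex_empty)

lemma singular_cochain_cup: "singular_cochain (p + q) X {} (cup p q X \<phi> \<psi>)"
  by (simp add: singular_cochain_empty cup_def)

lemma coboundary_add: "coboundary p X (\<lambda>\<sigma>. \<phi> \<sigma> + \<psi> \<sigma>) = (\<lambda>\<sigma>. coboundary p X \<phi> \<sigma> + coboundary p X \<psi> \<sigma>)"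
  by (auto simp: fun_eq_iff coboundary_def cochain_eval_def sum.distrib distrib_left)

lemma coboundary_cmul: "coboundary p X (\<lambda>\<sigma>. m * \<phi> \<sigma>) = (\<lambda>\<sigma>. m * coboundary p X \<phi> \<sigma>)"
  by (auto simp: fun_eq_iff coboundary_def cochain_eval_def sum_distrib_left mult.left_commute)

lemma coboundary_0 [simp]: "coboundary p X (\<lambda>_. 0) = (\<lambda>_. 0)"
  using coboundary_cmul[of p X 0 "\<lambda>_. 0"] by simp

lemma coboundary_coboundary: "coboundary (Suc p) X (coboundary p X \<phi>) = (\<lambda>_. 0)"
proof
  fix \<sigma>
  show "coboundary (Suc p) X (coboundary p X \<phi>) \<sigma> = 0"
  proof (cases "singular_simplex (Suc (Suc p)) X \<sigma>")
    case True
    then have 1: "singular_chain (Suc (Suc p)) X (frag_of \<sigma>)" by (simp add: singular_chain_of)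
    then show ?thesis
      using True chain_boundary_boundary_alt[OF 1]
      by (simp add: coboundary_def[of "Suc p"] cochain_eval_coboundary singular_chain_boundary_alt)
  qed (simp add: coboundary_def)
qed

lemma mem_cocycle_group:
  "\<phi> \<in> carrier (cocycle_group p X S) \<longleftrightarrow> singular_cochain p X S \<phi> \<and> coboundary p X \<phi> = (\<lambda>_. 0)"
  by (simp add: cocycle_group_def)

lemma cohomology_class_eq: "cohomology_class p X S \<phi> = (\<lambda>b \<sigma>. b \<sigma> + \<phi> \<sigma>) ` coboundary_set p X S"
  by (auto simp: cohomology_class_def r_coset_def cocycle_group_def)

lemma carrier_relative_cohomology_group:
  "carrier (relative_cohomology_group p X S) = cohomology_class p X S ` carrier (cocycle_group p X S)"
  by (auto simp: relative_cohomology_group_def FactGroup_def RCOSETS_def cohomology_class_def)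

text \<open>Degree 0 has no incoming coboundary and is defined separately. With zero as an explicit
  alternative, later proofs handle all degrees by one elimination.\<close>

lemma coboundary_set_empty:
  "b \<in> coboundary_set p X {} \<longleftrightarrow> b = (\<lambda>_. 0) \<or> (\<exists>q a. p = Suc q \<and> singular_cochain q X {} a \<and> b = coboundary q X a)"
proof (cases p)
  case (Suc q)
  have "singular_cochain q X {} (\<lambda>_. 0)" by (simp add: singular_cochain_empty)
  then show ?thesis using Suc coboundary_0[of q X] by (force simp: coboundary_set_def)
qed (simp add: coboundary_set_def)

lemma zero_in_coboundary_set: "(\<lambda>_. 0) \<in> coboundary_set p X {}"
  by (simp add: coboundary_set_empty)

lemma coboundary_set_add:
  assumes "a \<in> coboundary_set p X {}" "b \<in> coboundary_set p X {}"
  shows "(\<lambda>\<sigma>. a \<sigma> + b \<sigma>) \<in> coboundary_set p X {}"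
proof (cases p)
  case (Suc q)
  then obtain a' b' where ab: "singular_cochain q X {} a'" "a = coboundary q X a'" 
     "singular_cochain q X {} b'" "b = coboundary q X b'"
    using assms by (auto simp: coboundary_set_def)
  have "singular_cochain q X {} (\<lambda>\<sigma>. a' \<sigma> + b' \<sigma>)" using ab by (simp add: singular_cochain_empty)
  then show ?thesis
    using Suc ab by (auto simp: coboundary_set_def coboundary_add[symmetric])
qed (use assms in \<open>simp add: coboundary_set_def\<close>)

lemma coboundary_set_cmul:
  assumes "a \<in> coboundary_set p X {}"
  shows "(\<lambda>\<sigma>. m * a \<sigma>) \<in> coboundary_set p X {}"
proof (cases p)
  case (Suc q)
  then obtain a' where ab: "singular_cochain q X {} a'" "a = coboundary q X a'" 
    using assms by (auto simp: coboundary_set_def)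
  have "singular_cochain q X {} (\<lambda>\<sigma>. m * a' \<sigma>)" using ab by (simp add: singular_cochain_empty)
  then show ?thesis
    using Suc ab by (auto simp: coboundary_set_def coboundary_cmul[symmetric])
qed (use assms in \<open>simp add: coboundary_set_def\<close>)

lemma mem_cohomology_class:
  "\<psi> \<in> cohomology_class p X {} \<phi> \<longleftrightarrow> (\<lambda>\<sigma>. \<psi> \<sigma> - \<phi> \<sigma>) \<in> coboundary_set p X {}"
  by (force simp: cohomology_class_eq image_iff fun_eq_iff)

lemma cohomology_class_self: "\<phi> \<in> cohomology_class p X {} \<phi>"
  by (simp add: mem_cohomology_class zero_in_coboundary_set)

lemma cohomology_class_cong:
  assumes "\<psi> \<in> cohomology_class p X {} \<phi>"
  shows "cohomology_class p X {} \<psi> = cohomology_class p X {} \<phi>"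
proof -
  have 1: "(\<lambda>\<sigma>. \<psi> \<sigma> - \<phi> \<sigma>) \<in> coboundary_set p X {}" using assms by (simp add: mem_cohomology_class)
  have 2: "(\<lambda>\<sigma>. - 1 * (\<psi> \<sigma> - \<phi> \<sigma>)) \<in> coboundary_set p X {}" by (rule coboundary_set_cmul[OF 1])
  show ?thesis
  proof (intro equalityI subsetI)
    fix \<theta> assume "\<theta> \<in> cohomology_class p X {} \<psi>"
    then show "\<theta> \<in> cohomology_class p X {} \<phi>"
      using coboundary_set_add[OF _ 1, of "\<lambda>\<sigma>. \<theta> \<sigma> - \<psi> \<sigma>"] by (simp add: mem_cohomology_class)
  next
    fix \<theta> assume "\<theta> \<in> cohomology_class p X {} \<phi>"
    then show "\<theta> \<in> cohomology_class p X {} \<psi>"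
      using coboundary_set_add[OF _ 2, of "\<lambda>\<sigma>. \<theta> \<sigma> - \<phi> \<sigma>"] by (simp add: mem_cohomology_class)
  qed
qed

lemma cohomology_class_cocycle:
  assumes "\<psi> \<in> cohomology_class p X {} \<phi>" "\<phi> \<in> carrier (cocycle_group p X {})"
  shows "\<psi> \<in> carrier (cocycle_group p X {})"
proof -
  have 1: "(\<lambda>\<sigma>. \<psi> \<sigma> - \<phi> \<sigma>) \<in> coboundary_set p X {}" using assms by (simp add: mem_cohomology_class)
  define b where "b = (\<lambda>\<sigma>. \<psi> \<sigma> - \<phi> \<sigma>)"
  have psi: "\<psi> = (\<lambda>\<sigma>. b \<sigma> + \<phi> \<sigma>)" by (simp add: b_def)
  have "singular_cochain p X {} b \<and> coboundary p X b = (\<lambda>_. 0)"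
    using 1 unfolding b_def[symmetric] coboundary_set_empty
    by (auto simp: coboundary_coboundary singular_cochain_empty) (simp add: coboundary_def)
  then show ?thesis
    using assms(2) unfolding mem_cocycle_group psi coboundary_add by (simp add: singular_cochain_empty)
qed

lemma cup_cocycle:
  assumes "\<phi> \<in> carrier (cocycle_group p X {})" "\<psi> \<in> carrier (cocycle_group q X {})"
  shows "cup p q X \<phi> \<psi> \<in> carrier (cocycle_group (p + q) X {})"
  using assms by (simp add: mem_cocycle_group singular_cochain_cup coboundary_cup)

lemma cup_coboundary_left:
  assumes "a \<in> coboundary_set p X {}" "\<psi> \<in> carrier (cocycle_group q X {})"
  shows "cup p q X a \<psi> \<in> coboundary_set (p + q) X {}"
  using assms(1) unfolding coboundary_set_empty[of a]
proof (elim disjE exE conjE)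
  fix r a' assume *: "p = Suc r" "singular_cochain r X {} a'" "a = coboundary r X a'"
  have "cup p q X a \<psi> = coboundary (r + q) X (cup r q X a' \<psi>)"
    using assms(2) * by (simp add: coboundary_cup mem_cocycle_group)
  then show ?thesis using singular_cochain_cup[of r q X] * by (auto simp: coboundary_set_empty)
qed (simp add: zero_in_coboundary_set)

lemma cup_coboundary_right:
  assumes "\<phi> \<in> carrier (cocycle_group p X {})" "b \<in> coboundary_set q X {}" 
  shows "cup p q X \<phi> b \<in> coboundary_set (p + q) X {}"
  using assms(2) unfolding coboundary_set_empty[of b]
proof (elim disjE exE conjE)
  fix r b' assume *: "q = Suc r" "singular_cochain r X {} b'" "b = coboundary r X b'"
  have "coboundary (p + r) X (cup p r X \<phi> b') = (\<lambda>\<sigma>. (-1) ^ p * cup p q X \<phi> b \<sigma>)"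
    using assms(1) * by (simp add: coboundary_cup mem_cocycle_group)
  then have "(\<lambda>\<sigma>. (-1) ^ p * cup p q X \<phi> b \<sigma>) \<in> coboundary_set (p + q) X {}"
    using singular_cochain_cup[of p r X \<phi> b'] *(1) unfolding coboundary_set_empty by (metis add_Suc_right)
  \<comment> \<open>The Leibniz rule gives the product up to the sign \<open>(-1) ^ p\<close>, which
    multiplication by the same sign removes.\<close>
  from coboundary_set_cmul[OF this, of "(-1) ^ p"] show ?thesis
    by (simp add: mult.assoc[symmetric] power_mult_distrib[symmetric])
qed (simp add: zero_in_coboundary_set)

text \<open>\<open>cup_class\<close> is a union over all pairs of representatives. It is a single
  class because all these products are cohomologous and because there is at least one pair.\<close>

lemma cup_class_cohomology_class:
  assumes "\<phi> \<in> carrier (cocycle_group p X {})" "\<psi> \<in> carrier (cocycle_group q X {})"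
  shows "cup_class p q X {} (cohomology_class p X {} \<phi>) (cohomology_class q X {} \<psi>) =
    cohomology_class (p + q) X {} (cup p q X \<phi> \<psi>)"
proof -
  have "cohomology_class (p + q) X {} (cup p q X \<phi>' \<psi>') = cohomology_class (p + q) X {} (cup p q X \<phi> \<psi>)"
    if "\<phi>' \<in> cohomology_class p X {} \<phi>" "\<psi>' \<in> cohomology_class q X {} \<psi>" for \<phi>' \<psi>'
  proof (rule cohomology_class_cong)
    define a where "a = (\<lambda>\<sigma>. \<phi>' \<sigma> - \<phi> \<sigma>)"
    define b where "b = (\<lambda>\<sigma>. \<psi>' \<sigma> - \<psi> \<sigma>)"
    have ab: "a \<in> coboundary_set p X {}" "b \<in> coboundary_set q X {}"
      using that by (simp_all add: a_def b_def mem_cohomology_class)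
    have *: "\<phi>' = (\<lambda>\<sigma>. \<phi> \<sigma> + a \<sigma>)" "\<psi>' = (\<lambda>\<sigma>. \<psi> \<sigma> + b \<sigma>)" by (auto simp: a_def b_def)
    \<comment> \<open>The expansion is asymmetric: the second correction term contains
      \<open>\<psi>'\<close>, which is a cocycle just as \<psi> is.\<close>
    have "(\<lambda>\<sigma>. cup p q X \<phi>' \<psi>' \<sigma> - cup p q X \<phi> \<psi> \<sigma>) =
       (\<lambda>\<sigma>. cup p q X \<phi> b \<sigma> + cup p q X a \<psi>' \<sigma>)"
      unfolding *(1) cup_add_left by (simp add: *(2) cup_add_right)
    also have "\<dots> \<in> coboundary_set (p + q) X {}"
      using ab assms cohomology_class_cocycle[OF that(2) assms(2)]
      by (intro coboundary_set_add cup_coboundary_left cup_coboundary_right)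
    finally show "cup p q X \<phi>' \<psi>' \<in> cohomology_class (p + q) X {} (cup p q X \<phi> \<psi>)"
      by (simp add: mem_cohomology_class)
  qed
  moreover have "cohomology_class p X {} \<phi> \<noteq> {}" "cohomology_class q X {} \<psi> \<noteq> {}"
    using cohomology_class_self by (metis empty_iff)+
  ultimately show ?thesis
    unfolding cup_class_def by simp
qed

section \<open>Local contractibility of compact manifolds\<close>

text \<open>Urysohn's argument: every pair of basic sets, the closure of one inside the other,
  contributes one real function, and together they map the space to a countable product of lines.
  Compactness turns this continuous injection into a closed embedding. A metric is wanted because
  the filling argument near \<open>\<Gamma>\<close> compares radii.\<close>

lemma compact_Hausdorff_second_countable_imp_metrizable:
  assumes "compact_space X" "Hausdorff_space X" "second_countable X"
  shows "metrizable_space X"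
proof -
  have normal: "normal_space X" and regular: "regular_space X"
    using assms compact_Hausdorff_or_regular_imp_normal_space compact_Hausdorff_imp_regular_space by blast+
  have nb: "\<And>W x. openin X W \<Longrightarrow> x \<in> W \<Longrightarrow>
      \<exists>U C. openin X U \<and> closedin X C \<and> x \<in> U \<and> U \<subseteq> C \<and> C \<subseteq> W"
    using regular unfolding neighbourhood_base_of_closedin[symmetric] neighbourhood_base_of by blast
  obtain \<B> where \<B>: "countable \<B>" "\<And>V. V \<in> \<B> \<Longrightarrow> openin X V"
    "\<And>U x. openin X U \<Longrightarrow> x \<in> U \<Longrightarrow> \<exists>V \<in> \<B>. x \<in> V \<and> V \<subseteq> U"
    using assms(3) unfolding second_countable_def by metis
  define P where "P = {(U, V) \<in> \<B> \<times> \<B>. X closure_of U \<subseteq> V}"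
  have "countable P"
    unfolding P_def by (rule countable_subset[of _ "\<B> \<times> \<B>"]) (use \<B>(1) in auto)
  \<comment> \<open>Continuity is demanded for every \<open>p\<close>, also outside
    \<open>P\<close>: if \<open>P\<close> is empty, the values of \<open>from_nat_into P\<close> are
    arbitrary, and \<open>F\<close> must still be continuous.\<close>
  define Q :: "('a set \<times> 'a set) \<Rightarrow> ('a \<Rightarrow> real) \<Rightarrow> bool" where "Q p f \<longleftrightarrow> continuous_map X euclideanreal f \<and>
      (p \<in> P \<longrightarrow> f ` (X closure_of fst p) \<subseteq> {0} \<and> f ` (topspace X - snd p) \<subseteq> {1})" for p f
  have "\<exists>f. Q p f" for p
  proof (cases "p \<in> P")
    case True
    then have "openin X (snd p)" "X closure_of fst p \<subseteq> snd p"
      using \<B>(2) by (auto simp: P_def)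
    then have "closedin X (X closure_of fst p)" "closedin X (topspace X - snd p)"
      "disjnt (X closure_of fst p) (topspace X - snd p)"
      by (auto simp: disjnt_def)
    then have "\<exists>f. continuous_map X euclideanreal f \<and>
        f ` (X closure_of fst p) \<subseteq> {0} \<and> f ` (topspace X - snd p) \<subseteq> {1}"
      using normal_space_iff_Urysohn_alt[THEN iffD1, OF normal] by simp
    then show ?thesis using True by (simp add: Q_def)
  next
    case False
    then show ?thesis by (intro exI[of _ "\<lambda>_. 0"]) (auto simp: Q_def)
  qed
  then obtain f where "\<And>p. Q p (f p)"
    by metis
  then have f: "\<And>p. continuous_map X euclideanreal (f p)"
    "\<And>p. p \<in> P \<Longrightarrow> f p ` (X closure_of fst p) \<subseteq> {0} \<and> f p ` (topspace X - snd p) \<subseteq> {1}"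
    unfolding Q_def by simp_all
  define F where "F x = (\<lambda>i. f (from_nat_into P i) x)" for x
  have cont: "continuous_map X euclidean F"
    unfolding euclidean_product_topology[symmetric] continuous_map_componentwise_UNIV F_def using f(1) by blast
  have "inj_on F (topspace X)"
  proof (rule inj_onI, rule ccontr)
    fix x y assume xy: "x \<in> topspace X" "y \<in> topspace X" "F x = F y" "x \<noteq> y"
    obtain W W' where "openin X W" "openin X W'" "x \<in> W" "y \<in> W'" "disjnt W W'"
      using assms(2)[unfolded Hausdorff_space_def, rule_format, of x y] xy(1,2,4) by auto
    then have W: "openin X W" "x \<in> W" "y \<notin> W"
      by (auto simp: disjnt_def)
    then obtain V where V: "V \<in> \<B>" "x \<in> V" "V \<subseteq> W" using \<B>(3)[OF W(1,2)] by blast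
    obtain U0 C where U0: "openin X U0" "closedin X C" "x \<in> U0" "U0 \<subseteq> C" "C \<subseteq> V"
      using nb[OF \<B>(2)[OF V(1)] V(2)] by blast
    then obtain U where U: "U \<in> \<B>" "x \<in> U" "U \<subseteq> U0" using \<B>(3)[OF U0(1,3)] by blast
    have "X closure_of U \<subseteq> V" using U0 U closure_of_minimal[of U C X] by blast
    then have p: "(U, V) \<in> P" using U V by (simp add: P_def)
    obtain i where i: "from_nat_into P i = (U, V)"
      using from_nat_into_surj[OF \<open>countable P\<close> p] by blast
    have "x \<in> X closure_of U" using U(1,2) \<B>(2) closure_of_subset[of U X] openin_subset by blast
    then have "f (U, V) x = 0" using f(2)[OF p] by auto
    moreover have "f (U, V) y = 1" using f(2)[OF p] xy(2) W(3) V(3) by (auto simp: image_subset_iff)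
    ultimately show False using fun_cong[OF xy(3), of i] by (simp add: F_def i)
  qed
  moreover have "closed_map X euclidean F"
    using cont assms(1) by (simp add: continuous_imp_closed_map_gen Hausdorff_imp_kc_space)
  ultimately have "X homeomorphic_space (subtopology euclidean (F ` topspace X))"
    by (intro embedding_map_imp_homeomorphic_space injective_closed_imp_embedding_map cont)
  then show ?thesis
    by (simp add: homeomorphic_metrizable_space metrizable_space_subtopology metrizable_space_euclidean)
qed

text \<open>This is the strong form, in which the small neighbourhood contracts within itself and
  not merely inside \<open>U\<close>. Cycles can then be filled without leaving the set that
  contains them.\<close>

definition locally_contractible :: "'a topology \<Rightarrow> bool" where
  "locally_contractible X \<longleftrightarrow> (\<forall>U x. openin X U \<and> x \<in> U \<longrightarrow>
     (\<exists>V. openin X V \<and> x \<in> V \<and> V \<subseteq> U \<and> contractible_space (subtopology X V)))"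

lemma contractible_space_box:
  fixes I :: "nat \<Rightarrow> real set"
  assumes I: "\<And>i. convex (I i)"
  shows "contractible_space (subtopology (powertop_real UNIV) {x. \<forall>i. x i \<in> I i})"
proof (cases "\<exists>a. \<forall>i. a i \<in> I i")
  case True
  then obtain a where a: "\<And>i. a i \<in> I i" by blast
  let ?S = "{x. \<forall>i. x i \<in> I i}"
  let ?X = "subtopology (powertop_real UNIV) ?S"
  let ?h = "\<lambda>(t::real, x::nat \<Rightarrow> real). \<lambda>i. (1 - t) * x i + t * a i"
  have "homotopic_with (\<lambda>x. True) ?X ?X id (\<lambda>x. a)"
    unfolding homotopic_with_def
  proof (intro exI[of _ ?h] conjI)
    have comp: "continuous_map (prod_topology (top_of_set {0..1}) ?X) euclideanreal
        (\<lambda>p. (1 - fst p) * snd p i + fst p * a i)" for i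
    proof -
      have "continuous_map (prod_topology (top_of_set {0..1}) ?X) euclideanreal (\<lambda>p. fst p)"
        using continuous_map_into_fulltopology continuous_map_fst by blast
      moreover have "continuous_map (prod_topology (top_of_set {0..1}) ?X) euclideanreal (\<lambda>p. snd p i)"
      proof -
        have "continuous_map ?X euclideanreal (\<lambda>x. x i)"
          by (intro continuous_map_from_subtopology continuous_map_product_projection) simp
        from continuous_map_compose[OF continuous_map_snd this] show ?thesis
          by (simp add: o_def)
      qed
      ultimately show ?thesis
        by (intro continuous_map_add continuous_map_real_mult continuous_map_diff) auto
    qed
    have "?h p i \<in> I i" if "p \<in> {0..1} \<times> ?S" for p i
      using that convexD_alt[OF I, of "snd p i" i "a i" "fst p"] a by (auto simp: case_prod_unfold)
    with comp show "continuous_map (prod_topology (top_of_set {0..1}) ?X) ?X ?h"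
      unfolding continuous_map_in_subtopology
      by (auto simp: continuous_map_componentwise_UNIV case_prod_unfold)
  qed auto
  then show ?thesis unfolding contractible_space_def by blast
next
  case False
  then have "{x. \<forall>i. x i \<in> I i} = {}" by auto
  then show ?thesis by (metis contractible_space_empty subtopology_empty_iff_trivial)
qed

lemma locally_contractible_Euclidean_space: "locally_contractible (Euclidean_space n)"
  unfolding locally_contractible_def
proof (intro allI impI, elim conjE)
  fix W and y :: "nat \<Rightarrow> real"
  assume "openin (Euclidean_space n) W" and y: "y \<in> W"
  then obtain T where T: "openin (powertop_real UNIV) T" "W = T \<inter> {x. \<forall>i\<ge>n. x i = 0}"
    unfolding Euclidean_space_def openin_subtopology by blast
  then obtain U where U: "finite {i. U i \<noteq> UNIV}" "\<And>i. openin euclideanreal (U i)"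
     "y \<in> Pi\<^sub>E UNIV U" "Pi\<^sub>E UNIV U \<subseteq> T"
    using y unfolding openin_product_topology_alt by (auto dest!: bspec[of T _ y])
  then have op: "\<And>i. open (U i)" and yU: "\<And>i. y i \<in> U i" and UT: "\<And>x. (\<And>i. x i \<in> U i) \<Longrightarrow> x \<in> T"
    by auto
  have "\<exists>e>0. ball (y i) e \<subseteq> U i" for i
    using op yU by (meson open_contains_ball)
  then obtain e where e: "\<And>i. e i > 0" "\<And>i. ball (y i) (e i) \<subseteq> U i" by metis
  \<comment> \<open>Coordinates left free by \<open>U\<close> remain free, since a proper ball in
    infinitely many coordinates would not be open in the product topology. In \<open>I\<close> the
    factors from index \<open>n\<close> on are cut down to \<open>{0}\<close>, because points of
    \<open>Euclidean_space n\<close> are sequences vanishing there. Every factor is still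
    convex.\<close>
  define J where "J i = (if U i = UNIV then UNIV else ball (y i) (e i))" for i
  define I where "I i = (if i < n then J i else J i \<inter> {0})" for i
  define V where "V = {x. \<forall>i. x i \<in> I i}"
  have V: "V = Pi\<^sub>E UNIV J \<inter> {x. \<forall>i\<ge>n. x i = 0}"
  proof -
    have "(\<forall>i. x i \<in> I i) \<longleftrightarrow> (\<forall>i. x i \<in> J i) \<and> (\<forall>i\<ge>n. x i = 0)" for x
      unfolding I_def by (metis Int_iff insertCI not_le singletonD)
    then show ?thesis unfolding V_def by (auto simp: PiE_def Pi_def)
  qed
  have "openin (powertop_real UNIV) (Pi\<^sub>E UNIV J)"
    unfolding openin_PiE_gen
  proof (intro disjI2 conjI ballI)
    have "{i \<in> UNIV. J i \<noteq> topspace euclideanreal} \<subseteq> {i. U i \<noteq> UNIV}" by (auto simp: J_def)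
    then show "finite {i \<in> UNIV. J i \<noteq> topspace euclideanreal}" using U(1) finite_subset by blast
  qed (auto simp: J_def)
  then have "openin (Euclidean_space n) V"
    unfolding Euclidean_space_def V openin_subtopology by blast
  moreover have "y \<in> V"
    unfolding V using y T(2) e(1) by (auto simp: J_def)
  moreover have "V \<subseteq> W"
  proof
    fix x assume x: "x \<in> V"
    have "J i \<subseteq> U i" for i using e(2) by (auto simp: J_def)
    moreover have "x i \<in> J i" for i using x unfolding V by auto
    ultimately have "x \<in> T" using UT by blast
    then show "x \<in> W" using x unfolding V T(2) by blast
  qed
  moreover have "contractible_space (subtopology (Euclidean_space n) V)"
  proof -
    have "convex (I i)" for i
      by (auto simp: I_def J_def intro: convex_Int)
    then have "contractible_space (subtopology (powertop_real UNIV) V)"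
      unfolding V_def by (rule contractible_space_box)
    moreover have "{x. \<forall>i\<ge>n. x i = 0} \<inter> V = V" unfolding V by blast
    ultimately show ?thesis by (simp add: Euclidean_space_def subtopology_subtopology)
  qed
  ultimately show "\<exists>V. openin (Euclidean_space n) V \<and> y \<in> V \<and> V \<subseteq> W \<and>
      contractible_space (subtopology (Euclidean_space n) V)"
    by blast
qed

lemma manifold_imp_locally_contractible:
  assumes "manifold n X"
  shows "locally_contractible X"
  unfolding locally_contractible_def
proof (intro allI impI, elim conjE)
  fix U x assume U: "openin X U" "x \<in> U"
  then have "x \<in> topspace X" using openin_subset by blast
  then obtain A W where A: "openin X A" "x \<in> A" "openin (Euclidean_space n) W"
     "subtopology X A homeomorphic_space subtopology (Euclidean_space n) W"
    using assms unfolding manifold_def by blast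
  then obtain f g where fg: "homeomorphic_maps (subtopology X A) (subtopology (Euclidean_space n) W) f g"
    unfolding homeomorphic_space_def by blast
  let ?E = "subtopology (Euclidean_space n) W"
  have Atop: "topspace (subtopology X A) = A" and Wtop: "topspace ?E = W"
    using openin_subset[OF A(1)] openin_subset[OF A(3)] by auto
  have hf: "homeomorphic_map (subtopology X A) ?E f" and hg: "homeomorphic_map ?E (subtopology X A) g"
    using fg homeomorphic_maps_map by blast+
  have "openin (subtopology X A) (U \<inter> A)" using U(1) by (simp add: openin_subtopology_Int)
  then have "openin ?E (f ` (U \<inter> A))"
    using homeomorphic_map_openness[OF hf, of "U \<inter> A"] Atop by blast
  then have "openin (Euclidean_space n) (f ` (U \<inter> A))"
    using A(3) openin_trans_full by blast
  moreover have "f x \<in> f ` (U \<inter> A)" using U A by blast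
  ultimately obtain V where V: "openin (Euclidean_space n) V" "f x \<in> V" "V \<subseteq> f ` (U \<inter> A)"
     "contractible_space (subtopology (Euclidean_space n) V)"
    using locally_contractible_Euclidean_space unfolding locally_contractible_def by meson
  have gf: "\<And>z. z \<in> A \<Longrightarrow> g (f z) = z" and fA: "f ` A \<subseteq> W"
    using fg Atop Wtop by (auto simp: homeomorphic_maps_def continuous_map_def Pi_def)
  have VW: "V \<subseteq> W" using V(3) fA by blast
  have gV: "g ` V \<subseteq> U \<inter> A" using V(3) gf by (auto simp: image_iff)
  have "openin ?E V" using V(1) VW unfolding openin_subtopology by blast
  then have "openin (subtopology X A) (g ` V)"
    using homeomorphic_map_openness[OF hg, of V] VW Wtop by blast
  then have 1: "openin X (g ` V)" using A(1) openin_trans_full by blast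
  have "x \<in> g ` V" using V(2) gf[OF A(2)] by (metis image_eqI)
  moreover have "contractible_space (subtopology X (g ` V))"
  proof -
    have "homeomorphic_map (subtopology ?E V) (subtopology (subtopology X A) (g ` V)) g"
    proof (rule homeomorphic_map_subtopologies[OF hg])
      show "g ` (topspace ?E \<inter> V) = topspace (subtopology X A) \<inter> g ` V"
        unfolding Atop Wtop using VW gV by blast
    qed
    then have "subtopology ?E V homeomorphic_space subtopology (subtopology X A) (g ` V)"
      using homeomorphic_map_imp_homeomorphic_space by blast
    moreover have "subtopology ?E V = subtopology (Euclidean_space n) V"
      using VW by (simp add: subtopology_subtopology inf_absorb2)
    moreover have "subtopology (subtopology X A) (g ` V) = subtopology X (g ` V)"
      using gV by (simp add: subtopology_subtopology inf_absorb2)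
    ultimately show ?thesis
      using V(4) homeomorphic_space_contractibility by metis
  qed
  ultimately show "\<exists>V. openin X V \<and> x \<in> V \<and> V \<subseteq> U \<and> contractible_space (subtopology X V)"
    using 1 gV by blast
qed

text \<open>The radius is a Lebesgue number of the cover by contractible open sets lying in balls of
  radius \<open>\<epsilon> / 2\<close>. Such a ball is centred at some other point, and since the
  set also contains \<open>x\<close>, doubling the radius recentres it at \<open>x\<close>. The set
  \<open>U\<close> is inserted between two balls because balls themselves need not be
  contractible.\<close>

lemma (in Metric_space) uniformly_locally_contractible:
  assumes "compact_space mtopology" "locally_contractible mtopology" "\<epsilon> > 0"
  shows "\<exists>\<delta>>0. \<forall>x\<in>M. \<exists>U. mball x \<delta> \<subseteq> U \<and> U \<subseteq> mball x \<epsilon> \<and> contractible_space (subtopology mtopology U)"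
proof -
  define \<C> where "\<C> = {U. openin mtopology U \<and> contractible_space (subtopology mtopology U) \<and>
     (\<exists>y\<in>M. U \<subseteq> mball y (\<epsilon> / 2))}"
  have "M \<subseteq> \<Union>\<C>"
  proof
    fix y assume y: "y \<in> M"
    then have "openin mtopology (mball y (\<epsilon> / 2))" "y \<in> mball y (\<epsilon> / 2)"
      using assms(3) by auto
    then obtain V where "openin mtopology V" "y \<in> V" "V \<subseteq> mball y (\<epsilon> / 2)" "contractible_space (subtopology mtopology V)"
      using assms(2) unfolding locally_contractible_def by meson
    then show "y \<in> \<Union>\<C>" using y unfolding \<C>_def by blast
  qed
  moreover have "compactin mtopology M" using assms(1) by (simp add: compact_space_def)
  ultimately obtain \<delta> where \<delta>: "\<delta> > 0" "\<And>x. x \<in> M \<Longrightarrow> \<exists>U\<in>\<C>. mball x \<delta> \<subseteq> U"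
    using lebesgue_number[of M \<C>] unfolding \<C>_def by blast
  have "U \<subseteq> mball x \<epsilon>" if xU: "x \<in> M" "U \<in> \<C>" "mball x \<delta> \<subseteq> U" for x U
  proof
    fix z assume z: "z \<in> U"
    obtain y where y: "y \<in> M" "U \<subseteq> mball y (\<epsilon> / 2)" using xU(2) unfolding \<C>_def by blast
    have "x \<in> U" using xU(1,3) \<delta>(1) centre_in_mball_iff by blast
    then have "d y x < \<epsilon> / 2" "d y z < \<epsilon> / 2" "z \<in> M" using z y by auto
    then have "d x z < \<epsilon>" using triangle[of x y z] xU(1) y(1) by (simp add: commute)
    then show "z \<in> mball x \<epsilon>" using xU(1) \<open>z \<in> M\<close> by simp
  qed
  then show ?thesis
    using \<delta> unfolding \<C>_def by (smt (verit) mem_Collect_eq)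
qed

section \<open>Homology of a neighbourhood of a subspace\<close>

text \<open>A contraction makes the cycle homologous to its image under a constant map, which bounds
  in a one-point space if the degree is positive. In degree 0 a single point does not bound, but the
  images of two points cancel. The zero chain is treated apart because the space may then be empty
  and offer no point to contract to.\<close>

lemma contractible_space_cycle_is_boundary:
  assumes "contractible_space Y" and c: "singular_chain p Y c" "chain_boundary p c = 0"
    and p: "0 < p \<or> (\<exists>v w. c = frag_of v - frag_of w)"
  shows "\<exists>e. singular_chain (Suc p) Y e \<and> chain_boundary (Suc p) e = c"
proof (cases "c = 0")
  case False
  then have "topspace Y \<noteq> {}" using c(1) singular_chain_empty by blast
  then have "Y \<noteq> trivial_topology" by auto
  then obtain a where a: "a \<in> topspace Y" "homotopic_with (\<lambda>x. True) Y Y id (\<lambda>x. a)"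
    using assms(1) unfolding contractible_space by blast
  have cyc: "singular_relcycle p Y {} c" using c by (simp add: singular_cycle)
  have "homotopic_with (\<lambda>h. h \<in> {} \<rightarrow> {}) Y Y id (\<lambda>x. a)" using a(2) by simp
  from homotopic_imp_homologous_rel_chain_maps[OF this cyc]
  have hom: "homologous_rel p Y {} c (chain_map p (\<lambda>x. a) c)"
    using chain_map_id_gen[OF c(1), of id] by simp
  have "singular_relboundary p Y {} (chain_map p (\<lambda>x. a) c)"
    using p
  proof
    assume "0 < p"
    have "singular_relcycle p (subtopology Y {a}) {} (chain_map p (\<lambda>x. a) c)"
      by (rule singular_relcycle_chain_map[OF cyc]) (use a in \<open>auto simp: continuous_map_in_subtopology\<close>)
    moreover have "topspace (subtopology Y {a}) = {a}" using a by auto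
    ultimately have "singular_relboundary p (subtopology Y {a}) {} (chain_map p (\<lambda>x. a) c)"
      using singular_boundary_eq_cycle_singleton[of "subtopology Y {a}" a p] \<open>0 < p\<close> by simp
    then show ?thesis
      using singular_boundary_mono[of "{a}" "topspace Y" p Y] a(1) by simp
  next
    assume "\<exists>v w. c = frag_of v - frag_of w"
    then have "chain_map p (\<lambda>x. a) c = 0"
      by (auto simp: chain_map_diff simplex_map_def o_def)
    then show ?thesis by simp
  qed
  with hom have "singular_relboundary p Y {} c"
    by (metis homologous_rel_eq_relboundary homologous_rel_eq)
  then show ?thesis by (simp add: singular_boundary)
qed (auto intro: exI[of _ 0])

text \<open>Additive maps that agree on generators agree. Here \<open>L\<close> is a boundary
  operator and \<open>T\<close> the prescribed boundary: formulas arranged simplex by simplex pass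
  to chains, which is what shows that the next chain to be filled is a cycle.\<close>

lemma frag_extend_additive:
  assumes "\<And>\<sigma>. \<sigma> \<in> Poly_Mapping.keys c \<Longrightarrow> L (F \<sigma>) = T (frag_of \<sigma>)"
    and "L 0 = 0" "\<And>a b. L (a - b) = L a - L b"
    and "T 0 = 0" "\<And>a b. T (a - b) = T a - T b"
  shows "L (frag_extend F c) = (T c :: 'b::ab_group_add)"
proof -
  define A where "A = Poly_Mapping.keys c"
  have "Poly_Mapping.keys c \<subseteq> A" by (simp add: A_def)
  then show ?thesis
  proof (induction c rule: frag_induction)
    case (diff a b)
    then show ?case using assms by (simp add: frag_extend_diff)
  qed (use assms in \<open>auto simp: A_def\<close>)
qed

text \<open>A cycle near \<open>\<Gamma>\<close> is subdivided into simplices of size \<open>\<delta>\<close>. Sending vertices to nearby points of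
  \<open>\<Gamma>\<close> extends, by filling small cycles inside contractible subsets of \<open>\<Gamma>\<close>, to a chain map \<open>f\<^sub>0, f\<^sub>1, f\<^sub>2\<close>;
  filling inside contractible subsets of the whole space gives a chain homotopy \<open>D\<^sub>0, D\<^sub>1, D\<^sub>2\<close> from it
  to the identity. Each filling enlarges the sets involved, so the radii are chosen from the top
  dimension downwards.\<close>

lemma (in Metric_space) neighbourhood_homology_from_subspace:
  assumes compM: "compact_space mtopology" and lcM: "locally_contractible mtopology"
    and comp\<Gamma>: "compactin mtopology \<Gamma>" and lc\<Gamma>: "locally_contractible (subtopology mtopology \<Gamma>)"
  shows "\<exists>W. openin mtopology W \<and> \<Gamma> \<subseteq> W \<and>
    (\<forall>z. singular_relcycle 2 (subtopology mtopology W) {} z \<longrightarrow>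
      (\<exists>y. singular_relcycle 2 (subtopology mtopology \<Gamma>) {} y \<and> homologous_rel 2 mtopology {} z y))"
proof -
  have \<Gamma>M: "\<Gamma> \<subseteq> M" using comp\<Gamma> compactin_subset_topspace by fastforce
  interpret sub: Submetric M d \<Gamma>
    using \<Gamma>M by unfold_locales
  have unifM: "\<exists>\<delta>>0. \<exists>U. \<forall>x\<in>M. mball x \<delta> \<subseteq> U x \<and> U x \<subseteq> mball x \<epsilon> \<and>
     contractible_space (subtopology mtopology (U x))" if "\<epsilon> > 0" for \<epsilon>
    using uniformly_locally_contractible[OF compM lcM that] by metis
  have unif\<Gamma>: "\<exists>\<delta>>0. \<exists>U. \<forall>x\<in>\<Gamma>. mball x \<delta> \<inter> \<Gamma> \<subseteq> U x \<and> U x \<subseteq> mball x \<epsilon> \<inter> \<Gamma> \<and>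
     contractible_space (subtopology mtopology (U x))" if "\<epsilon> > 0" for \<epsilon>
  proof -
    have "compact_space sub.sub.mtopology" "locally_contractible sub.sub.mtopology"
      using comp\<Gamma> lc\<Gamma> by (simp_all add: sub.mtopology_submetric compactin_subspace)
    from sub.sub.uniformly_locally_contractible[OF this that]
    obtain \<delta> where \<delta>: "\<delta> > 0" "\<forall>x\<in>\<Gamma>. \<exists>U. sub.sub.mball x \<delta> \<subseteq> U \<and> U \<subseteq> sub.sub.mball x \<epsilon> \<and>
      contractible_space (subtopology sub.sub.mtopology U)" by blast
    have "\<exists>U. mball x \<delta> \<inter> \<Gamma> \<subseteq> U \<and> U \<subseteq> mball x \<epsilon> \<inter> \<Gamma> \<and> contractible_space (subtopology mtopology U)"
      if x: "x \<in> \<Gamma>" for x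
    proof -
      obtain U where U: "sub.sub.mball x \<delta> \<subseteq> U" "U \<subseteq> sub.sub.mball x \<epsilon>"
        "contractible_space (subtopology sub.sub.mtopology U)" using \<delta>(2) x by blast
      have "sub.sub.mball x r = mball x r \<inter> \<Gamma>" for r using x \<Gamma>M by auto
      moreover have "subtopology sub.sub.mtopology U = subtopology mtopology U" 
        using U(2) calculation by (simp add: sub.mtopology_submetric subtopology_subtopology inf_absorb2)
      ultimately show ?thesis using U by metis
    qed
    then show ?thesis using \<delta>(1) by metis
  qed
  \<comment> \<open>The radius 1 is arbitrary, as the fillings of top dimension only have to lie in
    \<open>M\<close>. From here on a filling radius is at most half of the next tolerance; the other
    half pays for the distance between the centres of the two sets.\<close>
  obtain d2 UM2 where d2: "d2 > 0" and "\<forall>x\<in>M. mball x d2 \<subseteq> UM2 x \<and> UM2 x \<subseteq> mball x 1 \<and>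
     contractible_space (subtopology mtopology (UM2 x))"
    using unifM[of "1"] by auto
  then have UM2: "\<And>x. x \<in> M \<Longrightarrow> mball x d2 \<subseteq> UM2 x"
    "\<And>x. x \<in> M \<Longrightarrow> UM2 x \<subseteq> mball x 1"
    "\<And>x. x \<in> M \<Longrightarrow> contractible_space (subtopology mtopology (UM2 x))"
    by blast+
  obtain d1 UM1 where d1: "d1 > 0" and "\<forall>x\<in>M. mball x d1 \<subseteq> UM1 x \<and> UM1 x \<subseteq> mball x (d2/2) \<and>
     contractible_space (subtopology mtopology (UM1 x))"
    using unifM[of "d2/2"] d2 by auto
  then have UM1: "\<And>x. x \<in> M \<Longrightarrow> mball x d1 \<subseteq> UM1 x"
    "\<And>x. x \<in> M \<Longrightarrow> UM1 x \<subseteq> mball x (d2/2)"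
    "\<And>x. x \<in> M \<Longrightarrow> contractible_space (subtopology mtopology (UM1 x))"
    by blast+
  obtain d0 UM0 where d0: "d0 > 0" and "\<forall>x\<in>M. mball x d0 \<subseteq> UM0 x \<and> UM0 x \<subseteq> mball x (d1/2) \<and>
     contractible_space (subtopology mtopology (UM0 x))"
    using unifM[of "d1/2"] d1 by auto
  then have UM0: "\<And>x. x \<in> M \<Longrightarrow> mball x d0 \<subseteq> UM0 x"
    "\<And>x. x \<in> M \<Longrightarrow> UM0 x \<subseteq> mball x (d1/2)"
    "\<And>x. x \<in> M \<Longrightarrow> contractible_space (subtopology mtopology (UM0 x))"
    by blast+
  obtain a2 UG2 where a2: "a2 > 0" and "\<forall>x\<in>\<Gamma>. mball x a2 \<inter> \<Gamma> \<subseteq> UG2 x \<and> UG2 x \<subseteq> mball x (d2/2) \<inter> \<Gamma> \<and>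
     contractible_space (subtopology mtopology (UG2 x))"
    using unif\<Gamma>[of "d2/2"] d2 by auto
  then have UG2: "\<And>x. x \<in> \<Gamma> \<Longrightarrow> mball x a2 \<inter> \<Gamma> \<subseteq> UG2 x"
    "\<And>x. x \<in> \<Gamma> \<Longrightarrow> UG2 x \<subseteq> mball x (d2/2) \<inter> \<Gamma>"
    "\<And>x. x \<in> \<Gamma> \<Longrightarrow> contractible_space (subtopology mtopology (UG2 x))"
    by blast+
  \<comment> \<open>An edge filled in \<open>\<Gamma>\<close> has to fit into \<open>UG2\<close>, to
    be used in the next filling in \<open>\<Gamma>\<close>, and into \<open>UM1\<close>, to be used
    in the homotopy. This explains the minimum of the two halves.\<close>
  define b1 where "b1 = min (a2/2) (d1/2)"
  have b1: "b1 > 0" "b1 \<le> a2/2" "b1 \<le> d1/2" using a2 d1 by (auto simp: b1_def)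
  obtain a1 UG1 where a1: "a1 > 0" and "\<forall>x\<in>\<Gamma>. mball x a1 \<inter> \<Gamma> \<subseteq> UG1 x \<and> UG1 x \<subseteq> mball x b1 \<inter> \<Gamma> \<and>
     contractible_space (subtopology mtopology (UG1 x))"
    using unif\<Gamma>[of "b1"] b1 by auto
  then have UG1: "\<And>x. x \<in> \<Gamma> \<Longrightarrow> mball x a1 \<inter> \<Gamma> \<subseteq> UG1 x"
    "\<And>x. x \<in> \<Gamma> \<Longrightarrow> UG1 x \<subseteq> mball x b1 \<inter> \<Gamma>"
    "\<And>x. x \<in> \<Gamma> \<Longrightarrow> contractible_space (subtopology mtopology (UG1 x))"
    by blast+
  \<comment> \<open>A simplex lies within \<open>2 * \<delta>\<close> of its first vertex, the first
    vertices of a simplex and of a face are less than \<open>2 * \<delta>\<close> apart, and the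
    points of \<open>\<Gamma>\<close> chosen for them less than \<open>4 * \<delta>\<close>. So
    \<open>4 * \<delta>\<close> must fit into \<open>a1\<close> and into half of \<open>a2\<close>,
    and \<open>2 * \<delta>\<close> into \<open>d0\<close> and into the halves of \<open>d1\<close>
    and \<open>d2\<close>.\<close>
  define \<delta> where "\<delta> = Min {a1/4, a2/8, d0/2, d1/4, d2/4}"
  have \<delta>: "\<delta> > 0" "4 * \<delta> \<le> a1" "8 * \<delta> \<le> a2" "2 * \<delta> \<le> d0" "4 * \<delta> \<le> d1" "4 * \<delta> \<le> d2"
    using a1 a2 d0 d1 d2 by (auto simp: \<delta>_def)
  define S where "S p = {\<sigma>. \<exists>x\<in>\<Gamma>. singular_simplex p (subtopology mtopology (mball x \<delta>)) \<sigma>}" for p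
  define W where "W = (\<Union>x\<in>\<Gamma>. mball x \<delta>)"
  \<comment> \<open>This is the first vertex of the simplex. A face may have a different first
    vertex, so the estimates \<open>S_face\<close> and \<open>S_q\<close> are needed to compare the
    two.\<close>
  define base where "base \<sigma> = \<sigma> (\<lambda>j. if j = 0 then 1 else 0)" for \<sigma> :: "(nat \<Rightarrow> real) \<Rightarrow> 'a"
  define near where "near v = (SOME x. x \<in> \<Gamma> \<and> d x v < \<delta>)" for v
  define q where "q \<sigma> = near (base \<sigma>)" for \<sigma>
  have base_in: "base \<sigma> \<in> U" if "singular_simplex p (subtopology mtopology U) \<sigma>" for p U \<sigma>
    using that unfolding base_def singular_simplex_subtopology image_subset_iff by simp
  have near: "near v \<in> \<Gamma>" "near v \<in> M" "d (near v) v < \<delta>" if "x \<in> \<Gamma>" "v \<in> mball x \<delta>" for x v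
  proof -
    have "\<exists>x. x \<in> \<Gamma> \<and> d x v < \<delta>" using that by auto
    from someI_ex[OF this] show "near v \<in> \<Gamma>" "near v \<in> M" "d (near v) v < \<delta>"
      unfolding near_def using \<Gamma>M by blast+
  qed
  have S_base: "base \<sigma> \<in> M" "q \<sigma> \<in> \<Gamma>" "q \<sigma> \<in> M" "d (q \<sigma>) (base \<sigma>) < \<delta>"
    "singular_simplex p mtopology \<sigma>" "singular_simplex p (subtopology mtopology (mball (base \<sigma>) (2 * \<delta>))) \<sigma>"
    if S: "\<sigma> \<in> S p" for \<sigma> p
  proof -
    obtain x where x: "x \<in> \<Gamma>" "singular_simplex p (subtopology mtopology (mball x \<delta>)) \<sigma>"
      using S unfolding S_def by blast
    then have b: "base \<sigma> \<in> mball x \<delta>" by (intro base_in)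
    then show bM: "base \<sigma> \<in> M" by simp
    show "q \<sigma> \<in> \<Gamma>" "q \<sigma> \<in> M" "d (q \<sigma>) (base \<sigma>) < \<delta>" unfolding q_def using near[OF x(1) b] by auto
    show "singular_simplex p mtopology \<sigma>" using x(2) by (simp add: singular_simplex_subtopology)
    have "mball x \<delta> \<subseteq> mball (base \<sigma>) (2 * \<delta>)"
      using b triangle[of "base \<sigma>" x] by (force simp: commute)
    then show "singular_simplex p (subtopology mtopology (mball (base \<sigma>) (2 * \<delta>))) \<sigma>"
      using x(2) by (rule singular_simplex_mono[rotated])
  qed
  have S_face: "\<tau> \<in> S p" "d (base \<tau>) (base \<sigma>) < 2 * \<delta>"
    if S: "\<sigma> \<in> S (Suc p)" "\<tau> \<in> Poly_Mapping.keys (chain_boundary (Suc p) (frag_of \<sigma>))" for \<sigma> \<tau> p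
  proof -
    obtain x where x: "x \<in> \<Gamma>" "singular_simplex (Suc p) (subtopology mtopology (mball x \<delta>)) \<sigma>"
      using S(1) unfolding S_def by blast
    then have "singular_chain p (subtopology mtopology (mball x \<delta>)) (chain_boundary (Suc p) (frag_of \<sigma>))"
      by (intro singular_chain_boundary_alt) (simp add: singular_chain_of)
    then have \<tau>: "singular_simplex p (subtopology mtopology (mball x \<delta>)) \<tau>"
      using S(2) unfolding singular_chain_def by blast
    then show "\<tau> \<in> S p" using x(1) unfolding S_def by blast
    have "base \<tau> \<in> mball x \<delta>" "base \<sigma> \<in> mball x \<delta>" using base_in[OF \<tau>] base_in[OF x(2)] by auto
    then show "d (base \<tau>) (base \<sigma>) < 2 * \<delta>"
      using triangle[of "base \<tau>" x "base \<sigma>"] by (auto simp: commute)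
  qed
  have S_q: "d (q \<tau>) (q \<sigma>) < 4 * \<delta>" 
    if "\<sigma> \<in> S (Suc p)" "\<tau> \<in> Poly_Mapping.keys (chain_boundary (Suc p) (frag_of \<sigma>))" for \<sigma> \<tau> p
    using S_face[OF that] S_base[OF that(1)] S_base[of \<tau> p]
      triangle[of "q \<tau>" "base \<tau>" "q \<sigma>"] triangle[of "base \<tau>" "base \<sigma>" "q \<sigma>"] by (auto simp: commute)
  have S_keys: "Poly_Mapping.keys (chain_boundary (Suc p) c) \<subseteq> S p" if "Poly_Mapping.keys c \<subseteq> S (Suc p)" for p c
    using that
  proof (induction c rule: frag_induction)
    case (one \<sigma>)
    then show ?case using S_face(1) by blast
  next
    case (diff a b)
    then show ?case
      unfolding chain_boundary_diff
      by (intro order_trans[OF keys_diff] Un_least)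
  qed simp
  have ball_mono: "mball x r \<subseteq> mball y s" if "x \<in> M" "y \<in> M" "d x y + r \<le> s" for x y r s
  proof
    fix z assume "z \<in> mball x r"
    then show "z \<in> mball y s" using that triangle[of y x z] by (auto simp: commute)
  qed
  have Sig: "singular_chain p (subtopology mtopology U) (frag_of \<sigma>)" if "\<sigma> \<in> S p" "mball (base \<sigma>) (2 * \<delta>) \<subseteq> U" for p U \<sigma>
    unfolding singular_chain_of using S_base(6)[OF that(1)] that(2) by (rule singular_simplex_mono)
  have bnd: "chain_boundary (Suc 0) (frag_of \<sigma>) = frag_of (singular_face 1 0 \<sigma>) - frag_of (singular_face 1 1 \<sigma>)"
    for \<sigma> :: "(nat \<Rightarrow> real) \<Rightarrow> 'a"
    by (simp add: chain_boundary_of)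

  \<comment> \<open>The constant map is restricted because singular simplices are extensional
    functions, undefined off the standard simplex.\<close>
  define f0 where "f0 \<sigma> = frag_of (restrict (\<lambda>_. q \<sigma>) (standard_simplex 0))" for \<sigma>
  have f0: "singular_chain 0 (subtopology mtopology U) (f0 \<sigma>)" if "q \<sigma> \<in> U" "q \<sigma> \<in> M" for U \<sigma>
    using that by (auto simp: f0_def singular_chain_of singular_simplex_def continuous_map_in_subtopology)
  have "\<exists>c. singular_chain 1 (subtopology mtopology (UG1 (q \<sigma>))) c \<and>
      chain_boundary 1 c = frag_extend f0 (chain_boundary 1 (frag_of \<sigma>))" if \<sigma>: "\<sigma> \<in> S 1" for \<sigma>
  proof -
    have "singular_chain 0 (subtopology mtopology (UG1 (q \<sigma>))) (frag_extend f0 (chain_boundary (Suc 0) (frag_of \<sigma>)))"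
    proof (rule singular_chain_extend)
      fix \<tau> assume \<tau>: "\<tau> \<in> Poly_Mapping.keys (chain_boundary (Suc 0) (frag_of \<sigma>))"
      have "\<sigma> \<in> S (Suc 0)" using \<sigma> by simp
      note * = S_face(1)[OF this \<tau>] S_q[OF this \<tau>]
      have "q \<tau> \<in> mball (q \<sigma>) a1 \<inter> \<Gamma>"
        using * S_base[OF *(1)] S_base[OF \<sigma>] \<delta> by (auto simp: commute)
      then have "q \<tau> \<in> UG1 (q \<sigma>)" using UG1(1) S_base(2)[OF \<sigma>] by blast
      then show "singular_chain 0 (subtopology mtopology (UG1 (q \<sigma>))) (f0 \<tau>)"
        using f0 S_base(3)[OF *(1)] by blast
    qed
    \<comment> \<open>Every 0-chain is a cycle, so in this degree the filling lemma asks for a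
      difference of two points instead.\<close>
    moreover have "\<exists>v w. frag_extend f0 (chain_boundary (Suc 0) (frag_of \<sigma>)) = frag_of v - frag_of w"
      unfolding bnd frag_extend_diff by (auto simp: f0_def)
    ultimately show ?thesis
      using contractible_space_cycle_is_boundary[OF UG1(3)[OF S_base(2)[OF \<sigma>]],
          of 0 "frag_extend f0 (chain_boundary (Suc 0) (frag_of \<sigma>))"]
      by (simp add: chain_boundary_def[of 0])
  qed
  then obtain f1 where f1: "\<And>\<sigma>. \<sigma> \<in> S 1 \<Longrightarrow> singular_chain 1 (subtopology mtopology (UG1 (q \<sigma>))) (f1 \<sigma>)"
     "\<And>\<sigma>. \<sigma> \<in> S 1 \<Longrightarrow> chain_boundary 1 (f1 \<sigma>) = frag_extend f0 (chain_boundary 1 (frag_of \<sigma>))" by metis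
  have f1b: "chain_boundary 1 (frag_extend f1 c) = frag_extend f0 (chain_boundary 1 c)"
    if "Poly_Mapping.keys c \<subseteq> S 1" for c
    by (rule frag_extend_additive) (use that f1(2) in \<open>auto simp: chain_boundary_diff frag_extend_diff\<close>)
  have "\<exists>c. singular_chain 2 (subtopology mtopology (UG2 (q \<sigma>))) c \<and>
      chain_boundary 2 c = frag_extend f1 (chain_boundary 2 (frag_of \<sigma>))" if \<sigma>: "\<sigma> \<in> S 2" for \<sigma>
  proof -
    have \<sigma>': "\<sigma> \<in> S (Suc 1)" using \<sigma> by (simp add: numeral_2_eq_2)
    let ?b = "chain_boundary (Suc 1) (frag_of \<sigma>)"
    have "singular_chain 1 (subtopology mtopology (UG2 (q \<sigma>))) (frag_extend f1 ?b)"
    proof (rule singular_chain_extend)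
      fix \<tau> assume \<tau>: "\<tau> \<in> Poly_Mapping.keys ?b"
      note * = S_face(1)[OF \<sigma>' \<tau>] S_q[OF \<sigma>' \<tau>]
      have "UG1 (q \<tau>) \<subseteq> mball (q \<tau>) b1 \<inter> \<Gamma>" using UG1(2) S_base(2)[OF *(1)] by blast
      also have "\<dots> \<subseteq> mball (q \<sigma>) a2 \<inter> \<Gamma>"
        using ball_mono[of "q \<tau>" "q \<sigma>" b1 a2] S_base(3)[OF *(1)] S_base(3)[OF \<sigma>] * b1 \<delta> by auto
      also have "\<dots> \<subseteq> UG2 (q \<sigma>)" using UG2(1) S_base(2)[OF \<sigma>] by blast
      finally show "singular_chain 1 (subtopology mtopology (UG2 (q \<sigma>))) (f1 \<tau>)"
        using f1(1)[OF *(1)] singular_chain_mono by blast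
    qed
    moreover have "chain_boundary 1 (frag_extend f1 ?b) = 0"
    proof -
      have "Poly_Mapping.keys ?b \<subseteq> S 1" using S_keys[of "frag_of \<sigma>" 1] \<sigma>' by simp
      moreover have "chain_boundary 1 ?b = 0"
        using chain_boundary_boundary_alt[of "Suc 0" mtopology "frag_of \<sigma>"] S_base(5)[OF \<sigma>]
        by (simp add: singular_chain_of numeral_2_eq_2)
      ultimately show ?thesis using f1b by simp
    qed
    ultimately show ?thesis
      using contractible_space_cycle_is_boundary[OF UG2(3)[OF S_base(2)[OF \<sigma>]], of 1 "frag_extend f1 ?b"]
      by (simp add: numeral_2_eq_2)
  qed
  then obtain f2 where f2: "\<And>\<sigma>. \<sigma> \<in> S 2 \<Longrightarrow> singular_chain 2 (subtopology mtopology (UG2 (q \<sigma>))) (f2 \<sigma>)"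
     "\<And>\<sigma>. \<sigma> \<in> S 2 \<Longrightarrow> chain_boundary 2 (f2 \<sigma>) = frag_extend f1 (chain_boundary 2 (frag_of \<sigma>))" by metis
  have f2b: "chain_boundary 2 (frag_extend f2 c) = frag_extend f1 (chain_boundary 2 c)"
    if "Poly_Mapping.keys c \<subseteq> S 2" for c
    by (rule frag_extend_additive) (use that f2(2) in \<open>auto simp: chain_boundary_diff frag_extend_diff\<close>)

  \<comment> \<open>The homotopy is determined by the identity
    \<open>\<partial> D = id - f - D \<partial>\<close>. On each simplex the right-hand side is a
    small chain, a cycle by the same identity one degree lower, and it is filled in a contractible
    subset of \<open>M\<close>; in degree 0 the last term is absent. The fillings are chosen
    independently for different simplices, since the formulas involve only values on faces.\<close>
  have "\<exists>c. singular_chain 1 (subtopology mtopology (UM0 (base \<sigma>))) c \<and>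
      chain_boundary 1 c = frag_of \<sigma> - f0 \<sigma>" if \<sigma>: "\<sigma> \<in> S 0" for \<sigma>
  proof -
    note * = S_base[OF \<sigma>]
    have "mball (base \<sigma>) (2 * \<delta>) \<subseteq> UM0 (base \<sigma>)"
      using UM0(1)[OF *(1)] ball_mono[of "base \<sigma>" "base \<sigma>" "2 * \<delta>" d0] * \<delta> by auto
    moreover have "q \<sigma> \<in> mball (base \<sigma>) (2 * \<delta>)" using * \<delta>(1) by (auto simp: commute)
    ultimately have "singular_chain 0 (subtopology mtopology (UM0 (base \<sigma>))) (frag_of \<sigma> - f0 \<sigma>)"
      using Sig[OF \<sigma>] f0 *(3) by (intro singular_chain_diff) blast+
    then show ?thesis
      using contractible_space_cycle_is_boundary[OF UM0(3)[OF *(1)], of 0 "frag_of \<sigma> - f0 \<sigma>"]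
      by (auto simp: chain_boundary_def[of 0] f0_def)
  qed
  then obtain D0 where D0: "\<And>\<sigma>. \<sigma> \<in> S 0 \<Longrightarrow> singular_chain 1 (subtopology mtopology (UM0 (base \<sigma>))) (D0 \<sigma>)"
     "\<And>\<sigma>. \<sigma> \<in> S 0 \<Longrightarrow> chain_boundary 1 (D0 \<sigma>) = frag_of \<sigma> - f0 \<sigma>" by metis
  have D0b: "chain_boundary 1 (frag_extend D0 c) = c - frag_extend f0 c"
    if "Poly_Mapping.keys c \<subseteq> S 0" for c
    by (rule frag_extend_additive) (use that D0(2) in \<open>auto simp: chain_boundary_diff frag_extend_diff\<close>)
  have "\<exists>c. singular_chain 2 (subtopology mtopology (UM1 (base \<sigma>))) c \<and>
      chain_boundary 2 c = frag_of \<sigma> - f1 \<sigma> - frag_extend D0 (chain_boundary 1 (frag_of \<sigma>))" if \<sigma>: "\<sigma> \<in> S 1" for \<sigma>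
  proof -
    note * = S_base[OF \<sigma>]
    have \<sigma>': "\<sigma> \<in> S (Suc 0)" using \<sigma> by simp
    let ?b = "chain_boundary (Suc 0) (frag_of \<sigma>)"
    have "singular_chain 1 (subtopology mtopology (UM1 (base \<sigma>))) (frag_of \<sigma>)"
      using UM1(1)[OF *(1)] ball_mono[of "base \<sigma>" "base \<sigma>" "2 * \<delta>" d1] * \<delta> by (intro Sig[OF \<sigma>]) auto
    moreover have "singular_chain 1 (subtopology mtopology (UM1 (base \<sigma>))) (f1 \<sigma>)"
    proof (rule singular_chain_mono[OF f1(1)[OF \<sigma>]])
      show "UG1 (q \<sigma>) \<subseteq> UM1 (base \<sigma>)"
        using UG1(2)[OF *(2)] UM1(1)[OF *(1)] ball_mono[of "q \<sigma>" "base \<sigma>" b1 d1] * b1 \<delta> by auto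
    qed
    moreover have "singular_chain 1 (subtopology mtopology (UM1 (base \<sigma>))) (frag_extend D0 ?b)"
    proof (rule singular_chain_extend)
      fix \<tau> assume \<tau>: "\<tau> \<in> Poly_Mapping.keys ?b"
      note ** = S_face[OF \<sigma>' \<tau>]
      show "singular_chain 1 (subtopology mtopology (UM1 (base \<sigma>))) (D0 \<tau>)"
      proof (rule singular_chain_mono[OF D0(1)[OF **(1)]])
        show "UM0 (base \<tau>) \<subseteq> UM1 (base \<sigma>)"
          using UM0(2) UM1(1)[OF *(1)] ball_mono[of "base \<tau>" "base \<sigma>" "d1/2" d1] S_base(1)[OF **(1)] *(1) ** \<delta>
          by fastforce
      qed
    qed
    ultimately have "singular_chain 1 (subtopology mtopology (UM1 (base \<sigma>))) (frag_of \<sigma> - f1 \<sigma> - frag_extend D0 ?b)"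
      by (intro singular_chain_diff)
    moreover have "chain_boundary 1 (frag_of \<sigma> - f1 \<sigma> - frag_extend D0 ?b) = 0"
      using f1(2)[OF \<sigma>] D0b[of ?b] S_keys[of "frag_of \<sigma>" 0] \<sigma>' by (simp add: chain_boundary_diff)
    ultimately show ?thesis
      using contractible_space_cycle_is_boundary[OF UM1(3)[OF *(1)], of 1 "frag_of \<sigma> - f1 \<sigma> - frag_extend D0 ?b"]
      by (simp add: numeral_2_eq_2)
  qed
  then obtain D1 where D1: "\<And>\<sigma>. \<sigma> \<in> S 1 \<Longrightarrow> singular_chain 2 (subtopology mtopology (UM1 (base \<sigma>))) (D1 \<sigma>)"
     "\<And>\<sigma>. \<sigma> \<in> S 1 \<Longrightarrow> chain_boundary 2 (D1 \<sigma>) = frag_of \<sigma> - f1 \<sigma> - frag_extend D0 (chain_boundary 1 (frag_of \<sigma>))"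
    by metis
  have D1b: "chain_boundary 2 (frag_extend D1 c) = c - frag_extend f1 c - frag_extend D0 (chain_boundary 1 c)"
    if "Poly_Mapping.keys c \<subseteq> S 1" for c
    by (rule frag_extend_additive) (use that D1(2) in \<open>auto simp: chain_boundary_diff frag_extend_diff\<close>)
  have "\<exists>c. singular_chain 3 (subtopology mtopology (UM2 (base \<sigma>))) c \<and>
      chain_boundary 3 c = frag_of \<sigma> - f2 \<sigma> - frag_extend D1 (chain_boundary 2 (frag_of \<sigma>))" if \<sigma>: "\<sigma> \<in> S 2" for \<sigma>
  proof -
    note * = S_base[OF \<sigma>]
    have \<sigma>': "\<sigma> \<in> S (Suc 1)" using \<sigma> by (simp add: numeral_2_eq_2)
    let ?b = "chain_boundary (Suc 1) (frag_of \<sigma>)"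
    have "singular_chain 2 (subtopology mtopology (UM2 (base \<sigma>))) (frag_of \<sigma>)"
      using UM2(1)[OF *(1)] ball_mono[of "base \<sigma>" "base \<sigma>" "2 * \<delta>" d2] * \<delta> by (intro Sig[OF \<sigma>]) auto
    moreover have "singular_chain 2 (subtopology mtopology (UM2 (base \<sigma>))) (f2 \<sigma>)"
    proof (rule singular_chain_mono[OF f2(1)[OF \<sigma>]])
      show "UG2 (q \<sigma>) \<subseteq> UM2 (base \<sigma>)"
        using UG2(2)[OF *(2)] UM2(1)[OF *(1)] ball_mono[of "q \<sigma>" "base \<sigma>" "d2/2" d2] * \<delta> by auto
    qed
    moreover have "singular_chain 2 (subtopology mtopology (UM2 (base \<sigma>))) (frag_extend D1 ?b)"
    proof (rule singular_chain_extend)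
      fix \<tau> assume \<tau>: "\<tau> \<in> Poly_Mapping.keys ?b"
      note ** = S_face[OF \<sigma>' \<tau>]
      show "singular_chain 2 (subtopology mtopology (UM2 (base \<sigma>))) (D1 \<tau>)"
      proof (rule singular_chain_mono[OF D1(1)[OF **(1)]])
        show "UM1 (base \<tau>) \<subseteq> UM2 (base \<sigma>)"
          using UM1(2) UM2(1)[OF *(1)] ball_mono[of "base \<tau>" "base \<sigma>" "d2/2" d2] S_base(1)[OF **(1)] *(1) ** \<delta>
          by fastforce
      qed
    qed
    ultimately have "singular_chain 2 (subtopology mtopology (UM2 (base \<sigma>))) (frag_of \<sigma> - f2 \<sigma> - frag_extend D1 ?b)"
      by (intro singular_chain_diff)
    moreover have "chain_boundary 2 (frag_of \<sigma> - f2 \<sigma> - frag_extend D1 ?b) = 0"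
    proof -
      have "chain_boundary 1 ?b = 0"
        using chain_boundary_boundary_alt[of "Suc 0" mtopology "frag_of \<sigma>"] S_base(5)[OF \<sigma>]
        by (simp add: singular_chain_of numeral_2_eq_2)
      then show ?thesis
        using f2(2)[OF \<sigma>] D1b[of ?b] S_keys[of "frag_of \<sigma>" 1] \<sigma>' by (simp add: chain_boundary_diff numeral_2_eq_2)
    qed
    ultimately show ?thesis
      using contractible_space_cycle_is_boundary[OF UM2(3)[OF *(1)], of 2 "frag_of \<sigma> - f2 \<sigma> - frag_extend D1 ?b"]
      by (simp add: numeral_2_eq_2 numeral_3_eq_3)
  qed
  then obtain D2 where D2: "\<And>\<sigma>. \<sigma> \<in> S 2 \<Longrightarrow> singular_chain 3 (subtopology mtopology (UM2 (base \<sigma>))) (D2 \<sigma>)"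
     "\<And>\<sigma>. \<sigma> \<in> S 2 \<Longrightarrow> chain_boundary 3 (D2 \<sigma>) = frag_of \<sigma> - f2 \<sigma> - frag_extend D1 (chain_boundary 2 (frag_of \<sigma>))"
    by metis
  have D2b: "chain_boundary 3 (frag_extend D2 c) = c - frag_extend f2 c - frag_extend D1 (chain_boundary 2 c)"
    if "Poly_Mapping.keys c \<subseteq> S 2" for c
    by (rule frag_extend_additive) (use that D2(2) in \<open>auto simp: chain_boundary_diff frag_extend_diff\<close>)

  have "openin mtopology W" unfolding W_def by auto
  moreover have "\<Gamma> \<subseteq> W" unfolding W_def using \<Gamma>M \<delta>(1) by auto
  moreover have "\<exists>y. singular_relcycle 2 (subtopology mtopology \<Gamma>) {} y \<and> homologous_rel 2 mtopology {} z y"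
    if z: "singular_relcycle 2 (subtopology mtopology W) {} z" for z
  proof -
    have WM: "W \<subseteq> M" unfolding W_def by auto
    have op: "openin (subtopology mtopology W) U" if "U \<in> (\<lambda>x. mball x \<delta>) ` \<Gamma>" for U
    proof -
      have "openin mtopology U" "U \<subseteq> W" using that by (auto simp: W_def)
      then show ?thesis unfolding openin_subtopology by blast
    qed
    have cov: "topspace (subtopology mtopology W) \<subseteq> \<Union>((\<lambda>x. mball x \<delta>) ` \<Gamma>)"
      by (auto simp: W_def)
    \<comment> \<open>Subdivision: only on simplices contained in one \<delta>-ball about a point of
      \<open>\<Gamma>\<close> are the fillings under control.\<close>
    obtain c where c: "singular_relcycle 2 (subtopology mtopology W) {} c"
      "homologous_rel 2 (subtopology mtopology W) {} z c"
      "\<And>f. f \<in> Poly_Mapping.keys c \<Longrightarrow> \<exists>V \<in> (\<lambda>x. mball x \<delta>) ` \<Gamma>. f \<in> standard_simplex 2 \<rightarrow> V"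
      using small_homologous_rel_relcycle_exists[OF op cov z] by metis
    have cS: "Poly_Mapping.keys c \<subseteq> S 2"
    proof
      fix f assume f: "f \<in> Poly_Mapping.keys c"
      then have "singular_simplex 2 mtopology f"
        using c(1) unfolding singular_cycle singular_chain_def singular_simplex_subtopology by blast
      then show "f \<in> S 2" using c(3)[OF f] unfolding S_def singular_simplex_subtopology by blast
    qed
    have bc: "chain_boundary 2 c = 0" using c(1) by (simp add: singular_cycle)
    have "singular_chain 2 (subtopology mtopology \<Gamma>) (frag_extend f2 c)"
    proof (rule singular_chain_extend)
      fix \<sigma> assume "\<sigma> \<in> Poly_Mapping.keys c"
      then have \<sigma>: "\<sigma> \<in> S 2" using cS by blast
      show "singular_chain 2 (subtopology mtopology \<Gamma>) (f2 \<sigma>)"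
        by (rule singular_chain_mono[OF f2(1)[OF \<sigma>]]) (use UG2(2)[OF S_base(2)[OF \<sigma>]] in blast)
    qed
    then have "singular_relcycle 2 (subtopology mtopology \<Gamma>) {} (frag_extend f2 c)"
      using f2b[OF cS] bc by (simp add: singular_cycle)
    moreover have "homologous_rel 2 mtopology {} c (frag_extend f2 c)"
    proof -
      have "singular_chain 3 mtopology (frag_extend D2 c)"
        by (rule singular_chain_extend) (use D2(1) cS singular_chain_subtopology in blast)
      moreover have "chain_boundary 3 (frag_extend D2 c) = c - frag_extend f2 c"
        using D2b[OF cS] bc by simp
      ultimately show ?thesis
        unfolding homologous_rel_def singular_boundary by (auto simp: numeral_3_eq_3 numeral_2_eq_2)
    qed
    moreover have "homologous_rel 2 mtopology {} z c"
      using c(2) WM singular_boundary_mono[of W M 2 mtopology "z - c"] unfolding homologous_rel_def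
      by (metis subtopology_topspace topspace_mtopology)
    ultimately show ?thesis using homologous_rel_trans by blast
  qed
  ultimately show ?thesis by blast
qed

section \<open>Homology relative to ends\<close>

lemma singular_chain_subtopology_imp: "singular_chain p (subtopology X S) c \<Longrightarrow> singular_chain p X c"
  by (simp add: singular_chain_subtopology)

lemma singular_chain_diff_iff:
  assumes "singular_chain p X (a - b)"
  shows "singular_chain p X (c - a) \<longleftrightarrow> singular_chain p X (c - b)"
  using singular_chain_add[OF _ assms, of "c - a"] singular_chain_diff[OF _ assms, of "c - b"] by auto

lemma relative_chain_coset:
  "singular_chain_set p (subtopology X S) #>\<^bsub>chain_group p X\<^esub> y = {w. singular_chain p (subtopology X S) (w - y)}"
  by (force simp: r_coset_def)

lemma carrier_relative_chain_group:
  "carrier (relative_chain_group p X S) =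
    (\<lambda>y. {w. singular_chain p (subtopology X S) (w - y)}) ` singular_chain_set p X"
  by (auto simp: relative_chain_group_def FactGroup_def RCOSETS_def relative_chain_coset)

lemma mult_relative_chain_group:
  "{w. singular_chain p (subtopology X S) (w - x)} \<otimes>\<^bsub>relative_chain_group p X S\<^esub> {w. singular_chain p (subtopology X S) (w - y)}
    = {w. singular_chain p (subtopology X S) (w - (x + y))}"
proof -
  have "\<exists>a. singular_chain p (subtopology X S) (a - x) \<and> (\<exists>b. singular_chain p (subtopology X S) (b - y) \<and> w = a + b)"
    if "singular_chain p (subtopology X S) (w - (x + y))" for w
    by (rule exI[of _ "w - y"], rule conjI[OF _ exI[of _ y]]) (use that in \<open>auto simp: algebra_simps\<close>)
  moreover have "singular_chain p (subtopology X S) (a + b - (x + y))"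
    if "singular_chain p (subtopology X S) (a - x)" "singular_chain p (subtopology X S) (b - y)" for a b
    using singular_chain_add[OF that] by (simp add: algebra_simps)
  ultimately show ?thesis
    by (auto simp: relative_chain_group_def FactGroup_def set_mult_def)
qed

lemma one_relative_chain_group: "\<one>\<^bsub>relative_chain_group p X S\<^esub> = {w. singular_chain p (subtopology X S) (w - 0)}"
  by (simp add: relative_chain_group_def FactGroup_def)

text \<open>Elements of the inverse limit are handled through sequences of absolute chains representing
  their components.\<close>

definition coherent :: "nat \<Rightarrow> 'a topology \<Rightarrow> (nat \<Rightarrow> 'a set) \<Rightarrow> 'a set \<Rightarrow> (nat \<Rightarrow> 'a chain) \<Rightarrow> bool" where
  "coherent p X K V x \<longleftrightarrow>
     (\<forall>i. singular_chain p X (x i) \<and> singular_chain p (subtopology X (V - K i)) (x (Suc i) - x i))"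

definition ends_chain :: "nat \<Rightarrow> 'a topology \<Rightarrow> (nat \<Rightarrow> 'a set) \<Rightarrow> 'a set \<Rightarrow> (nat \<Rightarrow> 'a chain) \<Rightarrow> nat \<Rightarrow> 'a chain set"
  where "ends_chain p X K V x = (\<lambda>i. {w. singular_chain p (subtopology X (V - K i)) (w - x i)})"

definition ends_class :: "nat \<Rightarrow> 'a topology \<Rightarrow> (nat \<Rightarrow> 'a set) \<Rightarrow> 'a set \<Rightarrow> (nat \<Rightarrow> 'a chain) \<Rightarrow> (nat \<Rightarrow> 'a chain set) set"
  where "ends_class p X K V x = ends_boundary_set p X K V #>\<^bsub>ends_cycle_group p X K V\<^esub> ends_chain p X K V x"

lemma ends_chain_eq_iff:
  "ends_chain p X K V x = ends_chain p X K V y \<longleftrightarrow> (\<forall>i. singular_chain p (subtopology X (V - K i)) (x i - y i))"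
proof
  assume eq: "ends_chain p X K V x = ends_chain p X K V y"
  have "x i \<in> ends_chain p X K V x i" for i by (simp add: ends_chain_def)
  then show "\<forall>i. singular_chain p (subtopology X (V - K i)) (x i - y i)"
    unfolding eq by (simp add: ends_chain_def)
next
  assume "\<forall>i. singular_chain p (subtopology X (V - K i)) (x i - y i)"
  then have "singular_chain p (subtopology X (V - K i)) (w - x i) \<longleftrightarrow>
      singular_chain p (subtopology X (V - K i)) (w - y i)" for i w
    using singular_chain_diff_iff by blast
  then show "ends_chain p X K V x = ends_chain p X K V y"
    by (simp add: ends_chain_def)
qed

text \<open>Transition maps are encoded as inclusions of cosets. If one chain is picked from each
  coset, the inclusion says that consecutive picks differ by a chain off \<open>K i\<close>.
  Conversely, such differences give inclusions because \<open>K\<close> increases, so that an error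
  off \<open>K (Suc i)\<close> is also one off \<open>K i\<close>.\<close>

lemma carrier_ends_chain_group:
  assumes mono: "incseq K"
  shows "carrier (ends_chain_group p X K V) = ends_chain p X K V ` Collect (coherent p X K V)"
proof (intro equalityI subsetI)
  fix c assume "c \<in> carrier (ends_chain_group p X K V)"
  then have c: "\<And>i. c i \<in> carrier (relative_chain_group p X (V - K i))" "\<And>i. c (Suc i) \<subseteq> c i"
    by (auto simp: ends_chain_group_def)
  have "\<exists>y. singular_chain p X y \<and> c i = {w. singular_chain p (subtopology X (V - K i)) (w - y)}" for i
    using c(1)[of i] unfolding carrier_relative_chain_group by blast
  then obtain x where x: "\<And>i. singular_chain p X (x i)"
     "\<And>i. c i = {w. singular_chain p (subtopology X (V - K i)) (w - x i)}" by metis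
  have "x (Suc i) \<in> c i" for i using c(2)[of i] x(2)[of "Suc i"] by auto
  then have "coherent p X K V x" using x by (auto simp: coherent_def)
  moreover have "c = ends_chain p X K V x" using x(2) by (auto simp: ends_chain_def)
  ultimately show "c \<in> ends_chain p X K V ` Collect (coherent p X K V)" by blast
next
  fix c assume "c \<in> ends_chain p X K V ` Collect (coherent p X K V)"
  then obtain x where x: "coherent p X K V x" "c = ends_chain p X K V x" by blast
  have "singular_chain p (subtopology X (V - K i)) (w - x i)"
    if "singular_chain p (subtopology X (V - K (Suc i))) (w - x (Suc i))" for w i
  proof -
    have "singular_chain p (subtopology X (V - K i)) (w - x (Suc i))"
      by (rule singular_chain_mono[OF that]) (use incseq_SucD[OF mono] in blast)
    then show ?thesis using x(1) singular_chain_diff_iff unfolding coherent_def by blast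
  qed
  then show "c \<in> carrier (ends_chain_group p X K V)"
    using x by (auto simp: ends_chain_group_def carrier_relative_chain_group ends_chain_def coherent_def)
qed

lemma one_ends_chain_group: "\<one>\<^bsub>ends_chain_group p X K V\<^esub> = ends_chain p X K V (\<lambda>_. 0)"
  by (simp add: ends_chain_group_def one_relative_chain_group ends_chain_def)

lemma mult_ends_cycle_group:
  "ends_chain p X K V x \<otimes>\<^bsub>ends_cycle_group p X K V\<^esub> ends_chain p X K V y = ends_chain p X K V (\<lambda>i. x i + y i)"
  by (simp add: ends_cycle_group_def ends_chain_group_def ends_chain_def mult_relative_chain_group)

lemma ends_boundary_ends_chain:
  "ends_boundary p X K V (ends_chain p X K V x) = ends_chain (p - 1) X K V (\<lambda>i. chain_boundary p (x i))"
proof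
  fix i
  let ?S = "subtopology X (V - K i)"
  have "{w. singular_chain (p - 1) ?S (w - chain_boundary p y)} = {w. singular_chain (p - 1) ?S (w - chain_boundary p (x i))}"
    if "singular_chain p ?S (y - x i)" for y
    using singular_chain_boundary[OF that] singular_chain_diff_iff[of "p - 1" ?S "chain_boundary p y" "chain_boundary p (x i)"]
    by (simp add: chain_boundary_diff)
  moreover have "singular_chain p ?S (x i - x i)" by simp
  ultimately show "ends_boundary p X K V (ends_chain p X K V x) i = ends_chain (p - 1) X K V (\<lambda>i. chain_boundary p (x i)) i"
    unfolding ends_boundary_def ends_chain_def relative_chain_coset by blast
qed

lemma coherent_add: "coherent p X K V x \<Longrightarrow> coherent p X K V y \<Longrightarrow> coherent p X K V (\<lambda>i. x i + y i)"
  unfolding coherent_def by (metis add_diff_add singular_chain_add)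

lemma coherent_minus: "coherent p X K V x \<Longrightarrow> coherent p X K V (\<lambda>i. - x i)"
  unfolding coherent_def by (metis minus_diff_minus singular_chain_minus)

lemma coherent_cmul: "coherent p X K V x \<Longrightarrow> coherent p X K V (\<lambda>i. frag_cmul m (x i))"
  unfolding coherent_def
  by (auto simp: singular_chain_cmul frag_cmul_diff_distrib2[symmetric])

lemma carrier_ends_cycle_group:
  assumes "incseq K"
  shows "carrier (ends_cycle_group p X K V) =
    ends_chain p X K V ` {x. coherent p X K V x \<and> (\<forall>i. singular_relcycle p X (V - K i) (x i))}"
proof -
  have "ends_boundary p X K V (ends_chain p X K V x) = \<one>\<^bsub>ends_chain_group (p - 1) X K V\<^esub> \<longleftrightarrow>
      (\<forall>i. singular_relcycle p X (V - K i) (x i))" if "coherent p X K V x" for x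
    using that
    by (simp add: ends_boundary_ends_chain one_ends_chain_group ends_chain_eq_iff coherent_def singular_relcycle)
  then show ?thesis
    unfolding ends_cycle_group_def by (auto simp: carrier_ends_chain_group[OF assms])
qed

lemma ends_boundary_set_eq:
  assumes "incseq K"
  shows "ends_boundary_set p X K V =
    (\<lambda>w. ends_chain p X K V (\<lambda>i. chain_boundary (Suc p) (w i))) ` Collect (coherent (Suc p) X K V)"
  unfolding ends_boundary_set_def carrier_ends_chain_group[OF assms] image_image ends_boundary_ends_chain by simp

lemma ends_class_eq:
  assumes "incseq K"
  shows "ends_class p X K V x =
    (\<lambda>w. ends_chain p X K V (\<lambda>i. chain_boundary (Suc p) (w i) + x i)) ` Collect (coherent (Suc p) X K V)"
  unfolding ends_class_def r_coset_def ends_boundary_set_eq[OF assms] by (auto simp: mult_ends_cycle_group)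

text \<open>Besides a coherent family of boundaries, each stage tolerates its own error in
  \<open>V - K i\<close>, since such chains vanish in the quotient. The cap product is shown to be
  well defined by exhibiting a suitable \<open>w\<close>. One inclusion suffices, as replacing
  \<open>w\<close> by its negative exchanges the two sides.\<close>

lemma ends_class_cong:
  assumes mono: "incseq K" and w: "coherent (Suc p) X K V w"
    and xy: "\<And>i. singular_chain p (subtopology X (V - K i)) (chain_boundary (Suc p) (w i) + x i - y i)"
  shows "ends_class p X K V x = ends_class p X K V y"
proof -
  have *: "ends_class p X K V x \<subseteq> ends_class p X K V y" 
    if w: "coherent (Suc p) X K V w" and xy: "\<And>i. singular_chain p (subtopology X (V - K i)) (chain_boundary (Suc p) (w i) + x i - y i)"
    for w and x y :: "nat \<Rightarrow> 'a chain"
  proof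
    fix c assume "c \<in> ends_class p X K V x"
    then obtain v where v: "coherent (Suc p) X K V v" "c = ends_chain p X K V (\<lambda>i. chain_boundary (Suc p) (v i) + x i)"
      by (auto simp: ends_class_eq[OF mono])
    have "coherent (Suc p) X K V (\<lambda>i. v i + - w i)" using v(1) w coherent_add coherent_minus by blast
    moreover have "c = ends_chain p X K V (\<lambda>i. chain_boundary (Suc p) (v i + - w i) + y i)"
      unfolding v(2) ends_chain_eq_iff using xy by (simp add: chain_boundary_diff algebra_simps)
    ultimately show "c \<in> ends_class p X K V y" by (auto simp: ends_class_eq[OF mono])
  qed
  have "singular_chain p (subtopology X (V - K i)) (chain_boundary (Suc p) (- w i) + y i - x i)" for i
    using xy[of i] singular_chain_minus[of p _ "chain_boundary (Suc p) (w i) + x i - y i"]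
    by (simp add: chain_boundary_minus algebra_simps)
  then show ?thesis using *[OF w xy] *[OF coherent_minus[OF w]] by blast
qed

lemma carrier_ends_homology_group:
  assumes "incseq K"
  shows "carrier (ends_homology_group p X K V) =
    ends_class p X K V ` {x. coherent p X K V x \<and> (\<forall>i. singular_relcycle p X (V - K i) (x i))}"
  unfolding ends_homology_group_def FactGroup_def RCOSETS_def ends_class_def
  by (auto simp: carrier_ends_cycle_group[OF assms])

lemma ends_projection_ends_class:
  assumes mono: "incseq K"
  shows "ends_projection p X K V i (ends_class p X K V x) = homologous_rel_set p X (V - K i) (x i)"
proof -
  have "homologous_rel_set p X (V - K i) w = homologous_rel_set p X (V - K i) (x i)"
    if "coherent (Suc p) X K V v" "singular_chain p (subtopology X (V - K i)) (w - (chain_boundary (Suc p) (v i) + x i))" for v w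
  proof -
    have "chain_boundary (Suc p) (v i) + (w - (chain_boundary (Suc p) (v i) + x i)) = w - x i" by simp
    then have "homologous_rel p X (V - K i) w (x i)"
      unfolding homologous_rel_def singular_relboundary using that unfolding coherent_def by blast
    then show ?thesis by (simp add: homologous_rel_set_eq)
  qed
  then have "homologous_rel_set p X (V - K i) w = homologous_rel_set p X (V - K i) (x i)"
    if "c \<in> ends_class p X K V x" "w \<in> c i" for c w
    using that unfolding ends_class_eq[OF mono] ends_chain_def by blast
  then have "ends_projection p X K V i (ends_class p X K V x) =
      (\<Union>c \<in> ends_class p X K V x. \<Union>w \<in> c i. homologous_rel_set p X (V - K i) (x i))"
    unfolding ends_projection_def by (intro SUP_cong refl)
  moreover have "ends_chain p X K V (\<lambda>i. chain_boundary (Suc p) 0 + x i) \<in> ends_class p X K V x"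
    unfolding ends_class_eq[OF mono] by (intro image_eqI[of _ _ "\<lambda>_. 0"]) (auto simp: coherent_def)
  moreover have "x i \<in> ends_chain p X K V (\<lambda>i. chain_boundary (Suc p) 0 + x i) i"
    by (simp add: ends_chain_def)
  ultimately show ?thesis by blast
qed

text \<open>\<open>restricted_class\<close> is evaluated at the least admissible stage. The
  existential hides which one it is: later arguments use only that the stage is admissible.\<close>

lemma restricted_class_ends_class:
  assumes mono: "incseq K"
    and x: "\<And>i. singular_relcycle p X (V - K i) (x i)" and ex: "V - K j \<subseteq> topspace X - \<Omega>"
  shows "\<exists>i. V - K i \<subseteq> topspace X - \<Omega> \<and>
    restricted_class p X K V \<Omega> (ends_class p X K V x) = homologous_rel_set p X (topspace X - \<Omega>) (x i)"
proof -
  define i where "i = (LEAST i. V - K i \<subseteq> topspace X - \<Omega>)"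
  have i: "V - K i \<subseteq> topspace X - \<Omega>" unfolding i_def using ex by (rule LeastI)
  have "restricted_class p X K V \<Omega> (ends_class p X K V x) =
     hom_induced p X (V - K i) X (topspace X - \<Omega>) id (homologous_rel_set p X (V - K i) (x i))"
    by (simp add: restricted_class_def i_def[symmetric] ends_projection_ends_class[OF mono])
  also have "\<dots> = homologous_rel_set p X (topspace X - \<Omega>) (chain_map p id (x i))"
    by (rule hom_induced_chain_map) (use i x in auto)
  also have "chain_map p id (x i) = x i"
    using x[of i] by (intro chain_map_id_gen[of p X]) (auto simp: singular_relcycle)
  finally show ?thesis using i by blast
qed

section \<open>Cap products on homology relative to ends\<close>

lemma coherent_le:
  assumes "incseq K" "coherent p X K V x" "i \<le> m"
  shows "singular_chain p (subtopology X (V - K i)) (x m - x i)"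
  using assms(3)
proof (induction m rule: dec_induct)
  case (step m)
  have "singular_chain p (subtopology X (V - K m)) (x (Suc m) - x m)"
    using assms(2) by (simp add: coherent_def)
  then have "singular_chain p (subtopology X (V - K i)) (x (Suc m) - x m)"
    by (rule singular_chain_mono) (use incseqD[OF assms(1) step(1)] in blast)
  from singular_chain_add[OF this step(3)] show ?case by simp
qed simp

text \<open>Source and target are relative to the ends of the same \<open>V\<close>, and capping
  does not move a chain out of the subspace carrying it. The cap products of all late components
  therefore agree with that of component \<open>i\<close> up to chains in \<open>V - K i\<close>, so
  the limit in \<open>ends_cap\<close> is computed componentwise.\<close>

lemma ends_cap_ends_chain:
  assumes K: "incseq K" and x: "coherent n X K V x" and k: "k \<le> n"
  shows "ends_cap n k X K V (ends_chain n X K V x) \<phi> = ends_chain (n - k) X K V (\<lambda>i. cap n k (x i) \<phi>)"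
proof
  fix i
  let ?S = "subtopology X (V - K i)"
  have cap: "singular_chain (n - k) ?S (cap n k w \<phi> - cap n k (x i) \<phi>)"
    if m: "i \<le> m" and w: "w \<in> ends_chain n X K V x m" for m w
  proof -
    have "singular_chain n (subtopology X (V - K m)) (w - x m)" using w by (simp add: ends_chain_def)
    then have "singular_chain n ?S (w - x m)"
      by (rule singular_chain_mono) (use incseqD[OF K m] in blast)
    from singular_chain_add[OF this coherent_le[OF K x m]] have "singular_chain n ?S (w - x i)" by simp
    then show ?thesis using singular_chain_cap[of n ?S "w - x i" k \<phi>] k by (simp add: cap_diff)
  qed
  show "ends_cap n k X K V (ends_chain n X K V x) \<phi> i = ends_chain (n - k) X K V (\<lambda>i. cap n k (x i) \<phi>) i"
  proof (intro equalityI subsetI)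
    fix y assume "y \<in> ends_cap n k X K V (ends_chain n X K V x) \<phi> i"
    then obtain N where N: "\<And>m w. N \<le> m \<Longrightarrow> w \<in> ends_chain n X K V x m \<Longrightarrow> singular_chain (n - k) ?S (y - cap n k w \<phi>)"
      unfolding ends_cap_def eventually_sequentially by blast
    define m where "m = max N i"
    have m: "N \<le> m" "i \<le> m" and xm: "x m \<in> ends_chain n X K V x m" by (auto simp: m_def ends_chain_def)
    from singular_chain_add[OF N[OF m(1) xm] cap[OF m(2) xm]]
    show "y \<in> ends_chain (n - k) X K V (\<lambda>i. cap n k (x i) \<phi>) i" by (simp add: ends_chain_def)
  next
    fix y assume "y \<in> ends_chain (n - k) X K V (\<lambda>i. cap n k (x i) \<phi>) i"
    then have y: "singular_chain (n - k) ?S (y - cap n k (x i) \<phi>)" by (simp add: ends_chain_def)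
    have "singular_chain (n - k) X (cap n k (x i) \<phi>)"
      using x k by (simp add: coherent_def singular_chain_cap)
    from singular_chain_add[OF singular_chain_subtopology_imp[OF y] this]
    have "singular_chain (n - k) X y" by simp
    moreover have "singular_chain (n - k) ?S (y - cap n k w \<phi>)"
      if "i \<le> m" "w \<in> ends_chain n X K V x m" for m w
      using singular_chain_diff[OF y cap[OF that]] by simp
    ultimately show "y \<in> ends_cap n k X K V (ends_chain n X K V x) \<phi> i"
      unfolding ends_cap_def by (auto intro!: eventually_sequentiallyI[of i])
  qed
qed

lemma coherent_cap:
  assumes "coherent n X K V x" "k \<le> n"
  shows "coherent (n - k) X K V (\<lambda>i. cap n k (x i) \<phi>)"
  using assms unfolding coherent_def by (auto simp: singular_chain_cap cap_diff[symmetric])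

lemma coherent_chain_boundary:
  assumes "coherent (Suc p) X K V w"
  shows "coherent p X K V (\<lambda>i. chain_boundary (Suc p) (w i))"
  using assms unfolding coherent_def
  by (auto simp: singular_chain_boundary_alt chain_boundary_diff[symmetric])

lemma singular_relcycle_cap:
  assumes "singular_relcycle (Suc (k + l)) X S c" "coboundary k X \<phi> = (\<lambda>_. 0)"
  shows "singular_relcycle (Suc l) X S (cap (Suc (k + l)) k c \<phi>)"
proof -
  have c: "singular_chain (Suc (k + l)) X c" "singular_chain (k + l) (subtopology X S) (chain_boundary (Suc (k + l)) c)"
    using assms(1) by (auto simp: singular_relcycle)
  have "frag_cmul ((-1) ^ k) (cap (k + l) k (chain_boundary (Suc (k + l)) c) \<phi>) =
      chain_boundary (Suc l) (cap (Suc (k + l)) k c \<phi>)"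
    using cap_chain_boundary[OF c(1), of \<phi>] assms(2) by (simp add: power_mult_distrib[symmetric])
  moreover have "singular_chain l (subtopology X S) (frag_cmul ((-1) ^ k) (cap (k + l) k (chain_boundary (Suc (k + l)) c) \<phi>))"
    using singular_chain_cap[OF c(2), of k \<phi>] by (simp add: singular_chain_cmul)
  moreover have "singular_chain (Suc l) X (cap (Suc (k + l)) k c \<phi>)"
    using singular_chain_cap[OF c(1), of k \<phi>] by (simp add: Suc_diff_le)
  ultimately show ?thesis by (simp add: singular_relcycle)
qed

lemma ends_class_cap_boundary:
  assumes K: "incseq K" and w: "coherent (Suc (k + l)) X K V w" and \<phi>: "coboundary k X \<phi> = (\<lambda>_. 0)"
  shows "ends_class l X K V (\<lambda>i. cap (k + l) k (chain_boundary (Suc (k + l)) (w i) + x i) \<phi>) =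
     ends_class l X K V (\<lambda>i. cap (k + l) k (x i) \<phi>)"
proof (rule ends_class_cong[OF K])
  \<comment> \<open>For a cocycle the Leibniz rule makes the cap product of a boundary the boundary
    of the cap product up to \<open>(-1) ^ k\<close>. The extra minus sign cancels this
    term.\<close>
  show "coherent (Suc l) X K V (\<lambda>i. frag_cmul (- ((-1) ^ k)) (cap (Suc (k + l)) k (w i) \<phi>))"
    using coherent_cmul[OF coherent_cap[OF w, of k \<phi>]] by (simp add: Suc_diff_le)
  fix i
  have "singular_chain (Suc (k + l)) X (w i)" using w by (simp add: coherent_def)
  from cap_chain_boundary[OF this, of \<phi>] \<phi>
  show "singular_chain l (subtopology X (V - K i))
     (chain_boundary (Suc l) (frag_cmul (- ((-1) ^ k)) (cap (Suc (k + l)) k (w i) \<phi>)) +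
       cap (k + l) k (chain_boundary (Suc (k + l)) (w i) + x i) \<phi> - cap (k + l) k (x i) \<phi>)"
    by (simp add: cap_add chain_boundary_cmul frag_cmul_distrib[symmetric])
qed

lemma ends_class_cap_coboundary:
  assumes K: "incseq K" and x: "coherent (k + l) X K V x"
    and cyc: "\<And>i. singular_relcycle (k + l) X (V - K i) (x i)" and b: "b \<in> coboundary_set k X {}"
  shows "ends_class l X K V (\<lambda>i. cap (k + l) k (x i) (\<lambda>\<sigma>. b \<sigma> + \<phi> \<sigma>)) =
     ends_class l X K V (\<lambda>i. cap (k + l) k (x i) \<phi>)"
  using b unfolding coboundary_set_empty
proof (elim disjE exE conjE)
  fix q a assume q: "k = Suc q" "b = coboundary q X a"
  show ?thesis
  proof (rule ends_class_cong[OF K])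
    \<comment> \<open>By the Leibniz rule, capping with the coboundary of \<open>a\<close> is, up to
      a boundary, the same as capping the boundary of \<open>x i\<close> with \<open>a\<close>. The
      latter lies in \<open>V - K i\<close> because \<open>x i\<close> is a relative cycle, so it is
      an admissible error.\<close>
    show "coherent (Suc l) X K V (\<lambda>i. frag_cmul ((-1) ^ q) (cap (k + l) q (x i) a))"
      using coherent_cmul[OF coherent_cap[OF x, of q a]] q(1) by (simp add: Suc_diff_le)
    fix i
    have c: "singular_chain (Suc (q + l)) X (x i)" using x q(1) by (simp add: coherent_def)
    have "singular_chain (q + l) (subtopology X (V - K i)) (chain_boundary (Suc (q + l)) (x i))"
      using cyc[of i] q(1) by (simp add: singular_relcycle)
    from singular_chain_cap[OF this, of q a]
    have "singular_chain l (subtopology X (V - K i)) (cap (q + l) q (chain_boundary (Suc (q + l)) (x i)) a)" by simp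
    then show "singular_chain l (subtopology X (V - K i))
     (chain_boundary (Suc l) (frag_cmul ((-1) ^ q) (cap (k + l) q (x i) a)) +
       cap (k + l) k (x i) (\<lambda>\<sigma>. b \<sigma> + \<phi> \<sigma>) - cap (k + l) k (x i) \<phi>)"
      unfolding cap_chain_boundary[OF c] cap_cochain_add q by (simp add: chain_boundary_cmul add.commute)
  qed
qed simp

lemma ends_cap_class_ends_class:
  assumes K: "incseq K" and x: "coherent (k + l) X K V x"
    and cyc: "\<And>i. singular_relcycle (k + l) X (V - K i) (x i)" and \<phi>: "\<phi> \<in> carrier (cocycle_group k X {})"
  shows "ends_cap_class (k + l) k X K V (ends_class (k + l) X K V x) (UNIV \<times> {cohomology_class k X {} \<phi>}) =
    ends_class l X K V (\<lambda>i. cap (k + l) k (x i) \<phi>)"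
proof -
  have "ends_boundary_set l X K V #>\<^bsub>ends_cycle_group l X K V\<^esub> ends_cap (k + l) k X K V c \<psi> =
      ends_class l X K V (\<lambda>i. cap (k + l) k (x i) \<phi>)"
    if c: "c \<in> ends_class (k + l) X K V x" and \<psi>: "\<psi> \<in> cohomology_class k X {} \<phi>" for c \<psi>
  proof -
    obtain w where w: "coherent (Suc (k + l)) X K V w"
      "c = ends_chain (k + l) X K V (\<lambda>i. chain_boundary (Suc (k + l)) (w i) + x i)"
      using c unfolding ends_class_eq[OF K] by blast
    have "coherent (k + l) X K V (\<lambda>i. chain_boundary (Suc (k + l)) (w i) + x i)"
      using coherent_add[OF coherent_chain_boundary[OF w(1)] x] .
    from ends_cap_ends_chain[OF K this, of k \<psi>]
    have "ends_cap (k + l) k X K V c \<psi> = ends_chain l X K V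
        (\<lambda>i. cap (k + l) k (chain_boundary (Suc (k + l)) (w i) + x i) \<psi>)" by (simp add: w(2))
    then have "ends_boundary_set l X K V #>\<^bsub>ends_cycle_group l X K V\<^esub> ends_cap (k + l) k X K V c \<psi> =
       ends_class l X K V (\<lambda>i. cap (k + l) k (chain_boundary (Suc (k + l)) (w i) + x i) \<psi>)"
      by (simp add: ends_class_def)
    also have "\<dots> = ends_class l X K V (\<lambda>i. cap (k + l) k (x i) \<psi>)"
      using cohomology_class_cocycle[OF \<psi> \<phi>] ends_class_cap_boundary[OF K w(1)] by (simp add: mem_cocycle_group)
    also obtain b where b: "b \<in> coboundary_set k X {}" "\<psi> = (\<lambda>\<sigma>. b \<sigma> + \<phi> \<sigma>)"
      using \<psi> unfolding cohomology_class_eq by blast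
    then have "ends_class l X K V (\<lambda>i. cap (k + l) k (x i) \<psi>) = ends_class l X K V (\<lambda>i. cap (k + l) k (x i) \<phi>)"
      using ends_class_cap_coboundary[OF K x cyc b(1)] by simp
    finally show ?thesis .
  qed
  then have "ends_cap_class (k + l) k X K V (ends_class (k + l) X K V x) (UNIV \<times> {cohomology_class k X {} \<phi>}) =
     (\<Union>c \<in> ends_class (k + l) X K V x. \<Union>(j::nat, b) \<in> UNIV \<times> {cohomology_class k X {} \<phi>}. \<Union>\<psi> \<in> b.
       ends_class l X K V (\<lambda>i. cap (k + l) k (x i) \<phi>))"
    unfolding ends_cap_class_def by (intro SUP_cong refl) auto
  moreover have "ends_chain (k + l) X K V (\<lambda>i. chain_boundary (Suc (k + l)) 0 + x i) \<in> ends_class (k + l) X K V x"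
    unfolding ends_class_eq[OF K] by (intro image_eqI[of _ _ "\<lambda>_. 0"]) (auto simp: coherent_def)
  moreover have "\<phi> \<in> cohomology_class k X {} \<phi>" by (rule cohomology_class_self)
  ultimately show ?thesis by (auto split: if_splits)
qed

section \<open>Cohomology relative to an empty set of ends, and products of representatives\<close>

lemma cohomology_restrict_empty:
  assumes "b \<in> carrier (cohomology_group p X)"
  shows "cohomology_restrict p X {} b = b"
proof -
  obtain \<phi> where b: "b = cohomology_class p X {} \<phi>"
    using assms unfolding carrier_relative_cohomology_group by blast
  have "cohomology_restrict p X {} b = (\<Union>\<psi> \<in> b. b)"
    unfolding cohomology_restrict_def by (intro SUP_cong refl) (simp add: b cohomology_class_cong)
  then show ?thesis using cohomology_class_self[of \<phi> p X] b by auto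
qed

text \<open>All stages of the direct system are \<open>H^p(X)\<close> itself with identity maps. An
  element \<open>b\<close> of the limit thus consists of the pairs \<open>(i, b)\<close> for all
  \<open>i\<close>, that is, of \<open>UNIV \<times> {b}\<close>; this is the shape in which
  absolute classes enter the products below.\<close>

lemma ends_cohomology_rel_empty:
  "ends_cohomology_rel p X K {} = {((i, b), (j, c)). b \<in> carrier (cohomology_group p X) \<and> b = c}"
proof -
  have "\<exists>l. i \<le> l \<and> j \<le> l" for i j :: nat by (meson max.cobounded1 max.cobounded2)
  then show ?thesis
    by (auto simp: ends_cohomology_rel_def ends_cohomology_pairs_def cohomology_restrict_empty)
qed

lemma ends_cohomology_empty:
  assumes "b \<in> carrier (cohomology_group p X)"
  shows "UNIV \<times> {b} \<in> ends_cohomology p X K {}"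
proof -
  have "ends_cohomology_rel p X K {} `` {(0, b)} = UNIV \<times> {b}"
    using assms by (auto simp: ends_cohomology_rel_empty)
  moreover have "(0, b) \<in> ends_cohomology_pairs p X K {}" using assms by (simp add: ends_cohomology_pairs_def)
  ultimately show ?thesis unfolding ends_cohomology_def by (metis quotientI)
qed

lemma cohomology_class_carrier:
  "\<phi> \<in> carrier (cocycle_group p X {}) \<Longrightarrow> cohomology_class p X {} \<phi> \<in> carrier (cohomology_group p X)"
  by (simp add: carrier_relative_cohomology_group)

lemma ends_cup_empty:
  assumes "\<phi> \<in> carrier (cocycle_group p X {})" "\<psi> \<in> carrier (cocycle_group q X {})"
  shows "ends_cup p q X K {} (UNIV \<times> {cohomology_class p X {} \<phi>}) (cohomology_class q X {} \<psi>) =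
    UNIV \<times> {cohomology_class (p + q) X {} (cup p q X \<phi> \<psi>)}"
  using cohomology_class_carrier[OF cup_cocycle[OF assms]]
  by (auto simp: ends_cup_def ends_cohomology_rel_empty cup_class_cohomology_class[OF assms])

text \<open>It follows the bracketing of \<open>cup_list\<close>, including the final unit, so that
  classes and representatives are related by a direct induction.\<close>

primrec cup_cochain :: "'a topology \<Rightarrow> 'a cochain list \<Rightarrow> 'a cochain" where
  "cup_cochain X [] = (\<lambda>\<sigma>. if singular_simplex 0 X \<sigma> then 1 else 0)"
| "cup_cochain X (\<phi> # \<phi>s) = cup 1 (length \<phi>s) X \<phi> (cup_cochain X \<phi>s)"

lemma cup_cochain_cocycle:
  assumes "set \<phi>s \<subseteq> carrier (cocycle_group 1 X {})"
  shows "cup_cochain X \<phi>s \<in> carrier (cocycle_group (length \<phi>s) X {})"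
  using assms
proof (induction \<phi>s)
  case Nil
  \<comment> \<open>The unit has the value 1 at both ends of a path, so the two terms of its
    coboundary cancel.\<close>
  have "coboundary 0 X (\<lambda>\<sigma>. if singular_simplex 0 X \<sigma> then 1 else 0) \<sigma> = 0" for \<sigma>
  proof (cases "singular_simplex (Suc 0) X \<sigma>")
    case True
    then have "singular_simplex 0 X (singular_face (Suc 0) i \<sigma>)" if "i \<le> Suc 0" for i
      using singular_simplex_singular_face[OF True _ that] by simp
    then show ?thesis using coboundary_frag[OF True] by simp
  qed (simp add: coboundary_def)
  then show ?case by (auto simp: mem_cocycle_group singular_cochain_empty)
next
  case (Cons \<phi> \<phi>s)
  then show ?case using cup_cocycle[of \<phi> 1 X "cup_cochain X \<phi>s" "length \<phi>s"] by simp
qed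

lemma cup_list_cohomology_class:
  assumes "set \<phi>s \<subseteq> carrier (cocycle_group 1 X {})"
  shows "cup_list X (map (cohomology_class 1 X {}) \<phi>s) = cohomology_class (length \<phi>s) X {} (cup_cochain X \<phi>s)"
  using assms
proof (induction \<phi>s)
  case (Cons \<phi> \<phi>s)
  then show ?case
    using cup_class_cohomology_class[of \<phi> 1 X "cup_cochain X \<phi>s" "length \<phi>s"] cup_cochain_cocycle[of \<phi>s X] by simp
qed (simp add: cohomology_one_def)

text \<open>This is the pullback along an inclusion. The value 0 elsewhere follows the convention
  that cochains vanish on functions that are not simplices of the space.\<close>

definition restrict_cochain :: "nat \<Rightarrow> 'a topology \<Rightarrow> 'a cochain \<Rightarrow> 'a cochain" where
  "restrict_cochain p X \<phi> = (\<lambda>\<sigma>. if singular_simplex p X \<sigma> then \<phi> \<sigma> else 0)"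

lemma restrict_cochain_cocycle:
  assumes "\<phi> \<in> carrier (cocycle_group p X {})"
  shows "restrict_cochain p (subtopology X S) \<phi> \<in> carrier (cocycle_group p (subtopology X S) {})"
proof -
  let ?Y = "subtopology X S"
  have "coboundary p ?Y (restrict_cochain p ?Y \<phi>) \<sigma> = 0" for \<sigma>
  proof (cases "singular_simplex (Suc p) ?Y \<sigma>")
    case True
    then have \<sigma>: "singular_simplex (Suc p) X \<sigma>" by (simp add: singular_simplex_subtopology)
    have "coboundary p ?Y (restrict_cochain p ?Y \<phi>) \<sigma> = coboundary p X \<phi> \<sigma>"
      unfolding coboundary_frag[OF True] coboundary_frag[OF \<sigma>]
      by (rule sum.cong) (use singular_simplex_singular_face[OF True] in \<open>auto simp: restrict_cochain_def\<close>)
    then show ?thesis using assms by (simp add: mem_cocycle_group)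
  qed (simp add: coboundary_def)
  then show ?thesis by (auto simp: mem_cocycle_group singular_cochain_empty restrict_cochain_def)
qed

text \<open>Equality of values, not just of classes, makes the two cap products of a chain in the
  subspace literally the same chain. This links products on the complement to those on the ambient
  manifold.\<close>

lemma cup_cochain_restrict:
  assumes "singular_simplex (length \<phi>s) (subtopology X S) \<sigma>"
  shows "cup_cochain (subtopology X S) (map (restrict_cochain 1 (subtopology X S)) \<phi>s) \<sigma> = cup_cochain X \<phi>s \<sigma>"
  using assms
proof (induction \<phi>s arbitrary: \<sigma>)
  case Nil
  then show ?case by (simp add: singular_simplex_subtopology)
next
  case (Cons \<phi> \<phi>s)
  have \<sigma>: "singular_simplex (1 + length \<phi>s) (subtopology X S) \<sigma>" using Cons.prems by simp
  then show ?case
    using Cons.IH[OF singular_simplex_back_face[OF \<sigma>]] singular_simplex_front_face[OF \<sigma>, of 1]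
    by (simp add: cup_def restrict_cochain_def singular_simplex_subtopology)
qed

section \<open>Open subspaces and excision\<close>

lemma manifold_open_subspace:
  assumes "manifold n X" "openin X V"
  shows "manifold n (subtopology X V)"
  unfolding manifold_def
proof (intro conjI ballI)
  show "Hausdorff_space (subtopology X V)" "second_countable (subtopology X V)"
    using assms(1) by (auto simp: manifold_def Hausdorff_space_subtopology second_countable_subtopology)
  fix x assume "x \<in> topspace (subtopology X V)"
  then have x: "x \<in> topspace X" "x \<in> V" by auto
  then obtain A W where A: "openin X A" "x \<in> A" "openin (Euclidean_space n) W"
     "subtopology X A homeomorphic_space subtopology (Euclidean_space n) W"
    using assms unfolding manifold_def by blast
  let ?E = "subtopology (Euclidean_space n) W"
  obtain f where f: "homeomorphic_map (subtopology X A) ?E f"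
    using A(4) unfolding homeomorphic_space by blast
  have Atop: "topspace (subtopology X A) = A" and Wtop: "topspace ?E = W"
    using openin_subset[OF A(1)] openin_subset[OF A(3)] by auto
  have fA: "f ` A = W" using homeomorphic_imp_surjective_map[OF f] Atop Wtop by simp
  have "openin (subtopology X A) (V \<inter> A)" using assms(2) by (simp add: openin_subtopology_Int)
  then have "openin ?E (f ` (V \<inter> A))"
    using homeomorphic_map_openness[OF f, of "V \<inter> A"] Atop by blast
  then have 1: "openin (Euclidean_space n) (f ` (V \<inter> A))"
    using A(3) openin_trans_full by blast
  have "homeomorphic_map (subtopology (subtopology X A) (V \<inter> A)) (subtopology ?E (f ` (V \<inter> A))) f"
  proof (rule homeomorphic_map_subtopologies[OF f])
    show "f ` (topspace (subtopology X A) \<inter> (V \<inter> A)) = topspace ?E \<inter> f ` (V \<inter> A)"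
      unfolding Atop Wtop using fA by blast
  qed
  then have "subtopology (subtopology X A) (V \<inter> A) homeomorphic_space subtopology ?E (f ` (V \<inter> A))"
    using homeomorphic_map_imp_homeomorphic_space by blast
  moreover have "subtopology (subtopology X A) (V \<inter> A) = subtopology (subtopology X V) (V \<inter> A)"
    by (simp add: subtopology_subtopology Int_commute Int_left_commute)
  moreover have "subtopology ?E (f ` (V \<inter> A)) = subtopology (Euclidean_space n) (f ` (V \<inter> A))"
  proof -
    have "W \<inter> f ` (V \<inter> A) = f ` (V \<inter> A)" using fA by blast
    then show ?thesis by (simp add: subtopology_subtopology)
  qed
  ultimately have 2: "subtopology (subtopology X V) (V \<inter> A) homeomorphic_space subtopology (Euclidean_space n) (f ` (V \<inter> A))"
    by simp
  have "openin (subtopology X V) (V \<inter> A)" using A(1) by (metis Int_commute openin_subtopology_Int)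
  then show "\<exists>U W. openin (subtopology X V) U \<and> x \<in> U \<and> openin (Euclidean_space n) W \<and>
      subtopology (subtopology X V) U homeomorphic_space subtopology (Euclidean_space n) W"
    using 1 2 x(2) A(2) by blast
qed

section \<open>Exhaustions, and excision of a closed subset\<close>

lemma exhaustion_incseq: "exhaustion X K \<Longrightarrow> incseq K"
  unfolding exhaustion_def by (intro incseq_SucI) (meson interior_of_subset subset_trans)

lemma exhaustion_absorbs_compact:
  assumes K: "exhaustion X K" and C: "compactin X C"
  shows "\<exists>j. C \<subseteq> K j"
proof -
  have "C \<subseteq> \<Union> (range (\<lambda>i. X interior_of K i))"
  proof
    fix x assume "x \<in> C"
    then have "x \<in> (\<Union>i. K i)" using compactin_subset_topspace[OF C] K by (auto simp: exhaustion_def)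
    then show "x \<in> \<Union> (range (\<lambda>i. X interior_of K i))" using K unfolding exhaustion_def by blast
  qed
  moreover have "\<And>U. U \<in> range (\<lambda>i. X interior_of K i) \<Longrightarrow> openin X U" by auto
  ultimately obtain F where F: "finite F" "F \<subseteq> range (\<lambda>i. X interior_of K i)" "C \<subseteq> \<Union>F"
    using compactinD[OF C, of "range (\<lambda>i. X interior_of K i)"] by blast
  then obtain I where I: "finite I" "F = (\<lambda>i. X interior_of K i) ` I" by (meson finite_subset_image)
  have "X interior_of K i \<subseteq> K (Max I)" if "i \<in> I" for i
    using interior_of_subset[of X "K i"] incseqD[OF exhaustion_incseq[OF K] Max_ge[OF I(1) that]] by blast
  then show ?thesis using F(3) I(2) by blast
qed

lemma excision_complement_iso:
  assumes "X closure_of G \<subseteq> X interior_of (topspace X - C)"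
  shows "hom_induced p (subtopology X (topspace X - G)) (topspace X - G - C) X (topspace X - C) id
    \<in> iso (relative_homology_group p (subtopology X (topspace X - G)) (topspace X - G - C))
          (relative_homology_group p X (topspace X - C))"
proof -
  have "topspace X - C - G = topspace X - G - C" by blast
  then show ?thesis using homology_excision_axiom[OF assms, of "topspace X" p] by simp
qed

lemma closed_disjoint_excisive:
  assumes "closedin X G" "closedin X C" "C \<subseteq> topspace X - G"
  shows "X closure_of G \<subseteq> X interior_of (topspace X - C)"
proof -
  have "openin X (topspace X - C)" using assms(2) by auto
  then show ?thesis using assms(1,3) closedin_subset[OF assms(1)] by (auto simp: closure_of_closedin interior_of_openin)
qed

lemma singular_relcycle_imp_chain: "singular_relcycle p X S c \<Longrightarrow> singular_chain p X c"
  by (simp add: singular_relcycle)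

lemma hom_induced_id_homologous_rel_set:
  assumes "continuous_map X Y id" "S \<subseteq> T" "singular_relcycle p X S c"
  shows "hom_induced p X S Y T id (homologous_rel_set p X S c) = homologous_rel_set p Y T c"
proof -
  have "hom_induced p X S Y T id (homologous_rel_set p X S c) = homologous_rel_set p Y T (chain_map p id c)"
    by (rule hom_induced_chain_map) (use assms in auto)
  also have "chain_map p id c = c"
    using assms(3) by (intro chain_map_id_gen[of p X]) (auto simp: singular_relcycle)
  finally show ?thesis .
qed

text \<open>This is injectivity of excision in terms of chains: a bounding chain in the ambient
  space can be exchanged for one in the complement of \<open>G\<close>.\<close>

lemma excision_relboundary:
  assumes ex: "X closure_of G \<subseteq> X interior_of (topspace X - C)"
    and c: "singular_relcycle p (subtopology X (topspace X - G)) (topspace X - G - C) c"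
    and b: "singular_relboundary p X (topspace X - C) c"
  shows "singular_relboundary p (subtopology X (topspace X - G)) (topspace X - G - C) c"
proof -
  let ?Y = "subtopology X (topspace X - G)" and ?S = "topspace X - G - C"
  let ?h = "hom_induced p ?Y ?S X (topspace X - C) id"
  have inj: "inj_on ?h (carrier (relative_homology_group p ?Y ?S))"
    using excision_complement_iso[OF ex, of p] by (auto simp: iso_def bij_betw_def)
  have cont: "continuous_map ?Y X id" "?S \<subseteq> topspace X - C" by (auto simp: continuous_map_from_subtopology)
  have 0: "singular_relcycle p ?Y ?S 0" by simp
  have "?h (homologous_rel_set p ?Y ?S c) = ?h (homologous_rel_set p ?Y ?S 0)"
    unfolding hom_induced_id_homologous_rel_set[OF cont c] hom_induced_id_homologous_rel_set[OF cont 0]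
    unfolding homologous_rel_set_eq
    using b by (simp add: homologous_rel_def)
  then have "homologous_rel_set p ?Y ?S c = homologous_rel_set p ?Y ?S 0"
    by (rule inj_onD[OF inj]) (use c 0 in \<open>auto simp: carrier_relative_homology_group\<close>)
  then show ?thesis unfolding homologous_rel_set_eq by (simp add: homologous_rel_def)
qed

lemma singular_relcycle_mono:
  assumes "singular_relcycle p X S c" "S \<subseteq> T"
  shows "singular_relcycle p X T c"
  using assms singular_chain_mono unfolding singular_relcycle by blast

lemma homologous_rel_mono:
  assumes "homologous_rel p X S a b" "S \<subseteq> T"
  shows "homologous_rel p X T a b"
  using assms singular_chain_mono unfolding homologous_rel_def singular_relboundary by blast

text \<open>The inverse system of chain groups is surjective, so that compatible relative classes lift to a
  coherent sequence of chains.\<close>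

lemma ends_representatives:
  assumes z: "singular_relcycle n X {} z" and G: "closedin X G"
    and K: "incseq K" "\<And>i. closedin X (K i)" "\<And>i. K i \<subseteq> topspace X - G"
  shows "\<exists>x. coherent n (subtopology X (topspace X - G)) K (topspace X - G) x \<and>
    (\<forall>i. singular_relcycle n (subtopology X (topspace X - G)) (topspace X - G - K i) (x i) \<and>
         homologous_rel n X (topspace X - K i) (x i) z)"
proof -
  let ?Y = "subtopology X (topspace X - G)"
  define P where "P i c \<longleftrightarrow> singular_relcycle n ?Y (topspace X - G - K i) c \<and>
      homologous_rel n X (topspace X - K i) c z" for i c
  have ex: "X closure_of G \<subseteq> X interior_of (topspace X - K i)" for i
    by (rule closed_disjoint_excisive[OF G K(2,3)])
  have E: "\<exists>c. P i c" for i
  proof -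
    have "singular_relcycle n (subtopology X (topspace X)) (topspace X - K i) z"
      using singular_relcycle_mono[OF z] by simp
    from excised_relcycle_exists[OF ex[of i] _ this]
    obtain c where "singular_relcycle n ?Y (topspace X - K i - G) c" "homologous_rel n X (topspace X - K i) z c"
      by auto
    moreover have "topspace X - K i - G = topspace X - G - K i" by blast
    ultimately show ?thesis unfolding P_def by (metis homologous_rel_sym)
  qed
  have step: "\<exists>c'. P (Suc i) c' \<and> singular_chain n (subtopology ?Y (topspace X - G - K i)) (c' - c)"
    if c: "P i c" for i c
  proof -
    obtain a where a: "P (Suc i) a" using E by blast
    have sub: "topspace X - G - K (Suc i) \<subseteq> topspace X - G - K i" "topspace X - K (Suc i) \<subseteq> topspace X - K i"
      using incseq_SucD[OF K(1)] by blast+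
    have "singular_relcycle n ?Y (topspace X - G - K i) (a - c)"
      using a c singular_relcycle_mono[OF _ sub(1)] by (auto simp: P_def intro!: singular_relcycle_diff)
    moreover have "homologous_rel n X (topspace X - K i) a c"
      using a c homologous_rel_mono[OF _ sub(2)] homologous_rel_trans homologous_rel_sym unfolding P_def by metis
    ultimately have "singular_relboundary n ?Y (topspace X - G - K i) (a - c)"
      using excision_relboundary[OF ex] by (simp add: homologous_rel_def)
    then obtain d e where de: "singular_chain (Suc n) ?Y d"
      "singular_chain n (subtopology ?Y (topspace X - G - K i)) e" "chain_boundary (Suc n) d + e = a - c"
      unfolding singular_relboundary by blast
    \<comment> \<open>Subtracting a boundary leaves the class of \<open>a\<close> unchanged. What
      remains of the difference to the previous stage is \<open>e\<close>, which lies off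
      \<open>K i\<close>, as coherence permits.\<close>
    let ?c = "a - chain_boundary (Suc n) d"
    have bd: "singular_relboundary n ?Y {} (chain_boundary (Suc n) d)"
      using de(1) by (auto simp: singular_boundary)
    have "singular_relcycle n ?Y (topspace X - G - K (Suc i)) ?c"
      using a singular_relcycle_mono[OF singular_relboundary_imp_relcycle[OF bd] empty_subsetI]
      by (auto simp: P_def intro!: singular_relcycle_diff)
    moreover have "homologous_rel n X (topspace X - K (Suc i)) ?c z"
    proof -
      have "singular_relboundary n X {} (chain_boundary (Suc n) d)"
        using de(1) by (auto simp: singular_boundary singular_chain_subtopology)
      then have "homologous_rel n X {} ?c a"
        using singular_relboundary_minus by (fastforce simp: homologous_rel_def)
      then have "homologous_rel n X (topspace X - K (Suc i)) ?c a" by (rule homologous_rel_mono) simp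
      then show ?thesis using a homologous_rel_trans unfolding P_def by metis
    qed
    moreover have "?c - c = e" using de(3) by (simp add: algebra_simps)
    ultimately show ?thesis using de(2) unfolding P_def by blast
  qed
  obtain x where "\<And>i. P i (x i)" "\<And>i. singular_chain n (subtopology ?Y (topspace X - G - K i)) (x (Suc i) - x i)"
    using dependent_nat_choice[of P "\<lambda>i c c'. singular_chain n (subtopology ?Y (topspace X - G - K i)) (c' - c)"]
      E step by metis
  then have "coherent n ?Y K (topspace X - G) x" "\<And>i. P i (x i)"
    unfolding coherent_def P_def by (auto dest: singular_relcycle_imp_chain)
  then show ?thesis unfolding P_def by blast
qed

text \<open>At a point the local homology groups of the open subspace and of the whole space are
  isomorphic by excision, and the generator is pulled back. For local consistency excision is also
  needed for neighbourhoods \<open>U\<close>, which requires a closed set between \<open>U\<close>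
  and the subspace; regularity provides it.\<close>

lemma orientation_open_subspace:
  assumes \<mu>: "orientation n X \<mu>" and G: "closedin X G" and X: "Hausdorff_space X" "regular_space X"
  shows "\<exists>\<mu>'. orientation n (subtopology X (topspace X - G)) \<mu>' \<and>
    (\<forall>y \<in> topspace X - G. \<mu>' y \<in> carrier (relative_homology_group (int n) (subtopology X (topspace X - G)) (topspace X - G - {y})) \<and>
      hom_induced (int n) (subtopology X (topspace X - G)) (topspace X - G - {y}) X (topspace X - {y}) id (\<mu>' y) = \<mu> y)"
proof -
  define V where "V = topspace X - G"
  define Y where "Y = subtopology X V"
  have Vop: "openin X V" using G by (auto simp: V_def)
  have Ytop: "topspace Y = V" by (auto simp: Y_def V_def)
  define h where "h A = hom_induced (int n) Y (V - A) X (topspace X - A) id" for A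
  define H where "H A = relative_homology_group (int n) Y (V - A)" for A
  define H' where "H' A = relative_homology_group (int n) X (topspace X - A)" for A
  have cl: "closedin X {y}" if "y \<in> V" for y
    using that X(1) by (simp add: V_def closedin_Hausdorff_singleton)
  have h: "h A \<in> iso (H A) (H' A)" if "A \<subseteq> C" "closedin X C" "C \<subseteq> V" for A C
  proof -
    have "X closure_of G \<subseteq> X interior_of (topspace X - C)"
      using closed_disjoint_excisive[OF G that(2)] that(3) by (simp add: V_def)
    also have "\<dots> \<subseteq> X interior_of (topspace X - A)" using that(1) by (intro interior_of_mono) blast
    finally show ?thesis using excision_complement_iso unfolding h_def H_def H'_def Y_def V_def by blast
  qed
  have hy: "h {y} \<in> iso (H {y}) (H' {y})" if "y \<in> V" for y
    by (rule h[of _ "{y}"]) (use cl that in auto)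
  define \<mu>' where "\<mu>' y = inv_into (carrier (H {y})) (h {y}) (\<mu> y)" for y
  have \<mu>1: "\<mu> y \<in> carrier (H' {y})" "generate (H' {y}) {\<mu> y} = carrier (H' {y})" if "y \<in> V" for y
    using \<mu> that by (auto simp: orientation_def H'_def V_def)
  have \<mu>': "\<mu>' y \<in> carrier (H {y})" "h {y} (\<mu>' y) = \<mu> y" if "y \<in> V" for y
  proof -
    have "\<mu> y \<in> h {y} ` carrier (H {y})" using hy[OF that] \<mu>1(1)[OF that] by (simp add: iso_def bij_betw_def)
    then show "\<mu>' y \<in> carrier (H {y})" "h {y} (\<mu>' y) = \<mu> y"
      unfolding \<mu>'_def by (rule inv_into_into, rule f_inv_into_f)
  qed
  have gen: "generate (H {y}) {\<mu>' y} = carrier (H {y})" if y: "y \<in> V" for y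
  proof -
    interpret group_hom "H {y}" "H' {y}" "h {y}"
      using hy[OF y] by (simp add: group_hom_def group_hom_axioms_def iso_def H_def H'_def)
    have "h {y} ` generate (H {y}) {\<mu>' y} = generate (H' {y}) (h {y} ` {\<mu>' y})"
      by (rule generate_img[symmetric]) (use \<mu>'[OF y] in simp)
    also have "\<dots> = h {y} ` carrier (H {y})"
      using \<mu>'[OF y] \<mu>1[OF y] hy[OF y] by (simp add: iso_def bij_betw_def)
    finally have "h {y} ` generate (H {y}) {\<mu>' y} = h {y} ` carrier (H {y})" .
    moreover have "inj_on (h {y}) (carrier (H {y}))" using hy[OF y] by (simp add: iso_def bij_betw_def)
    ultimately show ?thesis
      using G.generate_incl[of "{\<mu>' y}"] \<mu>'(1)[OF y] by (simp add: inj_on_image_eq_iff)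
  qed
  have idc: "continuous_map Y X id" "continuous_map Y Y id" "continuous_map X X id"
    by (auto simp: Y_def continuous_map_from_subtopology)
  have nb: "\<exists>U C. openin X U \<and> closedin X C \<and> x \<in> U \<and> U \<subseteq> C \<and> C \<subseteq> W"
    if "openin X W" "x \<in> W" for W x
    using X(2) that unfolding neighbourhood_base_of_closedin[symmetric] neighbourhood_base_of by blast
  have loc: "\<exists>U. openin Y U \<and> y \<in> U \<and> (\<exists>\<alpha> \<in> carrier (H U). \<forall>w \<in> U.
      hom_induced (int n) Y (V - U) Y (V - {w}) id \<alpha> = \<mu>' w)" if y: "y \<in> V" for y
  proof -
    have yX: "y \<in> topspace X" using y by (simp add: V_def)
    obtain U0 \<alpha>0 where U0: "openin X U0" "y \<in> U0" "\<alpha>0 \<in> carrier (relative_homology_group (int n) X (topspace X - U0))"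
      "\<And>w. w \<in> U0 \<Longrightarrow> hom_induced (int n) X (topspace X - U0) X (topspace X - {w}) id \<alpha>0 = \<mu> w"
      using \<mu> yX unfolding orientation_def by meson
    have "openin X (U0 \<inter> V)" "y \<in> U0 \<inter> V" using U0 Vop y by auto
    \<comment> \<open>The neighbourhood on which the orientation is consistent may come arbitrarily
      close to \<open>G\<close>. The closed set \<open>C\<close> keeps the smaller \<open>U\<close>
      away from \<open>G\<close>, so that \<open>h U\<close> is an isomorphism.\<close>
    then obtain U C where UC: "openin X U" "closedin X C" "y \<in> U" "U \<subseteq> C" "C \<subseteq> U0 \<inter> V"
      using nb[of "U0 \<inter> V" y] by blast
    define \<alpha>1 where "\<alpha>1 = hom_induced (int n) X (topspace X - U0) X (topspace X - U) id \<alpha>0"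
    have "\<alpha>1 \<in> carrier (H' U)" unfolding \<alpha>1_def H'_def by (rule hom_induced_carrier)
    moreover have "h U \<in> iso (H U) (H' U)" by (rule h[OF UC(4,2)]) (use UC(5) in blast)
    ultimately have "\<alpha>1 \<in> h U ` carrier (H U)" by (simp add: iso_def bij_betw_def)
    then obtain \<alpha> where \<alpha>: "\<alpha> \<in> carrier (H U)" "h U \<alpha> = \<alpha>1" by blast
    have "hom_induced (int n) Y (V - U) Y (V - {w}) id \<alpha> = \<mu>' w" if w: "w \<in> U" for w
    proof -
      have wV: "w \<in> V" "w \<in> U0" using w UC by auto
      let ?r = "hom_induced (int n) Y (V - U) Y (V - {w}) id \<alpha>"
      \<comment> \<open>Both candidates for the local class at \<open>w\<close> are compared after
        mapping to the local homology of \<open>X\<close>, where \<open>h {w}\<close> is injective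
        and the consistency of \<mu> is known.\<close>
      have "h {w} ?r = hom_induced (int n) Y (V - U) X (topspace X - {w}) (id \<circ> id) \<alpha>"
        unfolding h_def by (rule hom_induced_compose') (use idc w in \<open>auto simp: V_def\<close>)
      also have "\<dots> = hom_induced (int n) X (topspace X - U) X (topspace X - {w}) id (h U \<alpha>)"
        unfolding h_def by (rule hom_induced_compose'[symmetric]) (use idc w in \<open>auto simp: V_def\<close>)
      also have "\<dots> = hom_induced (int n) X (topspace X - U0) X (topspace X - {w}) (id \<circ> id) \<alpha>0"
        unfolding \<alpha>(2) \<alpha>1_def by (rule hom_induced_compose') (use idc w UC in auto)
      also have "\<dots> = h {w} (\<mu>' w)" using U0(4)[OF wV(2)] \<mu>'(2)[OF wV(1)] by simp
      finally have "h {w} ?r = h {w} (\<mu>' w)" .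
      moreover have "?r \<in> carrier (H {w})" unfolding H_def by (rule hom_induced_carrier)
      ultimately show ?thesis
        using hy[OF wV(1)] \<mu>'(1)[OF wV(1)] by (auto simp: iso_def bij_betw_def dest: inj_onD)
    qed
    moreover have "openin Y U" using UC(1,4,5) unfolding Y_def openin_subtopology by blast
    ultimately show ?thesis using UC(3) \<alpha>(1) by blast
  qed
  have "orientation n Y \<mu>'"
    unfolding orientation_def Ytop
    by (intro conjI ballI \<mu>'(1)[unfolded H_def] gen[unfolded H_def] loc[unfolded H_def])
  then show ?thesis
    using \<mu>'[unfolded h_def H_def] unfolding Y_def V_def by (intro exI[of _ \<mu>']) simp
qed

section \<open>Spherical classes and the complement of a submanifold\<close>

lemma compact_neighbourhood_homology_from_subspace:
  assumes X: "compact_space X" "Hausdorff_space X" "second_countable X" "locally_contractible X"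
    and \<Gamma>: "compactin X \<Gamma>" "locally_contractible (subtopology X \<Gamma>)"
  shows "\<exists>W. openin X W \<and> \<Gamma> \<subseteq> W \<and>
    (\<forall>z. singular_relcycle 2 (subtopology X W) {} z \<longrightarrow>
      (\<exists>y. singular_relcycle 2 (subtopology X \<Gamma>) {} y \<and> homologous_rel 2 X {} z y))"
proof -
  obtain M d where M: "Metric_space M d" "X = Metric_space.mtopology M d"
    using compact_Hausdorff_second_countable_imp_metrizable[OF X(1-3)] unfolding metrizable_space_def by blast
  interpret Metric_space M d by (rule M(1))
  show ?thesis
    using neighbourhood_homology_from_subspace X(1,4) \<Gamma> unfolding M(2) by blast
qed

section \<open>Spherical classes and homologous chains\<close>

lemma hurewicz_image_subset_carrier: "hurewicz_image X \<subseteq> carrier (homology_group 2 X)"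
  unfolding hurewicz_image_def
  by (rule group.generate_incl) (auto intro: hom_induced_carrier)

lemma hom_induced_hurewicz_image:
  assumes f: "continuous_map X Y f" and s: "s \<in> hurewicz_image X"
  shows "hom_induced 2 X {} Y {} f s \<in> hurewicz_image Y"
proof -
  let ?S = "\<lambda>X. {hom_induced 2 (nsphere 2) {} X {} g s | g s.
        continuous_map (nsphere 2) X g \<and> s \<in> carrier (homology_group 2 (nsphere 2)) \<and>
        generate (homology_group 2 (nsphere 2)) {s} = carrier (homology_group 2 (nsphere 2))}"
  let ?h = "hom_induced 2 X {} Y {} f"
  interpret group_hom "homology_group 2 X" "homology_group 2 Y" ?h
    by (simp add: group_hom_def group_hom_axioms_def hom_induced_hom)
  have "?h ` ?S X \<subseteq> ?S Y"
  proof clarify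
    fix g s assume g: "continuous_map (nsphere 2) X g" and s: "s \<in> carrier (homology_group 2 (nsphere 2))"
      "generate (homology_group 2 (nsphere 2)) {s} = carrier (homology_group 2 (nsphere 2))"
    have "?h (hom_induced 2 (nsphere 2) {} X {} g s) = hom_induced 2 (nsphere 2) {} Y {} (f \<circ> g) s"
      by (rule hom_induced_compose') (use f g in auto)
    then show "\<exists>g' s'. ?h (hom_induced 2 (nsphere 2) {} X {} g s) = hom_induced 2 (nsphere 2) {} Y {} g' s' \<and>
        continuous_map (nsphere 2) Y g' \<and> s' \<in> carrier (homology_group 2 (nsphere 2)) \<and>
        generate (homology_group 2 (nsphere 2)) {s'} = carrier (homology_group 2 (nsphere 2))"
      using continuous_map_compose[OF g f] s by blast
  qed
  then have "generate (homology_group 2 Y) (?h ` ?S X) \<subseteq> hurewicz_image Y"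
    unfolding hurewicz_image_def by (rule H.mono_generate)
  moreover have "?h ` generate (homology_group 2 X) (?S X) = generate (homology_group 2 Y) (?h ` ?S X)"
    by (rule generate_img[symmetric]) (auto intro: hom_induced_carrier)
  ultimately show ?thesis using s unfolding hurewicz_image_def by blast
qed

lemma homologous_rel_set_add:
  "homologous_rel_set p X S (a + b) =
    homologous_rel_set p X S a \<otimes>\<^bsub>relative_homology_group (int p) X S\<^esub> homologous_rel_set p X S b"
proof -
  have "\<exists>r. homologous_rel p X S a r \<and> (\<exists>s. homologous_rel p X S b s \<and> c = r + s)"
    if "homologous_rel p X S (a + b) c" for c
    using that by (intro exI[of _ a] conjI exI[of _ "c - a"]) (auto simp: homologous_rel_def algebra_simps)
  then show ?thesis
    unfolding mult_relative_homology_group by (auto intro: homologous_rel_add)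
qed

lemma homologous_rel_subtopology:
  assumes "homologous_rel p (subtopology X S) A a b" "A \<subseteq> B"
  shows "homologous_rel p X B a b"
  using assms(1) singular_chain_mono[OF _ assms(2)]
  unfolding homologous_rel_def singular_relboundary
  by (metis Int_lower2 assms(2) singular_chain_mono singular_chain_subtopology_imp subset_trans subtopology_subtopology)

lemma homologous_rel_cap:
  assumes hom: "homologous_rel (k + l) X S a b" and \<phi>: "coboundary k X \<phi> = (\<lambda>_. 0)"
  shows "homologous_rel l X S (cap (k + l) k a \<phi>) (cap (k + l) k b \<phi>)"
proof -
  obtain d e where de: "singular_chain (Suc (k + l)) X d" "singular_chain (k + l) (subtopology X S) e"
     "chain_boundary (Suc (k + l)) d + e = a - b"
    using hom unfolding homologous_rel_def singular_relboundary by blast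
  have "cap (k + l) k a \<phi> - cap (k + l) k b \<phi> =
     chain_boundary (Suc l) (frag_cmul ((-1) ^ k) (cap (Suc (k + l)) k d \<phi>)) + cap (k + l) k e \<phi>"
    using cap_chain_boundary[OF de(1), of \<phi>] \<phi>
    by (simp add: cap_diff[symmetric] de(3)[symmetric] cap_add chain_boundary_cmul)
  moreover have "singular_chain (Suc l) X (frag_cmul ((-1) ^ k) (cap (Suc (k + l)) k d \<phi>))"
    using singular_chain_cap[OF de(1), of k \<phi>] by (simp add: singular_chain_cmul Suc_diff_le)
  moreover have "singular_chain l (subtopology X S) (cap (k + l) k e \<phi>)"
    using singular_chain_cap[OF de(2), of k \<phi>] by simp
  ultimately show ?thesis unfolding homologous_rel_def singular_relboundary by metis
qed

text \<open>Membership in the homology group says that the union over all representatives is a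
  single coset. As it contains the cap product of the given representatives, it is the coset of that
  chain. For \<tau> this membership is part of being aspherical.\<close>

lemma cap_class_eq:
  assumes carr: "cap_class n k X (homologous_rel_set n X {} z) (cohomology_class k X {} \<phi>) \<in> carrier (homology_group (int (n - k)) X)"
  shows "cap_class n k X (homologous_rel_set n X {} z) (cohomology_class k X {} \<phi>) =
    homologous_rel_set (n - k) X {} (cap n k z \<phi>)"
proof -
  let ?\<tau> = "cap_class n k X (homologous_rel_set n X {} z) (cohomology_class k X {} \<phi>)"
  obtain t where t: "?\<tau> = homologous_rel_set (n - k) X {} t"
    using carr unfolding carrier_relative_homology_group by blast
  have "cap n k z \<phi> \<in> ?\<tau>"
    unfolding cap_class_def using cohomology_class_self[of \<phi> k X]
    by (auto intro!: exI[of _ z] bexI[of _ \<phi>])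
  then show ?thesis unfolding t homologous_rel_set_eq by simp
qed

text \<open>The local condition at a point is checked in the whole space, where \<open>x i\<close>
  may be replaced by \<open>z\<close> as soon as \<open>K i\<close> contains the point, and is
  carried back by injectivity of excision.\<close>

lemma ends_fundamental_class_open_subspace:
  assumes X: "Hausdorff_space X" and G: "closedin X G"
    and z: "\<And>y. y \<in> topspace X \<Longrightarrow> homologous_rel_set n X (topspace X - {y}) z = \<mu> y"
    and \<mu>': "\<And>y. y \<in> topspace X - G \<Longrightarrow>
      \<mu>' y \<in> carrier (relative_homology_group (int n) (subtopology X (topspace X - G)) (topspace X - G - {y})) \<and>
      hom_induced (int n) (subtopology X (topspace X - G)) (topspace X - G - {y}) X (topspace X - {y}) id (\<mu>' y) = \<mu> y"
    and K: "exhaustion (subtopology X (topspace X - G)) K"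
    and x: "coherent n (subtopology X (topspace X - G)) K (topspace X - G) x"
      "\<And>i. singular_relcycle n (subtopology X (topspace X - G)) (topspace X - G - K i) (x i)"
      "\<And>i. homologous_rel n X (topspace X - K i) (x i) z"
  shows "ends_fundamental_class n (subtopology X (topspace X - G)) K \<mu>'
    (ends_class n (subtopology X (topspace X - G)) K (topspace X - G) x)"
proof -
  define V where "V = topspace X - G"
  define Y where "Y = subtopology X V"
  have Ytop: "topspace Y = V" by (auto simp: Y_def V_def)
  note x' = x(1,2)[folded V_def, folded Y_def]
  have mono: "incseq K" using exhaustion_incseq[OF K] .
  have cont: "continuous_map Y X id" by (auto simp: Y_def continuous_map_from_subtopology)
  have "restricted_class n Y K V {y} (ends_class n Y K V x) = \<mu>' y" if y: "y \<in> V" for y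
  proof -
    have "y \<in> (\<Union>i. K i)" using K y by (simp add: exhaustion_def V_def[symmetric] Y_def[symmetric] Ytop)
    then obtain j where "V - K j \<subseteq> topspace Y - {y}" unfolding Ytop by blast
    from restricted_class_ends_class[OF mono x'(2) this]
    obtain i where i: "V - K i \<subseteq> V - {y}"
      "restricted_class n Y K V {y} (ends_class n Y K V x) = homologous_rel_set n Y (V - {y}) (x i)"
      unfolding Ytop by blast
    let ?h = "hom_induced (int n) Y (V - {y}) X (topspace X - {y}) id"
    have cl: "closedin X {y}" "{y} \<subseteq> topspace X - G"
      using y X by (auto simp: V_def closedin_Hausdorff_singleton)
    have inj: "inj_on ?h (carrier (relative_homology_group (int n) Y (V - {y})))"
      using excision_complement_iso[OF closed_disjoint_excisive[OF G cl], of n]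
      by (simp add: iso_def bij_betw_def Y_def V_def)
    have cyc: "singular_relcycle n Y (V - {y}) (x i)"
      using singular_relcycle_mono[OF x'(2) i(1)] .
    have "?h (homologous_rel_set n Y (V - {y}) (x i)) = homologous_rel_set n X (topspace X - {y}) (x i)"
      by (rule hom_induced_id_homologous_rel_set[OF cont _ cyc]) (auto simp: V_def)
    also have "\<dots> = homologous_rel_set n X (topspace X - {y}) z"
      unfolding homologous_rel_set_eq
      by (rule homologous_rel_mono[OF x(3)[of i]]) (use i(1) y in auto)
    also have "\<dots> = ?h (\<mu>' y)" using z \<mu>'[of y] y by (simp add: V_def Y_def)
    finally have "?h (homologous_rel_set n Y (V - {y}) (x i)) = ?h (\<mu>' y)" .
    then have "homologous_rel_set n Y (V - {y}) (x i) = \<mu>' y"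
      by (rule inj_onD[OF inj]) (use cyc \<mu>'[of y] y in \<open>auto simp: carrier_relative_homology_group V_def Y_def\<close>)
    then show ?thesis using i(2) by simp
  qed
  moreover have "ends_class n Y K V x \<in> carrier (ends_homology_group n Y K V)"
    unfolding carrier_ends_homology_group[OF mono] using x' by blast
  ultimately have "ends_fundamental_class n Y K \<mu>' (ends_class n Y K V x)"
    by (simp add: ends_fundamental_class_def Ytop)
  then show ?thesis by (simp add: Y_def V_def)
qed

text \<open>The contrapositive of what the theorem needs: strong sphericity on the complement forces
  the class on the whole space into the excluded subgroup. \<Phi> and \<Psi> are the product
  cocycles on the whole space and on the complement, \<open>z\<close> is a fundamental cycle, and
  \<open>x i\<close> are its stages on the complement.\<close>

lemma ends_cap_class_not_strongly_spherical:
  assumes X: "compact_space X" and \<Gamma>: "closedin X \<Gamma>" and W: "openin X W" "\<Gamma> \<subseteq> W"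
    and W\<Gamma>: "\<And>c. singular_relcycle 2 (subtopology X W) {} c \<Longrightarrow>
      \<exists>y. singular_relcycle 2 (subtopology X \<Gamma>) {} y \<and> homologous_rel 2 X {} c y"
    and K: "exhaustion (subtopology X (topspace X - \<Gamma>)) K"
    and z: "singular_relcycle (k + 2) X {} z" and \<Phi>: "coboundary k X \<Phi> = (\<lambda>_. 0)"
    and \<Psi>: "\<And>\<sigma>. singular_simplex k (subtopology X (topspace X - \<Gamma>)) \<sigma> \<Longrightarrow> \<Psi> \<sigma> = \<Phi> \<sigma>"
    and x: "\<And>i. singular_chain (k + 2) (subtopology X (topspace X - \<Gamma>)) (x i)"
      "\<And>i. homologous_rel (k + 2) X (topspace X - K i) (x i) z"
    and cyc: "\<And>i. singular_relcycle 2 (subtopology X (topspace X - \<Gamma>)) (topspace X - \<Gamma> - K i) (cap (k + 2) k (x i) \<Psi>)"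
    and strong: "strongly_spherical (subtopology X (topspace X - \<Gamma>)) K (topspace X - \<Gamma>)
      (ends_class 2 (subtopology X (topspace X - \<Gamma>)) K (topspace X - \<Gamma>) (\<lambda>i. cap (k + 2) k (x i) \<Psi>))"
  shows "homologous_rel_set 2 X {} (cap (k + 2) k z \<Phi>) \<in> generate (homology_group 2 X)
    (hom_induced 2 (subtopology X \<Gamma>) {} X {} id ` carrier (homology_group 2 (subtopology X \<Gamma>)) \<union> hurewicz_image X)"
proof -
  define V where "V = topspace X - \<Gamma>"
  define Y where "Y = subtopology X V"
  have Ytop: "topspace Y = V" by (auto simp: Y_def V_def)
  note K' = K[folded V_def, folded Y_def] and x' = x(1)[folded V_def, folded Y_def]
    and cyc' = cyc[folded V_def, folded Y_def] and strong' = strong[folded V_def, folded Y_def]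
  have mono: "incseq K" using exhaustion_incseq[OF K] .
  \<comment> \<open>The complement of \<open>V\<close> in \<open>Y\<close> is empty, so the
    condition on a test set reduces to compactness of its closure. This set is compact because it is
    closed in the compact space \<open>X\<close>, and it avoids \<open>\<Gamma>\<close>.\<close>
  define \<Omega> where "\<Omega> = topspace X - W"
  have W': "W \<subseteq> topspace X" "topspace X - \<Omega> = W" using openin_subset[OF W(1)] by (auto simp: \<Omega>_def)
  have \<Omega>V: "\<Omega> \<subseteq> V" using W(2) by (auto simp: \<Omega>_def V_def)
  have cl: "closedin X \<Omega>" using W(1) by (auto simp: \<Omega>_def)
  then have cl': "closedin Y \<Omega>" using \<Omega>V by (simp add: Y_def closedin_subset_topspace)
  have comp: "compactin Y \<Omega>"
    using closedin_compact_space[OF X cl] \<Omega>V by (simp add: Y_def compactin_subtopology)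
  obtain j where "\<Omega> \<subseteq> K j" using exhaustion_absorbs_compact[OF K' comp] by blast
  then have "V - K j \<subseteq> topspace Y - \<Omega>" unfolding Ytop by blast
  from restricted_class_ends_class[OF mono cyc' this]
  obtain i where i: "V - K i \<subseteq> V - \<Omega>"
    "restricted_class 2 Y K V \<Omega> (ends_class 2 Y K V (\<lambda>i. cap (k + 2) k (x i) \<Psi>)) =
       homologous_rel_set 2 Y (V - \<Omega>) (cap (k + 2) k (x i) \<Psi>)"
    unfolding Ytop by blast
  have "compactin Y (Y closure_of sym_diff \<Omega> (topspace Y - V))"
    using comp cl' by (simp add: Ytop closure_of_closedin)
  then have "homologous_rel_set 2 Y (V - \<Omega>) (cap (k + 2) k (x i) \<Psi>) \<in>
      hom_induced 2 Y {} Y (V - \<Omega>) id ` hurewicz_image Y"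
    using strong' cl' i(2) unfolding strongly_spherical_def Ytop by metis
  then obtain s where s: "s \<in> hurewicz_image Y"
    "homologous_rel_set 2 Y (V - \<Omega>) (cap (k + 2) k (x i) \<Psi>) = hom_induced 2 Y {} Y (V - \<Omega>) id s" by blast
  have "s \<in> carrier (homology_group (int 2) Y)" using s(1) hurewicz_image_subset_carrier by auto
  then obtain s0 where s0: "s = homologous_rel_set 2 Y {} s0" "singular_relcycle 2 Y {} s0"
    unfolding carrier_relative_homology_group by blast
  have "hom_induced (int 2) Y {} Y (V - \<Omega>) id s = homologous_rel_set 2 Y (V - \<Omega>) s0"
    unfolding s0(1) by (rule hom_induced_id_homologous_rel_set) (use s0 in auto)
  then have "homologous_rel 2 Y (V - \<Omega>) (cap (k + 2) k (x i) \<Psi>) s0"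
    using s(2) by (simp add: homologous_rel_set_eq[symmetric])
  then have 1: "homologous_rel 2 X W (cap (k + 2) k (x i) \<Psi>) s0"
    unfolding Y_def by (rule homologous_rel_subtopology) (auto simp: V_def \<Omega>_def)
  \<comment> \<open>On passing to the ambient space the cochain is exchanged without changing the
    chain. Then \<open>x i\<close> is exchanged for \<open>z\<close> at the cost of chains off
    \<open>K i\<close>; these lie in \<open>W\<close> because \<Omega> is contained in
    \<open>K i\<close>.\<close>
  have "cap (k + 2) k (x i) \<Psi> = cap (k + 2) k (x i) \<Phi>"
    by (rule cap_cong[OF x']) (use \<Psi> in \<open>auto simp: V_def Y_def\<close>)
  moreover have "homologous_rel 2 X W (cap (k + 2) k (x i) \<Phi>) (cap (k + 2) k z \<Phi>)"
  proof (rule homologous_rel_mono[OF homologous_rel_cap[OF x(2) \<Phi>]])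
    show "topspace X - K i \<subseteq> W" using i(1) \<Omega>V unfolding \<Omega>_def by blast
  qed
  ultimately have "homologous_rel 2 X W (cap (k + 2) k z \<Phi>) s0"
    using 1 homologous_rel_trans homologous_rel_sym by metis
  then obtain d e where de: "singular_chain (Suc 2) X d" "singular_chain 2 (subtopology X W) e"
    "chain_boundary (Suc 2) d + e = cap (k + 2) k z \<Phi> - s0"
    unfolding homologous_rel_def singular_relboundary by blast
  have s0X: "singular_relcycle 2 X {} s0"
    using s0(2) by (auto simp: singular_cycle Y_def singular_chain_subtopology)
  have zX: "singular_relcycle 2 X {} (cap (k + 2) k z \<Phi>)"
    using singular_relcycle_cap[of k 1 X "{}" z \<Phi>] z \<Phi> by (simp add: numeral_2_eq_2)
  \<comment> \<open>The error \<open>e\<close> is the difference of two absolute cycles and a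
    boundary, hence an absolute cycle in \<open>W\<close>. It can therefore be moved into
    \<open>\<Gamma>\<close>, which turns a relation modulo \<open>W\<close> into one in
    \<open>H_2(X)\<close>.\<close>
  have "chain_boundary 2 e = chain_boundary 2 (cap (k + 2) k z \<Phi>) - chain_boundary 2 s0 - chain_boundary 2 (chain_boundary (Suc 2) d)"
    unfolding chain_boundary_diff[symmetric] de(3)[symmetric] by simp
  also have "\<dots> = 0"
    using zX s0X chain_boundary_boundary_alt[OF de(1)] by (simp add: singular_cycle)
  finally have "singular_relcycle 2 (subtopology X W) {} e" using de(2) by (simp add: singular_cycle)
  then obtain y where y: "singular_relcycle 2 (subtopology X \<Gamma>) {} y" "homologous_rel 2 X {} e y"
    using W\<Gamma> by blast
  have "homologous_rel 2 X {} (cap (k + 2) k z \<Phi>) (s0 + e)"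
    using de(1,3) unfolding homologous_rel_def singular_boundary
    by (intro exI[of _ d]) (simp add: algebra_simps)
  then have "homologous_rel 2 X {} (cap (k + 2) k z \<Phi>) (s0 + y)"
    using homologous_rel_add[OF homologous_rel_refl y(2)] homologous_rel_trans by blast
  then have "homologous_rel_set 2 X {} (cap (k + 2) k z \<Phi>) = homologous_rel_set 2 X {} (s0 + y)"
    unfolding homologous_rel_set_eq .
  also have "\<dots> = homologous_rel_set 2 X {} s0 \<otimes>\<^bsub>homology_group 2 X\<^esub> homologous_rel_set 2 X {} y"
    using homologous_rel_set_add[of 2 X "{}" s0 y] by simp
  finally have eq: "homologous_rel_set 2 X {} (cap (k + 2) k z \<Phi>) =
      homologous_rel_set 2 X {} s0 \<otimes>\<^bsub>homology_group 2 X\<^esub> homologous_rel_set 2 X {} y" .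
  have contY: "continuous_map Y X id" and cont\<Gamma>: "continuous_map (subtopology X \<Gamma>) X id"
    by (auto simp: Y_def continuous_map_from_subtopology)
  have "homologous_rel_set 2 X {} s0 = hom_induced (int 2) Y {} X {} id s"
    unfolding s0(1) by (rule hom_induced_id_homologous_rel_set[symmetric, OF contY _ s0(2)]) simp
  then have s0h: "homologous_rel_set 2 X {} s0 \<in> hurewicz_image X"
    using hom_induced_hurewicz_image[OF contY s(1)] by simp
  have "homologous_rel_set 2 X {} y = hom_induced (int 2) (subtopology X \<Gamma>) {} X {} id (homologous_rel_set 2 (subtopology X \<Gamma>) {} y)"
    by (rule hom_induced_id_homologous_rel_set[symmetric, OF cont\<Gamma> _ y(1)]) simp
  moreover have "homologous_rel_set 2 (subtopology X \<Gamma>) {} y \<in> carrier (homology_group (int 2) (subtopology X \<Gamma>))"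
    unfolding carrier_relative_homology_group using y(1) by blast
  ultimately have "homologous_rel_set 2 X {} y \<in>
      hom_induced 2 (subtopology X \<Gamma>) {} X {} id ` carrier (homology_group 2 (subtopology X \<Gamma>))" by simp
  then show ?thesis unfolding eq using s0h by (intro generate.eng generate.incl) auto
qed

theorem corollary1p14:
  fixes M :: "'a topology" and n :: nat and \<Gamma> :: "'a set"
    and \<mu> :: "'a \<Rightarrow> 'a chain set" and \<zeta> :: "'a chain set"
    and \<beta>s :: "'a cochain set list" and \<tau> :: "'a chain set"
  assumes "3 \<le> n" and "SYS n M"
    and "orientation n M \<mu>" and "fundamental_class n M \<mu> \<zeta>"
    and "length \<beta>s = n - 2" and "set \<beta>s \<subseteq> carrier (cohomology_group 1 M)"
    and "\<tau> = cap_class n (n - 2) M \<zeta> (cup_list M \<beta>s)"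
    and "aspherical_class M \<tau>"
    and "closed_embedded_submanifold M \<Gamma>"
    and "\<tau> \<notin> generate (homology_group 2 M)
           (hom_induced 2 (subtopology M \<Gamma>) {} M {} id ` carrier (homology_group 2 (subtopology M \<Gamma>))
            \<union> hurewicz_image M)"
  shows "weakly_SYS n (subtopology M (topspace M - \<Gamma>))"
proof -
  \<comment> \<open>The product has \<open>Suc m\<close> factors: one class relative to
    \<open>\<partial>\<^sub>bX\<close> and \<open>m\<close> absolute ones. The remaining 2 is the
    degree of the cap product.\<close>
  obtain m where n: "n = Suc m + 2" using assms(1) that[of "n - 3"] by simp
  define V where "V = topspace M - \<Gamma>"
  define X where "X = subtopology M V"
  have Xtop: "topspace X = V" by (auto simp: X_def V_def)
  have M: "manifold n M" "compact_space M" "Hausdorff_space M" "second_countable M"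
    using assms(2) by (auto simp: SYS_def closed_manifold_def manifold_def)
  have reg: "regular_space M" using M compact_Hausdorff_imp_regular_space by blast
  obtain k where \<Gamma>: "\<Gamma> \<subseteq> topspace M" "manifold k (subtopology M \<Gamma>)" "compact_space (subtopology M \<Gamma>)"
    using assms(9) by (auto simp: closed_embedded_submanifold_def closed_manifold_def)
  have comp\<Gamma>: "compactin M \<Gamma>" using \<Gamma> by (simp add: compactin_subspace)
  then have cl\<Gamma>: "closedin M \<Gamma>" using M(3) compactin_imp_closedin by blast
  obtain W where W: "openin M W" "\<Gamma> \<subseteq> W" "\<And>c. singular_relcycle 2 (subtopology M W) {} c \<Longrightarrow>
      \<exists>y. singular_relcycle 2 (subtopology M \<Gamma>) {} y \<and> homologous_rel 2 M {} c y"
    using compact_neighbourhood_homology_from_subspace[OF M(2-4) manifold_imp_locally_contractible[OF M(1)]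
        comp\<Gamma> manifold_imp_locally_contractible[OF \<Gamma>(2)]] by blast
  obtain z where z: "\<zeta> = homologous_rel_set n M {} z" "singular_relcycle n M {} z"
    using assms(4) unfolding fundamental_class_def carrier_relative_homology_group by blast
  have z\<mu>: "homologous_rel_set n M (topspace M - {y}) z = \<mu> y" if "y \<in> topspace M" for y
    using assms(4) that hom_induced_id_homologous_rel_set[of M M "{}" "topspace M - {y}" n z] z
    by (simp add: fundamental_class_def)
  \<comment> \<open>Phrased with \<open>lists\<close> of an image, this yields cocycle
    representatives for all the classes at once.\<close>
  have "\<beta>s \<in> lists (cohomology_class 1 M {} ` carrier (cocycle_group 1 M {}))"
    using assms(6) unfolding carrier_relative_cohomology_group by auto
  then obtain \<phi>s where \<phi>s: "set \<phi>s \<subseteq> carrier (cocycle_group 1 M {})" "\<beta>s = map (cohomology_class 1 M {}) \<phi>s"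
    unfolding lists_image by (auto simp: lists_eq_set)
  have len: "length \<phi>s = Suc m" using assms(5) \<phi>s(2) n by simp
  define \<Phi> where "\<Phi> = cup_cochain M \<phi>s"
  have \<Phi>: "\<Phi> \<in> carrier (cocycle_group (Suc m) M {})"
    using cup_cochain_cocycle[OF \<phi>s(1)] len by (simp add: \<Phi>_def)
  have \<tau>: "\<tau> = homologous_rel_set 2 M {} (cap n (Suc m) z \<Phi>)"
    using cap_class_eq[of n "Suc m" M z \<Phi>] assms(8) cup_list_cohomology_class[OF \<phi>s(1)]
    unfolding assms(7) z(1) \<phi>s(2) by (simp add: n len \<Phi>_def aspherical_class_def)
  define \<psi>s where "\<psi>s = map (restrict_cochain 1 X) \<phi>s"
  have \<psi>s: "set \<psi>s \<subseteq> carrier (cocycle_group 1 X {})" "length \<psi>s = Suc m"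
    using \<phi>s(1) len by (auto simp: \<psi>s_def X_def intro!: restrict_cochain_cocycle)
  then obtain \<psi> \<psi>t where \<psi>: "\<psi>s = \<psi> # \<psi>t" "length \<psi>t = m" by (auto simp: length_Suc_conv)
  define \<Psi> where "\<Psi> = cup_cochain X \<psi>s"
  have \<Psi>: "\<Psi> \<in> carrier (cocycle_group (Suc m) X {})"
    using cup_cochain_cocycle[OF \<psi>s(1)] \<psi>s(2) by (simp add: \<Psi>_def)
  have \<Psi>\<Phi>: "\<Psi> \<sigma> = \<Phi> \<sigma>" if "singular_simplex (Suc m) X \<sigma>" for \<sigma>
    unfolding \<Psi>_def \<psi>s_def \<Phi>_def X_def by (rule cup_cochain_restrict) (use that len in \<open>simp add: X_def\<close>)
  obtain \<mu>' where \<mu>': "orientation n X \<mu>'"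
    "\<And>y. y \<in> V \<Longrightarrow> \<mu>' y \<in> carrier (relative_homology_group (int n) X (V - {y})) \<and>
      hom_induced (int n) X (V - {y}) M (topspace M - {y}) id (\<mu>' y) = \<mu> y"
    using orientation_open_subspace[OF assms(3) cl\<Gamma> M(3) reg] unfolding X_def V_def by blast
  \<comment> \<open>The orientation has to be fixed before the exhaustion is given. The cocycles do
    not depend on \<open>K\<close> either; only the chains \<open>x\<close> and the classes formed
    from them are chosen for each \<open>K\<close>.\<close>
  have ends: "\<exists>\<zeta>. ends_fundamental_class n X K \<mu>' \<zeta> \<and>
      (\<exists>U \<in> compact_boundary_sets X. \<exists>\<beta>\<^sub>1 \<in> ends_cohomology 1 X K (topspace X - U). \<exists>\<beta>s.
        length \<beta>s = n - 3 \<and> set \<beta>s \<subseteq> carrier (cohomology_group 1 X) \<and>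
        weakly_aspherical X K U (ends_cap_class n (n - 2) X K U \<zeta>
          (ends_cup 1 (n - 3) X K (topspace X - U) \<beta>\<^sub>1 (cup_list X \<beta>s))))"
    if K: "exhaustion X K" for K
  proof -
    have mono: "incseq K" using exhaustion_incseq[OF K] .
    have KV: "K i \<subseteq> topspace M - \<Gamma>" and Kcl: "closedin M (K i)" for i
    proof -
      have "compactin X (K i)" using K by (simp add: exhaustion_def)
      then have "compactin M (K i)" "K i \<subseteq> V" by (simp_all add: X_def compactin_subtopology)
      then show "K i \<subseteq> topspace M - \<Gamma>" "closedin M (K i)"
        using M(3) compactin_imp_closedin by (auto simp: V_def)
    qed
    obtain x where x: "coherent n X K V x" "\<And>i. singular_relcycle n X (V - K i) (x i)"
      "\<And>i. homologous_rel n M (topspace M - K i) (x i) z"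
      using ends_representatives[OF z(2) cl\<Gamma> mono Kcl KV] unfolding X_def V_def by blast
    define \<zeta>' where "\<zeta>' = ends_class n X K V x"
    have fund: "ends_fundamental_class n X K \<mu>' \<zeta>'"
      using ends_fundamental_class_open_subspace[OF M(3) cl\<Gamma> z\<mu>, of \<mu>' K x] \<mu>'(2) K x
      unfolding \<zeta>'_def X_def V_def by blast
    \<comment> \<open>The first class is absolute as well. Since \<open>\<partial>\<^sub>bX\<close>
      is empty it counts as a class relative to it, represented at every stage by the same
      element.\<close>
    define \<beta>1 :: "(nat \<times> 'a cochain set) set" where "\<beta>1 = UNIV \<times> {cohomology_class 1 X {} \<psi>}"
    define \<beta>t where "\<beta>t = map (cohomology_class 1 X {}) \<psi>t"
    have \<psi>c: "\<psi> \<in> carrier (cocycle_group 1 X {})" "set \<psi>t \<subseteq> carrier (cocycle_group 1 X {})"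
      using \<psi>s(1) \<psi>(1) by auto
    have cup: "ends_cup 1 m X K {} \<beta>1 (cup_list X \<beta>t) = UNIV \<times> {cohomology_class (Suc m) X {} \<Psi>}"
      using ends_cup_empty[OF \<psi>c(1) cup_cochain_cocycle[OF \<psi>c(2)], of K]
      unfolding \<beta>1_def \<beta>t_def cup_list_cohomology_class[OF \<psi>c(2)] by (simp add: \<Psi>_def \<psi>)
    define \<tau>' where "\<tau>' = ends_class 2 X K V (\<lambda>i. cap n (Suc m) (x i) \<Psi>)"
    have cap: "ends_cap_class n (Suc m) X K V \<zeta>' (UNIV \<times> {cohomology_class (Suc m) X {} \<Psi>}) = \<tau>'"
      using ends_cap_class_ends_class[OF mono _ _ \<Psi>, of 2 V x] x(1,2) unfolding \<zeta>'_def \<tau>'_def n by blast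
    have cyc: "singular_relcycle 2 X (V - K i) (cap n (Suc m) (x i) \<Psi>)" for i
      using singular_relcycle_cap[of "Suc m" 1 X "V - K i" "x i" \<Psi>] x(2)[of i] \<Psi>
      by (simp add: n mem_cocycle_group numeral_2_eq_2)
    have "coherent 2 X K V (\<lambda>i. cap n (Suc m) (x i) \<Psi>)"
      using coherent_cap[OF x(1), of "Suc m" \<Psi>] by (simp add: n)
    then have carr: "\<tau>' \<in> carrier (ends_homology_group 2 X K V)"
      unfolding \<tau>'_def carrier_ends_homology_group[OF mono] using cyc by blast
    have "\<not> strongly_spherical X K V \<tau>'"
    proof
      assume "strongly_spherical X K V \<tau>'"
      then have "homologous_rel_set 2 M {} (cap n (Suc m) z \<Phi>) \<in> generate (homology_group 2 M)
        (hom_induced 2 (subtopology M \<Gamma>) {} M {} id ` carrier (homology_group 2 (subtopology M \<Gamma>)) \<union> hurewicz_image M)"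
        using ends_cap_class_not_strongly_spherical[OF M(2) cl\<Gamma> W, of K "Suc m" z \<Phi> \<Psi> x]
          K z(2) \<Phi> \<Psi>\<Phi> x cyc
        unfolding \<tau>'_def X_def V_def n by (simp add: mem_cocycle_group coherent_def)
      then show False using assms(10) \<tau> by simp
    qed
    then have wa: "weakly_aspherical X K V \<tau>'" using carr by (simp add: weakly_aspherical_def)
    have "topspace X \<in> compact_boundary_sets X" by (simp add: compact_boundary_sets_def)
    moreover have "\<beta>1 \<in> ends_cohomology 1 X K (topspace X - topspace X)"
      unfolding \<beta>1_def using ends_cohomology_empty[OF cohomology_class_carrier[OF \<psi>c(1)]] by simp
    moreover have "length \<beta>t = n - 3" "set \<beta>t \<subseteq> carrier (cohomology_group 1 X)"
      using \<psi>(2) \<psi>c(2) cohomology_class_carrier by (auto simp: \<beta>t_def n)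
    moreover have "weakly_aspherical X K (topspace X) (ends_cap_class n (n - 2) X K (topspace X) \<zeta>'
          (ends_cup 1 (n - 3) X K (topspace X - topspace X) \<beta>1 (cup_list X \<beta>t)))"
      using wa cap cup by (simp add: Xtop n)
    ultimately show ?thesis using fund by blast
  qed
  have "manifold n X" unfolding X_def V_def
    by (rule manifold_open_subspace[OF M(1)]) (use cl\<Gamma> in auto)
  then have "weakly_SYS n X" unfolding weakly_SYS_def using assms(1) \<mu>'(1) ends by blast
  then show ?thesis by (simp add: X_def V_def)
qed



end
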